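(* Let $n\ge1$, let $B\subset\mathrm{GL}_n(\mathbf{C})$ be the Borel subgroup of invertible upper-triangular matrices, acting by conjugation on the nilpotent cone $\mathcal{N}$ of nilpotent complex $n\times n$ matrices. Then the semi-invariant ring $K[\mathcal{N}]^B_*$ is generated by the $B$-semi-invariants $f^{\mathcal{P}}$, where $\mathcal{P}$ runs through all data $\mathcal{P}=((a_i)_i,(a'_j)_j,(\mathcal{P}_{i,j})_{i,j})$ as defined in the context.
   Context: $K=\mathbf{C}$. A regular function $f\in K[\mathcal{N}]$ is a $B$-semi-invariant of weight $\chi$ (a character of $B$) if $f(gNg^{-1})=\chi(g)f(N)$ for all $g\in B$, $N\in\mathcal{N}$. $K[\mathcal{N}]^B_*$ is the ring formed by the direct sum, over all characters $\chi$ of $B$, of the spaces of semi-invariants of weight $\chi$. For $a,b\in\{0,\dots,n\}$ and an $n\times n$ matrix $N$, $N_{(a,b)}$ denotes the $a\times b$ submatrix formed by the last $a$ rows and the first $b$ columns of $N$. A datum $\mathcal{P}=((a_i)_i,(a'_j)_j,(\mathcal{P}_{i,j})_{i,j})$ consists of positive integers $s,t$, integers $a_1,\dots,a_s,a'_1,\dots,a'_t\in\{1,\dots,n\}$ with $a_1+\dots+a_s=a'_1+\dots+a'_t=:r$, and polynomials $\mathcal{P}_{i,j}(x)\in K[x]$ for $1\le i\le s$, $1\le j\le t$. For $N\in\mathcal{N}$ let $N^{\mathcal{P}}$ be the $r\times r$ block matrix whose $(i,j)$ block is the $a_i\times a'_j$ matrix $\mathcal{P}_{i,j}(N)_{(a_i,a'_j)}$.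 Define $f^{\mathcal{P}}\colon\mathcal{N}\to K$, $f^{\mathcal{P}}(N)=\det(N^{\mathcal{P}})$. The function $f^{\mathcal{P}}$ is a $B$-semi-invariant of weight $\sum_{i=1}^s(\omega_{n-a_i+1}+\dots+\omega_n)-\sum_{j=1}^t(\omega_1+\dots+\omega_{a'_j})$, where $\omega_i(g)=g_{i,i}$ and characters are written additively. *)

theory Defs
  imports
    "Jordan_Normal_Form.Determinant"
    "Jordan_Normal_Form.Gauss_Jordan_Elimination"
    "HOL-Library.FuncSet"
begin

section \<open>Algebras of functions on a set\<close>

text \<open>
  Functions on a set \<open>X\<close> are represented by extensional functions (value \<open>undefined\<close>
  outside \<open>X\<close>), so that equality of functions is equality on \<open>X\<close>.  \<open>gen_alg X G\<close> is the
  unital \<open>\<complex>\<close>-subalgebra of the algebra of all functions on \<open>X\<close> generated by (the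
  restrictions to \<open>X\<close> of) the functions in \<open>G\<close>.
\<close>

inductive_set gen_alg :: "'x set \<Rightarrow> ('x \<Rightarrow> complex) set \<Rightarrow> ('x \<Rightarrow> complex) set"
  for X :: "'x set" and G :: "('x \<Rightarrow> complex) set" where
  gen: "f \<in> G \<Longrightarrow> restrict f X \<in> gen_alg X G"
| const: "(\<lambda>x\<in>X. c) \<in> gen_alg X G"
| add: "f \<in> gen_alg X G \<Longrightarrow> h \<in> gen_alg X G \<Longrightarrow> (\<lambda>x\<in>X. f x + h x) \<in> gen_alg X G"
| mult: "f \<in> gen_alg X G \<Longrightarrow> h \<in> gen_alg X G \<Longrightarrow> (\<lambda>x\<in>X. f x * h x) \<in> gen_alg X G"

definition entry_functions :: "nat \<Rightarrow> (complex mat \<Rightarrow> complex) set" where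
  "entry_functions n = {(\<lambda>A. A $$ (i, j)) | i j. i < n \<and> j < n}"

section \<open>The nilpotent cone and the Borel subgroup\<close>

definition nilpotent_cone :: "nat \<Rightarrow> complex mat set" where
  "nilpotent_cone n = {N \<in> carrier_mat n n. \<exists>k. N ^\<^sub>m k = 0\<^sub>m n n}"

definition borel_subgroup :: "nat \<Rightarrow> complex mat set" where
  "borel_subgroup n = {g \<in> carrier_mat n n. invertible_mat g \<and> upper_triangular g}"

definition conj_act :: "complex mat \<Rightarrow> complex mat \<Rightarrow> complex mat" where
  "conj_act g N = g * N * the (mat_inverse g)"

text \<open>
  The nilpotent cone is a closed subvariety of the affine space of \<open>n \<times> n\<close> matrices, so
  its regular functions are the restrictions of polynomials in the matrix entries.
\<close>

definition nilcone_regular :: "nat \<Rightarrow> (complex mat \<Rightarrow> complex) set" where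
  "nilcone_regular n = gen_alg (nilpotent_cone n) (entry_functions n)"

text \<open>
  The Borel subgroup is closed in \<open>GL\<^sub>n\<close>, whose coordinate ring is generated by the matrix
  entries and the inverse of the determinant.
\<close>

definition borel_regular :: "nat \<Rightarrow> (complex mat \<Rightarrow> complex) set" where
  "borel_regular n =
    gen_alg (borel_subgroup n) (insert (\<lambda>g. inverse (det g)) (entry_functions n))"

definition borel_characters :: "nat \<Rightarrow> (complex mat \<Rightarrow> complex) set" where
  "borel_characters n = {\<chi> \<in> borel_regular n.
     (\<forall>g\<in>borel_subgroup n. \<chi> g \<noteq> 0) \<and>
     (\<forall>g\<in>borel_subgroup n. \<forall>h\<in>borel_subgroup n. \<chi> (g * h) = \<chi> g * \<chi> h)}"

section \<open>Semi-invariants\<close>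

definition semi_invariants :: "nat \<Rightarrow> (complex mat \<Rightarrow> complex) \<Rightarrow> (complex mat \<Rightarrow> complex) set" where
  "semi_invariants n \<chi> = {f \<in> nilcone_regular n.
     \<forall>g\<in>borel_subgroup n. \<forall>N\<in>nilpotent_cone n. f (conj_act g N) = \<chi> g * f N}"

text \<open>
  The direct sum of the spaces of semi-invariants is formed inside the ring of regular
  functions; that the sum of these subspaces is indeed direct is shown in
  \<open>semi_invariants_independent\<close> below.
\<close>

definition semi_invariant_ring :: "nat \<Rightarrow> (complex mat \<Rightarrow> complex) set" where
  "semi_invariant_ring n =
    {(\<lambda>N\<in>nilpotent_cone n. \<Sum>\<chi>\<in>X. F \<chi> N) | X F.
      finite X \<and> X \<subseteq> borel_characters n \<and> (\<forall>\<chi>\<in>X. F \<chi> \<in> semi_invariants n \<chi>)}"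

section \<open>The determinantal functions\<close>

definition corner_submatrix :: "nat \<Rightarrow> nat \<Rightarrow> complex mat \<Rightarrow> complex mat" where
  "corner_submatrix a b N = mat a b (\<lambda>(i, j). N $$ (dim_row N - a + i, j))"

definition poly_at_mat :: "complex poly \<Rightarrow> complex mat \<Rightarrow> complex mat" where
  "poly_at_mat p N = mat (dim_row N) (dim_row N)
     (\<lambda>(i, j). \<Sum>k\<le>degree p. coeff p k * (N ^\<^sub>m k) $$ (i, j))"

text \<open>
  For block sizes \<open>as\<close>, the \<open>k\<close>-th entry of \<open>block_positions as\<close> is the pair consisting of
  the number of the block containing the index \<open>k < sum_list as\<close> and the relative position
  of \<open>k\<close> in that block.
\<close>

definition block_positions :: "nat list \<Rightarrow> (nat \<times> nat) list" where
  "block_positions as = concat (map (\<lambda>i. map (\<lambda>p. (i, p)) [0..<as ! i]) [0..<length as])"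

definition block_matrix :: "nat list \<Rightarrow> nat list \<Rightarrow> (nat \<Rightarrow> nat \<Rightarrow> complex mat) \<Rightarrow> complex mat" where
  "block_matrix as bs M = mat (sum_list as) (sum_list bs)
     (\<lambda>(k, l). let (i, p) = block_positions as ! k; (j, q) = block_positions bs ! l
               in M i j $$ (p, q))"

text \<open>
  A datum: \<open>as\<close> is the list of the \<open>a\<^sub>i\<close>, \<open>bs\<close> the list of the \<open>a'\<^sub>j\<close>, and \<open>P i j\<close> is the
  polynomial belonging to the block \<open>(i, j)\<close>.  Blocks are numbered from \<open>0\<close>; the values of
  \<open>P\<close> beyond \<open>length as\<close> and \<open>length bs\<close> are irrelevant.
\<close>

definition is_datum :: "nat \<Rightarrow> nat list \<Rightarrow> nat list \<Rightarrow> bool" where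
  "is_datum n as bs \<longleftrightarrow> as \<noteq> [] \<and> bs \<noteq> [] \<and> set as \<subseteq> {1..n} \<and> set bs \<subseteq> {1..n} \<and>
     sum_list as = sum_list bs"

definition datum_matrix ::
  "nat list \<Rightarrow> nat list \<Rightarrow> (nat \<Rightarrow> nat \<Rightarrow> complex poly) \<Rightarrow> complex mat \<Rightarrow> complex mat" where
  "datum_matrix as bs P N =
     block_matrix as bs (\<lambda>i j. corner_submatrix (as ! i) (bs ! j) (poly_at_mat (P i j) N))"

definition datum_function ::
  "nat \<Rightarrow> nat list \<Rightarrow> nat list \<Rightarrow> (nat \<Rightarrow> nat \<Rightarrow> complex poly) \<Rightarrow> complex mat \<Rightarrow> complex" where
  "datum_function n as bs P = (\<lambda>N\<in>nilpotent_cone n. det (datum_matrix as bs P N))"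

section \<open>Directness of the sum of the spaces of semi-invariants\<close>

lemma borel_subgroup_inverse:
  assumes g: "g \<in> borel_subgroup n"
  obtains h where "h \<in> carrier_mat n n" "g * h = 1\<^sub>m n" "h * g = 1\<^sub>m n"
proof -
  have gc: "g \<in> carrier_mat n n" using g by (auto simp: borel_subgroup_def)
  from g obtain h where h: "g * h = 1\<^sub>m n" "h * g = 1\<^sub>m (dim_row h)"
    using gc by (auto simp: borel_subgroup_def invertible_mat_def inverts_mat_def)
  have "dim_col h = n" using arg_cong[OF h(1), of dim_col] by simp
  moreover have "dim_row h = n" using arg_cong[OF h(2), of dim_col] gc by simp
  ultimately show ?thesis using that[of h] h by auto
qed

lemma borel_subgroup_mult:
  assumes g: "g \<in> borel_subgroup n" and h: "h \<in> borel_subgroup n"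
  shows "g * h \<in> borel_subgroup n"
proof -
  have gc: "g \<in> carrier_mat n n" and hc: "h \<in> carrier_mat n n"
    and gu: "upper_triangular g" and hu: "upper_triangular h"
    using g h by (auto simp: borel_subgroup_def)
  have "(g * h) $$ (i, j) = 0" if i: "i < n" and j: "j < i" for i j
  proof -
    have "g $$ (i, k) * h $$ (k, j) = 0" if "k < n" for k
    proof (cases "k < i")
      case True
      then show ?thesis using gu gc i by (auto simp: upper_triangular_def)
    next
      case False
      then show ?thesis using hu hc j \<open>k < n\<close> by (auto simp: upper_triangular_def)
    qed
    then show ?thesis
      using gc hc i j by (auto simp: scalar_prod_def intro!: sum.neutral)
  qed
  moreover have "invertible_mat (g * h)"
  proof -
    obtain g' where g': "g' \<in> carrier_mat n n" "g * g' = 1\<^sub>m n" "g' * g = 1\<^sub>m n"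
      using borel_subgroup_inverse[OF g] .
    obtain h' where h': "h' \<in> carrier_mat n n" "h * h' = 1\<^sub>m n" "h' * h = 1\<^sub>m n"
      using borel_subgroup_inverse[OF h] .
    have "(g * h) * (h' * g') = g * ((h * h') * g')"
      using gc hc g'(1) h'(1) by (simp add: assoc_mult_mat[of _ n n _ n _ n])
    then have 1: "(g * h) * (h' * g') = 1\<^sub>m n" using g' h'(2) by simp
    have "(h' * g') * (g * h) = h' * ((g' * g) * h)"
      using gc hc g'(1) h'(1) by (simp add: assoc_mult_mat[of _ n n _ n _ n])
    then have 2: "(h' * g') * (g * h) = 1\<^sub>m n" using g'(3) h' hc by simp
    show ?thesis
      unfolding invertible_mat_def inverts_mat_def
      using 1 2 gc hc g'(1) h'(1) by (auto intro!: exI[of _ "h' * g'"])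
  qed
  ultimately show ?thesis
    using gc hc by (auto simp: borel_subgroup_def upper_triangular_def)
qed

lemma borel_subgroup_one: "1\<^sub>m n \<in> borel_subgroup n"
  unfolding borel_subgroup_def invertible_mat_def inverts_mat_def
  by (auto intro!: exI[of _ "1\<^sub>m n"])

lemma characters_independent:
  assumes "finite X" and "X \<subseteq> borel_characters n"
    and "\<And>g. g \<in> borel_subgroup n \<Longrightarrow> (\<Sum>\<chi>\<in>X. c \<chi> * \<chi> g) = 0"
  shows "\<forall>\<chi>\<in>X. c \<chi> = 0"
  using assms
proof (induction X arbitrary: c rule: finite_induct)
  case empty
  then show ?case by simp
next
  case (insert \<psi> X)
  let ?B = "borel_subgroup n"
  have psi: "\<psi> \<in> borel_characters n" and X: "X \<subseteq> borel_characters n"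
    using insert.prems by auto
  have mult: "\<chi> (g * h) = \<chi> g * \<chi> h"
    if "\<chi> \<in> borel_characters n" "g \<in> ?B" "h \<in> ?B" for \<chi> g h
    using that by (auto simp: borel_characters_def)
  have rel: "c \<psi> * \<psi> g + (\<Sum>\<chi>\<in>X. c \<chi> * \<chi> g) = 0" if "g \<in> ?B" for g
    using insert.prems(2)[OF that] insert.hyps by simp
  have cX: "c \<chi> * (\<chi> h - \<psi> h) = 0" if h: "h \<in> ?B" and chi: "\<chi> \<in> X" for h \<chi>
  proof -
    have "(\<Sum>\<chi>\<in>X. c \<chi> * (\<chi> h - \<psi> h) * \<chi> g) = 0" if g: "g \<in> ?B" for g
    proof -
      have "c \<psi> * (\<psi> h * \<psi> g) + (\<Sum>\<chi>\<in>X. c \<chi> * (\<chi> h * \<chi> g)) = 0"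
      proof -
        have "(\<Sum>\<chi>\<in>X. c \<chi> * \<chi> (h * g)) = (\<Sum>\<chi>\<in>X. c \<chi> * (\<chi> h * \<chi> g))"
          using X g h by (intro sum.cong) (auto simp: mult)
        then show ?thesis
          using rel[OF borel_subgroup_mult[OF h g]] mult[OF psi h g] by simp
      qed
      then have "(\<Sum>\<chi>\<in>X. c \<chi> * (\<chi> h * \<chi> g)) - \<psi> h * (\<Sum>\<chi>\<in>X. c \<chi> * \<chi> g) =
          0 - \<psi> h * (c \<psi> * \<psi> g + (\<Sum>\<chi>\<in>X. c \<chi> * \<chi> g))"
        by (simp add: distrib_left mult.left_commute eq_neg_iff_add_eq_0 add.commute)
      also have "\<dots> = 0" using rel[OF g] by simp
      finally have "(\<Sum>\<chi>\<in>X. c \<chi> * (\<chi> h * \<chi> g)) - \<psi> h * (\<Sum>\<chi>\<in>X. c \<chi> * \<chi> g) = 0" .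
      then show ?thesis
        by (simp add: sum_distrib_left sum_subtractf[symmetric] algebra_simps)
    qed
    from insert.IH[OF X this] chi show ?thesis by blast
  qed
  have X0: "c \<chi> = 0" if chi: "\<chi> \<in> X" for \<chi>
  proof (rule ccontr)
    assume "c \<chi> \<noteq> 0"
    then have eq: "\<chi> h = \<psi> h" if "h \<in> ?B" for h
      using cX[OF that chi] by simp
    have ext: "\<phi> \<in> extensional ?B" if "\<phi> \<in> borel_characters n" for \<phi>
    proof -
      have "\<phi> \<in> borel_regular n" using that by (simp add: borel_characters_def)
      then show ?thesis unfolding borel_regular_def by cases auto
    qed
    have "\<chi> = \<psi>"
      using extensionalityI[OF ext ext] eq chi X psi by blast
    with chi insert.hyps show False by simp
  qed
  have "c \<psi> * \<psi> (1\<^sub>m n) = 0"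
    using rel[OF borel_subgroup_one] X0 by simp
  then have "c \<psi> = 0"
    using psi borel_subgroup_one by (auto simp: borel_characters_def)
  with X0 show ?case by blast
qed

lemma conj_act_nilpotent_cone:
  assumes g: "g \<in> borel_subgroup n" and N: "N \<in> nilpotent_cone n"
  shows "conj_act g N \<in> nilpotent_cone n"
proof -
  have gc: "g \<in> carrier_mat n n"
    using g by (auto simp: borel_subgroup_def)
  have Nc: "N \<in> carrier_mat n n" using N by (auto simp: nilpotent_cone_def)
  obtain k where k: "N ^\<^sub>m k = 0\<^sub>m n n" using N by (auto simp: nilpotent_cone_def)
  obtain h where h: "mat_inverse g = Some h"
  proof (cases "mat_inverse g")
    case None
    obtain g' where "g' \<in> carrier_mat n n" "g * g' = 1\<^sub>m n" "g' * g = 1\<^sub>m n"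
      using borel_subgroup_inverse[OF g] .
    with gc have "g \<in> Units (ring_mat TYPE(complex) n ())"
      by (auto simp: Units_def ring_mat_simps)
    with mat_inverse(1)[OF gc None, of "()"] show ?thesis by blast
  next
    case (Some h)
    then show ?thesis using that by blast
  qed
  have hc: "h \<in> carrier_mat n n" and gh: "g * h = 1\<^sub>m n" and hg: "h * g = 1\<^sub>m n"
    using mat_inverse(2)[OF gc h] by auto
  have Mc: "conj_act g N \<in> carrier_mat n n"
    using gc hc Nc h by (auto simp: conj_act_def)
  have wit: "similar_mat_wit (conj_act g N) N g h"
    using gc hc Nc gh hg h Mc by (auto simp: similar_mat_wit_def conj_act_def Let_def)
  have "conj_act g N ^\<^sub>m k = g * N ^\<^sub>m k * h"
    using similar_mat_wit_pow_id[OF wit] by simp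
  then have "conj_act g N ^\<^sub>m k = 0\<^sub>m n n"
    using k gc hc by simp
  with Mc show ?thesis by (auto simp: nilpotent_cone_def)
qed

lemma semi_invariants_independent:
  assumes X: "finite X" "X \<subseteq> borel_characters n"
    and F: "\<forall>\<chi>\<in>X. F \<chi> \<in> semi_invariants n \<chi>"
    and zero: "\<forall>N\<in>nilpotent_cone n. (\<Sum>\<chi>\<in>X. F \<chi> N) = 0"
  shows "\<forall>\<chi>\<in>X. \<forall>N\<in>nilpotent_cone n. F \<chi> N = 0"
proof -
  have "\<forall>\<chi>\<in>X. F \<chi> N = 0" if N: "N \<in> nilpotent_cone n" for N
  proof (rule characters_independent[OF X])
    fix g assume g: "g \<in> borel_subgroup n"
    have "(\<Sum>\<chi>\<in>X. F \<chi> N * \<chi> g) = (\<Sum>\<chi>\<in>X. F \<chi> (conj_act g N))"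
      using F g N by (intro sum.cong) (auto simp: semi_invariants_def)
    then show "(\<Sum>\<chi>\<in>X. F \<chi> N * \<chi> g) = 0"
      using zero conj_act_nilpotent_cone[OF g N] by simp
  qed
  then show ?thesis by blast
qed

end

theory Submission
  imports Defs "Jordan_Normal_Form.Char_Poly"
begin

text \<open>
  Characters of \<open>B\<close> are trivial on unipotent elements, so a semi-invariant \<open>f\<close> is invariant under
  the unipotent radical \<open>U\<close>.  For fixed nilpotent \<open>N\<close> and large \<open>k\<close>, the function
  \<open>p(g) = (det g)\<^sup>k f(g\<^sup>-\<^sup>1 N g)\<close> is a polynomial in \<open>g\<close>, homogeneous of degree \<open>d = n k\<close>, which is
  invariant under right multiplication of \<open>g\<close> by \<open>U\<close>; and \<open>f(N) = p(1)\<close>.  By Cramer's rule \<open>p\<close> is a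
  linear combination of products of \<open>k\<close> determinants of size \<open>n\<close> whose columns are \<open>g e\<^sub>j\<close> or
  \<open>N g e\<^sub>j\<close>.

  Only the parts of \<open>p\<close> in which rows and columns have the same weight contribute to \<open>p(1)\<close>.
  On lower triangular matrices such a part is a multiple of one monomial in the diagonal entries;
  hence by \<open>U\<close>-invariance it is \<open>p(1)\<close> times a product of leading principal minors, or zero at the
  identity if the weight is not dominant.  So its value at the identity is, up to a nonzero constant,
  its apolar (Fischer) pairing with that product of minors.  The pairing of a product of determinants
  as above with a product of minors of sizes \<open>b\<^sub>1, \<dots>, b\<^sub>t\<close> is an antisymmetrization over
  the columns, and inclusion-exclusion writes it as a signed sum of determinants \<open>f\<^sup>P\<close> in which
  all \<open>a\<^sub>i\<close> equal \<open>n\<close> and \<open>a'\<^sub>j = b\<^sub>j\<close>.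
\<close>

section \<open>Polynomials in matrix entries\<close>

text \<open>The single products of determinants that add up to \<open>p\<close> are not invariant
  under \<open>U\<close>; only their sum is, and at the identity they give arbitrary expressions in
  the entries of \<open>N\<close>. So evaluation at the identity cannot be applied term by term. The
  pairing with products of minors removes this obstacle: it is a linear functional on all
  polynomials in \<open>g\<close>, its normalized sum over the dominant weights agrees with
  evaluation at the identity on the invariant polynomials, and it sends each single product of
  determinants to an element of the algebra generated by the \<open>f^P\<close>. The functional is
  the same for all \<open>N\<close>, which enters only through the coefficients of \<open>p\<close>.

  Polynomials are given by coefficients of words because these come straight out of the multilinear
  expansion of determinants. Such coefficients are not unique, so it has to be shown that a
  polynomial that vanishes as a function pairs to zero.\<close>

definition word_content :: "nat \<Rightarrow> (nat \<Rightarrow> nat) \<Rightarrow> nat \<Rightarrow> nat" where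
  "word_content d v i = card {c. c < d \<and> v c = i}"

lemma content_le: "word_content d v i \<le> d"
proof -
  have "card {c. c < d \<and> v c = i} \<le> card {..<d}" by (rule card_mono) auto
  then show ?thesis by (simp add: word_content_def)
qed

lemma content_cong: "(\<And>c. c < d \<Longrightarrow> v c = v' c) \<Longrightarrow> word_content d v = word_content d v'"
  unfolding word_content_def by (intro ext arg_cong[where f = card]) auto

lemma content_zero: "(\<And>c. c < d \<Longrightarrow> v c < n) \<Longrightarrow> n \<le> i \<Longrightarrow> word_content d v i = 0"
  by (auto simp: word_content_def) (metis leD)

lemma content_permutes:
  assumes "\<pi> permutes {..<d}"
  shows "word_content d (\<lambda>c. v (\<pi> c)) = word_content d v"
proof
  fix i
  have "x \<in> \<pi> ` {c. c < d \<and> v (\<pi> c) = i}" if x: "x < d" "v x = i" for x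
  proof -
    have "x \<in> \<pi> ` {..<d}" using permutes_image[OF assms] x by simp
    then show ?thesis using x by auto
  qed
  moreover have "\<pi> c < d" if "c < d" for c
    using permutes_in_image[OF assms, of c] that by simp
  ultimately have "\<pi> ` {c. c < d \<and> v (\<pi> c) = i} = {c. c < d \<and> v c = i}" by blast
  moreover have "card (\<pi> ` {c. c < d \<and> v (\<pi> c) = i}) = card {c. c < d \<and> v (\<pi> c) = i}"
    using permutes_inj_on[OF assms] by (rule card_image)
  ultimately show "word_content d (\<lambda>c. v (\<pi> c)) i = word_content d v i"
    by (simp add: word_content_def)
qed

lemma prod_content:
  fixes F :: "nat \<Rightarrow> 'a :: comm_monoid_mult"
  assumes "\<And>c. c < d \<Longrightarrow> v c < n"
  shows "(\<Prod>c<d. F (v c)) = (\<Prod>i<n. F i ^ word_content d v i)"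
proof -
  have "(\<Prod>c<d. F (v c)) = (\<Prod>i<n. \<Prod>c\<in>{c \<in> {..<d}. v c = i}. F (v c))"
    using assms by (intro prod.group[symmetric]) auto
  also have "\<dots> = (\<Prod>i<n. F i ^ word_content d v i)"
    by (intro prod.cong refl) (simp add: word_content_def)
  finally show ?thesis .
qed

lemma sum_content:
  fixes F :: "nat \<Rightarrow> nat"
  assumes "\<And>c. c < d \<Longrightarrow> v c < n"
  shows "(\<Sum>c<d. F (v c)) = (\<Sum>i<n. word_content d v i * F i)"
proof -
  have "(\<Sum>c<d. F (v c)) = (\<Sum>i<n. \<Sum>c\<in>{c \<in> {..<d}. v c = i}. F (v c))"
    using assms by (intro sum.group[symmetric]) auto
  also have "\<dots> = (\<Sum>i<n. word_content d v i * F i)"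
    by (intro sum.cong refl) (simp add: word_content_def)
  finally show ?thesis .
qed

lemma digits_unique:
  fixes M :: nat
  assumes "\<And>i. i < m \<Longrightarrow> a i < M" "\<And>i. i < m \<Longrightarrow> b i < M"
    and "(\<Sum>i<m. a i * M ^ i) = (\<Sum>i<m. b i * M ^ i)"
  shows "\<forall>i<m. a i = b i"
  using assms
proof (induction m arbitrary: a b)
  case 0
  then show ?case by simp
next
  case (Suc m)
  have split: "(\<Sum>i<Suc m. x i * M ^ i) = x 0 + M * (\<Sum>i<m. x (Suc i) * M ^ i)" for x :: "nat \<Rightarrow> nat"
    unfolding sum.lessThan_Suc_shift by (simp add: sum_distrib_left mult_ac)
  have eq: "a 0 + M * (\<Sum>i<m. a (Suc i) * M ^ i) = b 0 + M * (\<Sum>i<m. b (Suc i) * M ^ i)"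
    using Suc.prems(3) unfolding split .
  have lt: "a 0 < M" "b 0 < M" using Suc.prems by auto
  have a0: "a 0 = b 0" using arg_cong[OF eq, of "\<lambda>x. x mod M"] lt by simp
  have "(\<Sum>i<m. a (Suc i) * M ^ i) = (\<Sum>i<m. b (Suc i) * M ^ i)"
    using eq a0 lt by auto
  then have "\<forall>i<m. a (Suc i) = b (Suc i)"
    using Suc.prems by (intro Suc.IH) auto
  then show ?case using a0 by (auto simp: less_Suc_eq_0_disj)
qed

text \<open>A polynomial with infinitely many zeros is zero, and its coefficient at
  \<open>z ^ k\<close> collects the \<open>w\<close> with \<open>e w = k\<close>. Only
  \<open>z \<noteq> 0\<close> is assumed since this serves for scaling by invertible
  matrices.\<close>

lemma sum_powers_zero:
  fixes c :: "'w \<Rightarrow> complex"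
  assumes "finite W" and zero: "\<And>z. z \<noteq> 0 \<Longrightarrow> (\<Sum>w\<in>W. c w * z ^ e w) = 0"
  shows "(\<Sum>w\<in>{w \<in> W. e w = k}. c w) = 0"
proof -
  define P where "P = (\<Sum>w\<in>W. monom (c w) (e w))"
  have "poly P z = 0" if "z \<noteq> 0" for z
    using zero[OF that] by (simp add: P_def poly_sum poly_monom)
  then have "- {0} \<subseteq> {z. poly P z = 0}" by auto
  moreover have "infinite (- {0 :: complex})"
    by (simp add: infinite_UNIV_char_0 Compl_eq_Diff_UNIV)
  ultimately have "P = 0" using poly_roots_finite finite_subset by metis
  then have "0 = coeff P k" by simp
  also have "\<dots> = (\<Sum>w\<in>W. if e w = k then c w else 0)" by (simp add: P_def coeff_sum)
  also have "\<dots> = (\<Sum>w\<in>{w \<in> W. e w = k}. c w)"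
    using assms(1) by (simp add: sum.inter_filter)
  finally show ?thesis by simp
qed

text \<open>In terms of the complement \<open>T = X - S\<close> this is the expansion of a product
  of factors \<open>- 1 + 1\<close>, one for each element of \<open>X - R\<close>.\<close>

lemma sum_Pow_supersets:
  assumes "finite X" "R \<subseteq> X"
  shows "(\<Sum>S | R \<subseteq> S \<and> S \<subseteq> X. (- 1) ^ card (X - S)) = (if R = X then 1 else 0 :: complex)"
proof -
  have "(\<Sum>S | R \<subseteq> S \<and> S \<subseteq> X. (- 1) ^ card (X - S)) = (\<Sum>T\<in>Pow (X - R). (- 1 :: complex) ^ card T)"
    by (rule sum.reindex_bij_witness[of _ "\<lambda>T. X - T" "\<lambda>S. X - S"])
      (use assms in \<open>auto simp: double_diff\<close>)
  also have "\<dots> = (\<Prod>x\<in>X - R. - 1 + 1)"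
    using assms prod_add[of "X - R" "\<lambda>_. - 1 :: complex" "\<lambda>_. 1"] by simp
  also have "\<dots> = (if R = X then 1 else 0)"
    using assms by (auto simp: prod_zero_iff)
  finally show ?thesis .
qed

text \<open>Inclusion-exclusion over the image of a self-map: only the surjective ones survive.\<close>

lemma polarization:
  fixes G :: "('x \<Rightarrow> 'x) \<Rightarrow> complex"
  assumes X: "finite X"
  shows "(\<Sum>S\<in>Pow X. (- 1) ^ card (X - S) * (\<Sum>\<phi>\<in>X \<rightarrow>\<^sub>E S. G \<phi>)) =
    (\<Sum>\<pi> | \<pi> permutes X. G (restrict \<pi> X))"
proof -
  have fin: "finite (X \<rightarrow>\<^sub>E X)" using X by (simp add: finite_PiE)
  have "(\<Sum>S\<in>Pow X. (- 1) ^ card (X - S) * (\<Sum>\<phi>\<in>X \<rightarrow>\<^sub>E S. G \<phi>)) =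
      (\<Sum>S\<in>Pow X. \<Sum>\<phi>\<in>X \<rightarrow>\<^sub>E X. if \<phi> ` X \<subseteq> S then (- 1) ^ card (X - S) * G \<phi> else 0)"
  proof (intro sum.cong refl)
    fix S assume S: "S \<in> Pow X"
    have eq: "X \<rightarrow>\<^sub>E S = {\<phi> \<in> X \<rightarrow>\<^sub>E X. \<phi> ` X \<subseteq> S}"
      using S by (auto simp: PiE_def Pi_def)
    show "(- 1) ^ card (X - S) * (\<Sum>\<phi>\<in>X \<rightarrow>\<^sub>E S. G \<phi>) =
      (\<Sum>\<phi>\<in>X \<rightarrow>\<^sub>E X. if \<phi> ` X \<subseteq> S then (- 1) ^ card (X - S) * G \<phi> else 0)"
      unfolding eq sum_distrib_left using fin by (rule sum.inter_filter)
  qed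
  also have "\<dots> = (\<Sum>\<phi>\<in>X \<rightarrow>\<^sub>E X. \<Sum>S\<in>Pow X. if \<phi> ` X \<subseteq> S then (- 1) ^ card (X - S) * G \<phi> else 0)"
    by (rule sum.swap)
  also have "\<dots> = (\<Sum>\<phi>\<in>X \<rightarrow>\<^sub>E X. (if \<phi> ` X = X then 1 else 0) * G \<phi>)"
  proof (intro sum.cong refl)
    fix \<phi> assume "\<phi> \<in> X \<rightarrow>\<^sub>E X"
    then have sub: "\<phi> ` X \<subseteq> X" by auto
    have "(\<Sum>S\<in>Pow X. if \<phi> ` X \<subseteq> S then (- 1) ^ card (X - S) * G \<phi> else 0) =
        (\<Sum>S\<in>{S \<in> Pow X. \<phi> ` X \<subseteq> S}. (- 1) ^ card (X - S) * G \<phi>)"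
      using X by (intro sum.inter_filter[symmetric]) auto
    also have "{S \<in> Pow X. \<phi> ` X \<subseteq> S} = {S. \<phi> ` X \<subseteq> S \<and> S \<subseteq> X}" by auto
    also have "(\<Sum>S\<in>\<dots>. (- 1) ^ card (X - S) * G \<phi>) = (if \<phi> ` X = X then 1 else 0) * G \<phi>"
      unfolding sum_distrib_right[symmetric] sum_Pow_supersets[OF X sub] ..
    finally show "(\<Sum>S\<in>Pow X. if \<phi> ` X \<subseteq> S then (- 1) ^ card (X - S) * G \<phi> else 0) =
      (if \<phi> ` X = X then 1 else 0) * G \<phi>" .
  qed
  also have "\<dots> = (\<Sum>\<phi>\<in>{\<phi> \<in> X \<rightarrow>\<^sub>E X. \<phi> ` X = X}. G \<phi>)"
    unfolding sum.inter_filter[OF fin] by (intro sum.cong) auto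
  also have "\<dots> = (\<Sum>\<pi> | \<pi> permutes X. G (restrict \<pi> X))"
  proof (rule sum.reindex_bij_witness[of _ "\<lambda>\<pi>. restrict \<pi> X" "\<lambda>\<phi> x. if x \<in> X then \<phi> x else x"])
    fix \<phi> assume \<phi>: "\<phi> \<in> {\<phi> \<in> X \<rightarrow>\<^sub>E X. \<phi> ` X = X}"
    show eq: "restrict (\<lambda>x. if x \<in> X then \<phi> x else x) X = \<phi>"
      using \<phi> by (auto simp: fun_eq_iff PiE_def extensional_def)
    have "inj_on \<phi> X" using \<phi> X by (simp add: eq_card_imp_inj_on)
    then have "bij_betw \<phi> X X" using \<phi> by (simp add: bij_betw_def)
    then have "bij_betw (\<lambda>x. if x \<in> X then \<phi> x else x) X X"
      by (subst bij_betw_cong[of X _ \<phi>]) auto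
    then show "(\<lambda>x. if x \<in> X then \<phi> x else x) \<in> {\<pi>. \<pi> permutes X}"
      by (simp add: bij_imp_permutes)
    show "G (restrict (\<lambda>x. if x \<in> X then \<phi> x else x) X) = G \<phi>" by (simp only: eq)
  next
    fix \<pi> assume "\<pi> \<in> {\<pi>. \<pi> permutes X}"
    then have p: "\<pi> permutes X" by simp
    show "(\<lambda>x. if x \<in> X then restrict \<pi> X x else x) = \<pi>"
      using p by (auto simp: fun_eq_iff permutes_not_in)
    show "restrict \<pi> X \<in> {\<phi> \<in> X \<rightarrow>\<^sub>E X. \<phi> ` X = X}"
      using permutes_image[OF p] permutes_in_image[OF p] by auto
  qed
  finally show ?thesis .
qed

section \<open>Homogeneous polynomials given by words\<close>

definition words :: "nat \<Rightarrow> nat \<Rightarrow> (nat \<Rightarrow> nat \<times> nat) set" where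
  "words n d = {..<d} \<rightarrow>\<^sub>E {..<n} \<times> {..<n}"

text \<open>
  A homogeneous polynomial of degree \<open>d\<close> in the entries of an \<open>n \<times> n\<close> matrix \<open>g\<close>, given by
  coefficients of noncommutative monomials; different coefficients may give the same polynomial.
\<close>

definition word_sum :: "nat \<Rightarrow> nat \<Rightarrow> ((nat \<Rightarrow> nat \<times> nat) \<Rightarrow> complex) \<Rightarrow> complex mat \<Rightarrow> complex" where
  "word_sum n d a g = (\<Sum>w\<in>words n d. a w * (\<Prod>c<d. g $$ w c))"

lemma finite_words: "finite (words n d)"
  by (simp add: words_def finite_PiE)

lemma words_less:
  assumes "w \<in> words n d" "c < d"
  shows "fst (w c) < n" "snd (w c) < n"
proof -
  have "w c \<in> {..<n} \<times> {..<n}"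
    using PiE_mem[OF assms(1)[unfolded words_def], of c] assms(2) by simp
  then show "fst (w c) < n" "snd (w c) < n" by auto
qed

lemma word_sum_add: "word_sum n d (\<lambda>w. x * a w + b w) g = x * word_sum n d a g + word_sum n d b g"
  by (simp add: word_sum_def sum.distrib sum_distrib_left algebra_simps)

lemma words_permute:
  assumes "w \<in> words n d" "\<pi> permutes {..<d}"
  shows "(\<lambda>c. w (\<pi> c)) \<in> words n d"
  using assms permutes_in_image[OF assms(2)] permutes_not_in[OF assms(2)]
  unfolding words_def by (auto simp: PiE_def Pi_def extensional_def)

lemma word_sum_tendsto:
  fixes G :: "complex \<Rightarrow> complex mat"
  assumes "\<And>i j. i < n \<Longrightarrow> j < n \<Longrightarrow> ((\<lambda>z. G z $$ (i, j)) \<longlongrightarrow> g $$ (i, j)) F"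
  shows "((\<lambda>z. word_sum n d a (G z)) \<longlongrightarrow> word_sum n d a g) F"
  unfolding word_sum_def
proof (intro tendsto_sum tendsto_mult tendsto_const tendsto_prod)
  fix w c assume "w \<in> words n d" "c \<in> {..<d}"
  then show "((\<lambda>z. G z $$ w c) \<longlongrightarrow> g $$ w c) F"
    using assms[of "fst (w c)" "snd (w c)"] words_less[of w n d c] by simp
qed

text \<open>Polynomials are continuous, so zeros along a punctured neighbourhood persist in the
  limit. This takes the place of Zariski density.\<close>

lemma word_sum_zero_extend:
  fixes G :: "complex \<Rightarrow> complex mat"
  assumes "\<And>i j. i < n \<Longrightarrow> j < n \<Longrightarrow> ((\<lambda>z. G z $$ (i, j)) \<longlongrightarrow> g $$ (i, j)) (at 0)"
    and "eventually (\<lambda>z. word_sum n d a (G z) = 0) (at 0)"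
  shows "word_sum n d a g = 0"
proof -
  have "((\<lambda>z. 0 :: complex) \<longlongrightarrow> word_sum n d a g) (at (0 :: complex))"
    using word_sum_tendsto[OF assms(1)] assms(2) by (rule Lim_transform_eventually)
  then show ?thesis by (simp add: tendsto_const_iff)
qed

text \<open>Coefficients of words are determined by the polynomial function only after
  symmetrization over the positions. For a set \<open>S\<close> of positions, evaluating at the sum
  of the matrix units \<open>v x\<close> with \<open>x \<in> S\<close> gives the sum of
  \<open>a\<close> over the words \<open>v (\<phi> c)\<close> with \<open>\<phi>\<close> mapping
  into \<open>S\<close>; inclusion-exclusion over \<open>S\<close> keeps the permutations.\<close>

lemma word_sum_eq_0_imp:
  assumes zero: "\<And>g. g \<in> carrier_mat n n \<Longrightarrow> word_sum n d a g = 0"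
    and v: "v \<in> words n d"
  shows "(\<Sum>\<pi> | \<pi> permutes {..<d}. a (\<lambda>c. v (\<pi> c))) = 0"
proof -
  let ?X = "{..<d}"
  define G where "G \<phi> = a (restrict (\<lambda>c. v (\<phi> c)) ?X)" for \<phi> :: "nat \<Rightarrow> nat"
  have "(\<Sum>\<phi>\<in>?X \<rightarrow>\<^sub>E S. G \<phi>) = 0" if S: "S \<subseteq> ?X" for S
  proof -
    \<comment> \<open>Letters that \<open>v\<close> repeats are counted with multiplicity, so the
      maps \<open>\<phi>\<close> are counted correctly although different \<open>\<phi>\<close> may
      give the same word.\<close>
    define g where "g = mat n n (\<lambda>ij. \<Sum>x\<in>S. if v x = ij then 1 else 0 :: complex)"
    have finS: "finite S" using S finite_subset by blast
    have "(\<Prod>c<d. g $$ w c) = (\<Sum>\<phi>\<in>?X \<rightarrow>\<^sub>E S. if restrict (\<lambda>c. v (\<phi> c)) ?X = w then 1 else 0)"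
      if w: "w \<in> words n d" for w
    proof -
      have "(\<Prod>c<d. g $$ w c) = (\<Prod>c<d. \<Sum>x\<in>S. if v x = w c then 1 else 0)"
      proof (intro prod.cong refl)
        fix c assume "c \<in> {..<d}"
        then have "fst (w c) < n" "snd (w c) < n" using words_less[OF w] by auto
        then show "g $$ w c = (\<Sum>x\<in>S. if v x = w c then 1 else 0)"
          by (cases "w c") (simp add: g_def)
      qed
      also have "\<dots> = (\<Sum>\<phi>\<in>?X \<rightarrow>\<^sub>E S. \<Prod>c<d. if v (\<phi> c) = w c then 1 else 0)"
        using finS by (subst prod_sum_PiE) auto
      also have "\<dots> = (\<Sum>\<phi>\<in>?X \<rightarrow>\<^sub>E S. if restrict (\<lambda>c. v (\<phi> c)) ?X = w then 1 else 0)"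
      proof (intro sum.cong refl)
        fix \<phi> :: "nat \<Rightarrow> nat"
        have "restrict (\<lambda>c. v (\<phi> c)) ?X = w \<longleftrightarrow> (\<forall>c<d. v (\<phi> c) = w c)"
          using w by (auto simp: fun_eq_iff words_def PiE_def extensional_def)
        then show "(\<Prod>c<d. if v (\<phi> c) = w c then 1 else 0) =
            (if restrict (\<lambda>c. v (\<phi> c)) ?X = w then 1 else 0 :: complex)"
          by auto
      qed
      finally show ?thesis .
    qed
    then have "word_sum n d a g =
        (\<Sum>w\<in>words n d. \<Sum>\<phi>\<in>?X \<rightarrow>\<^sub>E S. if restrict (\<lambda>c. v (\<phi> c)) ?X = w then a w else 0)"
      unfolding word_sum_def by (auto simp: sum_distrib_left intro!: sum.cong)
    also have "\<dots> = (\<Sum>\<phi>\<in>?X \<rightarrow>\<^sub>E S. \<Sum>w\<in>words n d. if restrict (\<lambda>c. v (\<phi> c)) ?X = w then a w else 0)"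
      by (rule sum.swap)
    also have "\<dots> = (\<Sum>\<phi>\<in>?X \<rightarrow>\<^sub>E S. G \<phi>)"
    proof (intro sum.cong refl)
      fix \<phi> assume \<phi>: "\<phi> \<in> ?X \<rightarrow>\<^sub>E S"
      have "restrict (\<lambda>c. v (\<phi> c)) ?X \<in> words n d"
        using \<phi> S v unfolding words_def by (fastforce simp: PiE_def Pi_def)
      then show "(\<Sum>w\<in>words n d. if restrict (\<lambda>c. v (\<phi> c)) ?X = w then a w else 0) = G \<phi>"
        by (simp add: G_def finite_words)
    qed
    finally show ?thesis using zero[of g] by (simp add: g_def)
  qed
  then have "(\<Sum>S\<in>Pow ?X. (- 1) ^ card (?X - S) * (\<Sum>\<phi>\<in>?X \<rightarrow>\<^sub>E S. G \<phi>)) = 0"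
    by (intro sum.neutral) auto
  then have "(\<Sum>\<pi> | \<pi> permutes ?X. G (restrict \<pi> ?X)) = 0"
    unfolding polarization[OF finite_lessThan] .
  moreover have "G (restrict \<pi> ?X) = a (\<lambda>c. v (\<pi> c))" if "\<pi> permutes ?X" for \<pi>
  proof -
    have "restrict (\<lambda>c. v (restrict \<pi> ?X c)) ?X = (\<lambda>c. v (\<pi> c))"
      using words_permute[OF v that] by (auto simp: words_def PiE_def extensional_def fun_eq_iff)
    then show ?thesis by (simp add: G_def)
  qed
  ultimately show ?thesis by simp
qed

section \<open>Products of leading principal minors\<close>

abbreviation block_of :: "nat list \<Rightarrow> nat \<Rightarrow> nat" where
  "block_of as x \<equiv> fst (block_positions as ! x)"

abbreviation pos_of :: "nat list \<Rightarrow> nat \<Rightarrow> nat" where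
  "pos_of as x \<equiv> snd (block_positions as ! x)"

lemma block_positions_snoc:
  "block_positions (as @ [b]) = block_positions as @ map (\<lambda>p. (length as, p)) [0..<b]"
proof -
  have "map (\<lambda>i. map (Pair i) [0..<(as @ [b]) ! i]) [0..<length as] =
      map (\<lambda>i. map (Pair i) [0..<as ! i]) [0..<length as]"
    by (intro map_cong refl) (simp add: nth_append)
  then show ?thesis by (simp add: block_positions_def del: map_eq_conv)
qed

lemma block_positions_Nil: "block_positions [] = []"
  by (simp add: block_positions_def)

lemma length_block_positions: "length (block_positions as) = sum_list as"
  by (induction as rule: rev_induct) (simp_all add: block_positions_snoc block_positions_Nil)

lemma set_block_positions: "set (block_positions as) = {(i, p). i < length as \<and> p < as ! i}"
  by (auto simp: block_positions_def)

lemma block_of_less: "x < sum_list as \<Longrightarrow> block_of as x < length as"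
  and pos_of_less: "x < sum_list as \<Longrightarrow> pos_of as x < as ! block_of as x"
  using nth_mem[of x "block_positions as"]
  unfolding length_block_positions set_block_positions by auto

lemma pos_of_less_bound:
  assumes "x < sum_list as" "set as \<subseteq> {1..n}"
  shows "pos_of as x < n"
proof -
  have "as ! block_of as x \<le> n"
    using assms block_of_less[OF assms(1)] nth_mem by fastforce
  then show ?thesis using pos_of_less[OF assms(1)] by simp
qed

text \<open>The lexicographic order is what turns triangularity of the blocks into triangularity of
  the whole matrix; it also makes the indexing injective.\<close>

lemma sorted_block_positions:
  "sorted_wrt (\<lambda>(i, p) (j, q). i < j \<or> i = j \<and> p < q) (block_positions as)"
proof (induction as rule: rev_induct)
  case (snoc b as)
  have "sorted_wrt (\<lambda>(i, p) (j, q). i < j \<or> i = j \<and> p < q) (map (Pair (length as)) [0..<b])"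
    by (simp add: sorted_wrt_map)
  with snoc show ?case
    unfolding block_positions_snoc sorted_wrt_append
    by (auto simp: set_block_positions)
qed (simp add: block_positions_Nil)

lemma block_positions_less:
  assumes "x < y" "y < sum_list as"
  shows "block_of as x < block_of as y \<or> block_of as x = block_of as y \<and> pos_of as x < pos_of as y"
  using sorted_wrt_nth_less[OF sorted_block_positions assms(1), of as] assms(2)
  by (simp add: length_block_positions split_beta)

lemma block_positions_inject:
  assumes "x < sum_list as" "y < sum_list as" "block_of as x = block_of as y" "pos_of as x = pos_of as y"
  shows "x = y"
  using block_positions_less[of x y as] block_positions_less[of y x as] assms
  by (cases x y rule: linorder_cases) auto

lemma sum_block_positions:
  fixes F :: "nat \<times> nat \<Rightarrow> 'a :: comm_monoid_add"
  shows "(\<Sum>x<sum_list as. F (block_positions as ! x)) = (\<Sum>i<length as. \<Sum>p<as ! i. F (i, p))"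
proof (induction as rule: rev_induct)
  case Nil
  then show ?case by simp
next
  case (snoc b as)
  let ?s = "sum_list as"
  have split: "(\<Sum>x<?s + b. H x) = (\<Sum>x<?s. H x) + (\<Sum>p<b. H (?s + p))" for H :: "nat \<Rightarrow> 'a"
    by (induction b) (simp_all add: add.assoc)
  have "(\<Sum>x<?s + b. F (block_positions (as @ [b]) ! x)) =
      (\<Sum>x<?s. F (block_positions (as @ [b]) ! x)) + (\<Sum>p<b. F (block_positions (as @ [b]) ! (?s + p)))"
    by (rule split)
  also have "(\<Sum>x<?s. F (block_positions (as @ [b]) ! x)) = (\<Sum>x<?s. F (block_positions as ! x))"
    by (simp add: block_positions_snoc nth_append length_block_positions)
  also have "(\<Sum>p<b. F (block_positions (as @ [b]) ! (?s + p))) = (\<Sum>p<b. F (length as, p))"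
    by (simp add: block_positions_snoc nth_append length_block_positions)
  also have "(\<Sum>x<?s. F (block_positions as ! x)) = (\<Sum>i<length as. \<Sum>p<(as @ [b]) ! i. F (i, p))"
    unfolding snoc.IH by (intro sum.cong refl) (simp add: nth_append)
  finally show ?case by simp
qed

text \<open>The entry function receives block numbers and relative positions as separate arguments,
  so that products and triangularity can be treated block by block.\<close>

definition blockwise_mat :: "nat list \<Rightarrow> nat list \<Rightarrow> (nat \<Rightarrow> nat \<Rightarrow> nat \<Rightarrow> nat \<Rightarrow> 'a) \<Rightarrow> 'a mat" where
  "blockwise_mat as bs F = mat (sum_list as) (sum_list bs)
     (\<lambda>(x, y). F (block_of as x) (block_of bs y) (pos_of as x) (pos_of bs y))"

lemma blockwise_mat_carrier [simp]: "blockwise_mat as bs F \<in> carrier_mat (sum_list as) (sum_list bs)"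
  by (simp add: blockwise_mat_def)

lemma blockwise_mat_dim [simp]: "dim_row (blockwise_mat as bs F) = sum_list as" "dim_col (blockwise_mat as bs F) = sum_list bs"
  by (simp_all add: blockwise_mat_def)

lemma blockwise_mat_index [simp]:
  "x < sum_list as \<Longrightarrow> y < sum_list bs \<Longrightarrow>
    blockwise_mat as bs F $$ (x, y) = F (block_of as x) (block_of bs y) (pos_of as x) (pos_of bs y)"
  by (simp add: blockwise_mat_def)

lemma blockwise_mat_cong:
  assumes "\<And>i j p q. i < length as \<Longrightarrow> j < length bs \<Longrightarrow> p < as ! i \<Longrightarrow> q < bs ! j \<Longrightarrow> F i j p q = G i j p q"
  shows "blockwise_mat as bs F = blockwise_mat as bs G"
  by (rule eq_matI) (auto intro!: assms block_of_less pos_of_less)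

lemma block_matrix_eq_blockwise_mat: "block_matrix as bs M = blockwise_mat as bs (\<lambda>i j p q. M i j $$ (p, q))"
  by (auto simp: block_matrix_def blockwise_mat_def split_beta intro!: eq_matI)

lemma blockwise_mat_mult:
  fixes F G :: "nat \<Rightarrow> nat \<Rightarrow> nat \<Rightarrow> nat \<Rightarrow> 'a :: comm_semiring_1"
  shows "blockwise_mat as bs F * blockwise_mat bs cs G =
    blockwise_mat as cs (\<lambda>i j p q. \<Sum>l<length bs. \<Sum>r<bs ! l. F i l p r * G l j r q)"
proof (rule eq_matI)
  fix x y assume "x < dim_row (blockwise_mat as cs (\<lambda>i j p q. \<Sum>l<length bs. \<Sum>r<bs ! l. F i l p r * G l j r q))"
    and "y < dim_col (blockwise_mat as cs (\<lambda>i j p q. \<Sum>l<length bs. \<Sum>r<bs ! l. F i l p r * G l j r q))"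
  then have xy: "x < sum_list as" "y < sum_list cs" by auto
  define H where "H u = F (block_of as x) (fst u) (pos_of as x) (snd u) *
    G (fst u) (block_of cs y) (snd u) (pos_of cs y)" for u
  have "(blockwise_mat as bs F * blockwise_mat bs cs G) $$ (x, y) = (\<Sum>z<sum_list bs. H (block_positions bs ! z))"
    using xy by (simp add: scalar_prod_def H_def atLeast0LessThan)
  also have "\<dots> = (\<Sum>l<length bs. \<Sum>r<bs ! l. H (l, r))" by (rule sum_block_positions)
  finally show "(blockwise_mat as bs F * blockwise_mat bs cs G) $$ (x, y) =
    blockwise_mat as cs (\<lambda>i j p q. \<Sum>l<length bs. \<Sum>r<bs ! l. F i l p r * G l j r q) $$ (x, y)"
    using xy by (simp add: H_def)
qed auto

lemma det_blockwise_mat_upper_triangular: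
  fixes F :: "nat \<Rightarrow> nat \<Rightarrow> nat \<Rightarrow> nat \<Rightarrow> 'a :: comm_ring_1"
  assumes "\<And>i j p q. i < length as \<Longrightarrow> j < length as \<Longrightarrow> p < as ! i \<Longrightarrow> q < as ! j \<Longrightarrow> i \<noteq> j \<or> q < p \<Longrightarrow> F i j p q = 0"
  shows "det (blockwise_mat as as F) = (\<Prod>x<sum_list as. F (block_of as x) (block_of as x) (pos_of as x) (pos_of as x))"
proof -
  have "upper_triangular (blockwise_mat as as F)"
  proof
    fix x y assume "y < x" and "x < dim_row (blockwise_mat as as F)"
    then have yx: "y < x" "x < sum_list as" by auto
    then show "blockwise_mat as as F $$ (x, y) = 0"
      using block_positions_less[OF yx] by (auto intro!: assms block_of_less pos_of_less)
  qed
  then have "det (blockwise_mat as as F) = prod_list (diag_mat (blockwise_mat as as F))"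
    by (rule det_upper_triangular[of _ "sum_list as"]) simp
  then show ?thesis
    by (simp add: prod_list_diag_prod atLeast0LessThan)
qed

lemma det_blockwise_mat_lower_triangular:
  fixes F :: "nat \<Rightarrow> nat \<Rightarrow> nat \<Rightarrow> nat \<Rightarrow> 'a :: comm_ring_1"
  assumes "\<And>i j p q. i < length as \<Longrightarrow> j < length as \<Longrightarrow> p < as ! i \<Longrightarrow> q < as ! j \<Longrightarrow> i \<noteq> j \<or> p < q \<Longrightarrow> F i j p q = 0"
  shows "det (blockwise_mat as as F) = (\<Prod>x<sum_list as. F (block_of as x) (block_of as x) (pos_of as x) (pos_of as x))"
proof -
  have "det (blockwise_mat as as F) = det (transpose_mat (blockwise_mat as as F))"
    by (rule det_transpose[symmetric, of _ "sum_list as"]) simp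
  also have "transpose_mat (blockwise_mat as as F) = blockwise_mat as as (\<lambda>i j p q. F j i q p)"
    by (rule eq_matI) auto
  also have "det \<dots> = (\<Prod>x<sum_list as. F (block_of as x) (block_of as x) (pos_of as x) (pos_of as x))"
    by (rule det_blockwise_mat_upper_triangular) (use assms in auto)
  finally show ?thesis .
qed

section \<open>Products of minors and the Young subgroup of the blocks\<close>

text \<open>One determinant of the block diagonal matrix of leading principal submatrices:
  multiplicativity and the Leibniz formula then apply to the whole product at once.\<close>

definition minor_product :: "nat list \<Rightarrow> complex mat \<Rightarrow> complex" where
  "minor_product bs g = det (blockwise_mat bs bs (\<lambda>i j p q. if i = j then g $$ (p, q) else 0))"

text \<open>The first \<open>b\<close> columns of an upper triangular \<open>u\<close> vanish below
  row \<open>b\<close>, so the leading \<open>b\<close> by \<open>b\<close> submatrix of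
  \<open>g * u\<close> is the product of the leading submatrices of \<open>g\<close> and
  \<open>u\<close>.\<close>

lemma minor_product_mult_upper_triangular:
  assumes g: "g \<in> carrier_mat n n" and u: "u \<in> carrier_mat n n" "upper_triangular u"
    and bs: "set bs \<subseteq> {1..n}"
  shows "minor_product bs (g * u) = minor_product bs g * (\<Prod>x<sum_list bs. u $$ (pos_of bs x, pos_of bs x))"
proof -
  let ?B = "\<lambda>g. blockwise_mat bs bs (\<lambda>i j p q. if i = j then g $$ (p, q) else 0)"
  have le: "bs ! i \<le> n" if "i < length bs" for i using bs nth_mem[OF that] by auto
  have u0: "u $$ (i, j) = 0" if "j < i" "i < n" for i j
    using upper_triangularD[OF u(2) that(1)] that(2) u(1) by simp
  have "?B g * ?B u = ?B (g * u)"
    unfolding blockwise_mat_mult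
  proof (rule blockwise_mat_cong)
    fix i j p q assume ij: "i < length bs" "j < length bs" "p < bs ! i" "q < bs ! j"
    have "(\<Sum>l<length bs. \<Sum>r<bs ! l. (if i = l then g $$ (p, r) else 0) * (if l = j then u $$ (r, q) else 0)) =
        (\<Sum>l<length bs. if l = i then \<Sum>r<bs ! i. g $$ (p, r) * (if i = j then u $$ (r, q) else 0) else 0)"
      by (intro sum.cong refl) auto
    also have "\<dots> = (\<Sum>r<bs ! i. g $$ (p, r) * (if i = j then u $$ (r, q) else 0))"
      using ij by simp
    also have "\<dots> = (if i = j then (g * u) $$ (p, q) else 0)"
    proof (cases "i = j")
      case True
      have "(\<Sum>r<bs ! i. g $$ (p, r) * u $$ (r, q)) = (\<Sum>r<n. g $$ (p, r) * u $$ (r, q))"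
        using le[OF ij(1)] ij True by (intro sum.mono_neutral_left) (auto intro!: u0)
      moreover have "(g * u) $$ (p, q) = (\<Sum>r<n. g $$ (p, r) * u $$ (r, q))"
        using g u le[OF ij(1)] ij True by (simp add: scalar_prod_def atLeast0LessThan)
      ultimately show ?thesis using True by simp
    qed simp
    finally show "(\<Sum>l<length bs. \<Sum>r<bs ! l.
        (if i = l then g $$ (p, r) else 0) * (if l = j then u $$ (r, q) else 0)) =
        (if i = j then (g * u) $$ (p, q) else 0)" .
  qed
  then have "minor_product bs (g * u) = det (?B g) * det (?B u)"
    unfolding minor_product_def by (simp add: det_mult[of _ "sum_list bs"] flip: \<open>?B g * ?B u = ?B (g * u)\<close>)
  also have "det (?B u) = (\<Prod>x<sum_list bs. u $$ (pos_of bs x, pos_of bs x))"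
    by (subst det_blockwise_mat_upper_triangular) (auto intro!: u0 dest: le)
  finally show ?thesis by (simp add: minor_product_def)
qed

lemma minor_product_lower_triangular:
  assumes "\<And>i j. i < j \<Longrightarrow> j < n \<Longrightarrow> g $$ (i, j) = 0" and bs: "set bs \<subseteq> {1..n}"
  shows "minor_product bs g = (\<Prod>x<sum_list bs. g $$ (pos_of bs x, pos_of bs x))"
proof -
  have le: "bs ! i \<le> n" if "i < length bs" for i using bs nth_mem[OF that] by auto
  show ?thesis
    unfolding minor_product_def
    by (subst det_blockwise_mat_lower_triangular) (auto intro!: assms(1) dest: le)
qed

text \<open>The Young subgroup of the blocks. Outside it, the Leibniz terms of the block diagonal
  determinant contain a factor from an off-diagonal block and vanish.\<close>

definition block_perms :: "nat list \<Rightarrow> (nat \<Rightarrow> nat) set" where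
  "block_perms bs = {\<sigma>. \<sigma> permutes {..<sum_list bs} \<and> (\<forall>x<sum_list bs. block_of bs (\<sigma> x) = block_of bs x)}"

text \<open>The monomial of the Leibniz term of \<open>\<sigma>\<close>: the letter at
  \<open>c\<close> is the entry of \<open>g\<close> that stands in row \<open>\<sigma> c\<close> and
  column \<open>c\<close> of the block diagonal matrix.\<close>

definition minor_word :: "nat list \<Rightarrow> (nat \<Rightarrow> nat) \<Rightarrow> nat \<Rightarrow> nat \<times> nat" where
  "minor_word bs \<sigma> = (\<lambda>c\<in>{..<sum_list bs}. (pos_of bs (\<sigma> c), pos_of bs c))"

definition minor_coeff :: "nat list \<Rightarrow> (nat \<Rightarrow> nat \<times> nat) \<Rightarrow> complex" where
  "minor_coeff bs w = (\<Sum>\<sigma>\<in>block_perms bs. if w = minor_word bs \<sigma> then signof \<sigma> else 0)"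

text \<open>
  The apolar (Fischer) pairing of the polynomial with coefficients \<open>a\<close> with the product of
  leading principal minors of sizes \<open>bs\<close>: differentiate the former by the latter.
\<close>

definition minor_pairing :: "nat list \<Rightarrow> ((nat \<Rightarrow> nat \<times> nat) \<Rightarrow> complex) \<Rightarrow> complex" where
  "minor_pairing bs a =
    (\<Sum>\<sigma>\<in>block_perms bs. signof \<sigma> * (\<Sum>\<pi> | \<pi> permutes {..<sum_list bs}. a (\<lambda>c. minor_word bs \<sigma> (\<pi> c))))"

lemma finite_block_perms: "finite (block_perms bs)"
  unfolding block_perms_def by (rule finite_subset[OF _ finite_permutations[of "{..<sum_list bs}"]]) auto

lemma block_perms_permutes: "\<sigma> \<in> block_perms bs \<Longrightarrow> \<sigma> permutes {..<sum_list bs}"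
  and block_perms_block_of: "\<sigma> \<in> block_perms bs \<Longrightarrow> x < sum_list bs \<Longrightarrow> block_of bs (\<sigma> x) = block_of bs x"
  by (auto simp: block_perms_def)

lemma minor_word_in_words:
  assumes "\<sigma> \<in> block_perms bs" "set bs \<subseteq> {1..n}"
  shows "minor_word bs \<sigma> \<in> words n (sum_list bs)"
  using permutes_in_image[OF block_perms_permutes[OF assms(1)]] pos_of_less_bound[OF _ assms(2)]
  by (auto simp: minor_word_def words_def)

lemma word_sum_minor_coeff:
  assumes bs: "set bs \<subseteq> {1..n}"
  shows "word_sum n (sum_list bs) (minor_coeff bs) g = minor_product bs g"
proof -
  let ?d = "sum_list bs"
  have "word_sum n ?d (minor_coeff bs) g = (\<Sum>w\<in>words n ?d. \<Sum>\<sigma>\<in>block_perms bs.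
      if w = minor_word bs \<sigma> then signof \<sigma> * (\<Prod>c<?d. g $$ w c) else 0)"
    unfolding word_sum_def minor_coeff_def sum_distrib_right by (intro sum.cong refl) auto
  also have "\<dots> = (\<Sum>\<sigma>\<in>block_perms bs. \<Sum>w\<in>words n ?d.
      if w = minor_word bs \<sigma> then signof \<sigma> * (\<Prod>c<?d. g $$ w c) else 0)"
    by (rule sum.swap)
  also have "\<dots> = (\<Sum>\<sigma>\<in>block_perms bs. signof \<sigma> * (\<Prod>c<?d. g $$ (pos_of bs (\<sigma> c), pos_of bs c)))"
    using minor_word_in_words[OF _ bs]
    by (intro sum.cong refl) (simp add: finite_words minor_word_def)
  also have "\<dots> = (\<Sum>\<sigma> | \<sigma> permutes {..<?d}. signof \<sigma> * (\<Prod>c<?d.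
      blockwise_mat bs bs (\<lambda>i j p q. if i = j then g $$ (p, q) else 0) $$ (\<sigma> c, c)))"
  proof (rule sum.mono_neutral_cong_left)
    show "finite {\<sigma>. \<sigma> permutes {..<?d}}" by (simp add: finite_permutations)
    show "block_perms bs \<subseteq> {\<sigma>. \<sigma> permutes {..<?d}}" by (auto simp: block_perms_def)
    show "\<forall>\<sigma>\<in>{\<sigma>. \<sigma> permutes {..<?d}} - block_perms bs. signof \<sigma> * (\<Prod>c<?d.
      blockwise_mat bs bs (\<lambda>i j p q. if i = j then g $$ (p, q) else 0) $$ (\<sigma> c, c)) = 0"
    proof
      fix \<sigma> assume "\<sigma> \<in> {\<sigma>. \<sigma> permutes {..<?d}} - block_perms bs"
      then have s: "\<sigma> permutes {..<?d}" and "\<exists>x<?d. block_of bs (\<sigma> x) \<noteq> block_of bs x"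
        by (auto simp: block_perms_def)
      then obtain x where x: "x < ?d" "block_of bs (\<sigma> x) \<noteq> block_of bs x" by blast
      then have "blockwise_mat bs bs (\<lambda>i j p q. if i = j then g $$ (p, q) else 0) $$ (\<sigma> x, x) = 0"
        using permutes_in_image[OF s, of x] by simp
      then have "(\<Prod>c<?d. blockwise_mat bs bs (\<lambda>i j p q. if i = j then g $$ (p, q) else 0) $$ (\<sigma> c, c)) = 0"
        using x by (intro prod_zero) auto
      then show "signof \<sigma> * (\<Prod>c<?d.
        blockwise_mat bs bs (\<lambda>i j p q. if i = j then g $$ (p, q) else 0) $$ (\<sigma> c, c)) = 0" by simp
    qed
    fix \<sigma> assume s: "\<sigma> \<in> block_perms bs"
    then have "(\<Prod>c<?d. blockwise_mat bs bs (\<lambda>i j p q. if i = j then g $$ (p, q) else 0) $$ (\<sigma> c, c)) =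
        (\<Prod>c<?d. g $$ (pos_of bs (\<sigma> c), pos_of bs c))"
      using permutes_in_image[OF block_perms_permutes[OF s]] block_perms_block_of[OF s]
      by (intro prod.cong refl) simp
    then show "signof \<sigma> * (\<Prod>c<?d. g $$ (pos_of bs (\<sigma> c), pos_of bs c)) = signof \<sigma> * (\<Prod>c<?d.
      blockwise_mat bs bs (\<lambda>i j p q. if i = j then g $$ (p, q) else 0) $$ (\<sigma> c, c))" by simp
  qed
  also have "\<dots> = minor_product bs g"
    unfolding minor_product_def by (subst det_col[of _ ?d]) (simp_all add: atLeast0LessThan)
  finally show ?thesis .
qed

lemma minor_pairing_add: "minor_pairing bs (\<lambda>w. x * a w + b w) = x * minor_pairing bs a + minor_pairing bs b"
  by (simp add: minor_pairing_def sum.distrib sum_distrib_left algebra_simps)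

text \<open>Together with linearity this makes the pairing depend only on the polynomial function,
  although it is defined by coefficients that are not unique.\<close>

lemma minor_pairing_eq_0:
  assumes "set bs \<subseteq> {1..n}" "\<And>g. g \<in> carrier_mat n n \<Longrightarrow> word_sum n (sum_list bs) a g = 0"
  shows "minor_pairing bs a = 0"
  unfolding minor_pairing_def
  using word_sum_eq_0_imp[OF assms(2) minor_word_in_words[OF _ assms(1)]] by simp

text \<open>Every word that the pairing evaluates has the same row and column content, so the
  pairing sees a single weight part of a polynomial.\<close>

lemma content_minor_word:
  assumes "\<sigma> \<in> block_perms bs" "\<pi> permutes {..<sum_list bs}"
  shows "word_content (sum_list bs) (\<lambda>c. fst (minor_word bs \<sigma> (\<pi> c))) = word_content (sum_list bs) (pos_of bs)"
    and "word_content (sum_list bs) (\<lambda>c. snd (minor_word bs \<sigma> (\<pi> c))) = word_content (sum_list bs) (pos_of bs)"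
proof -
  let ?d = "sum_list bs"
  have "word_content ?d (\<lambda>c. fst (minor_word bs \<sigma> (\<pi> c))) = word_content ?d (\<lambda>c. fst (minor_word bs \<sigma> c))"
    by (rule content_permutes[OF assms(2)])
  also have "\<dots> = word_content ?d (\<lambda>c. pos_of bs (\<sigma> c))"
    by (rule content_cong) (simp add: minor_word_def)
  also have "\<dots> = word_content ?d (pos_of bs)"
    by (rule content_permutes[OF block_perms_permutes[OF assms(1)]])
  finally show "word_content ?d (\<lambda>c. fst (minor_word bs \<sigma> (\<pi> c))) = word_content ?d (pos_of bs)" .
  have "word_content ?d (\<lambda>c. snd (minor_word bs \<sigma> (\<pi> c))) = word_content ?d (\<lambda>c. snd (minor_word bs \<sigma> c))"
    by (rule content_permutes[OF assms(2)])
  also have "\<dots> = word_content ?d (pos_of bs)"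
    by (rule content_cong) (simp add: minor_word_def)
  finally show "word_content ?d (\<lambda>c. snd (minor_word bs \<sigma> (\<pi> c))) = word_content ?d (pos_of bs)" .
qed

text \<open>The pairing of a product of minors with itself is a positive multiple of a sum of squares.\<close>

lemma minor_pairing_self_nonzero:
  assumes bs: "set bs \<subseteq> {1..n}"
  shows "minor_pairing bs (minor_coeff bs) \<noteq> 0"
proof
  assume zero: "minor_pairing bs (minor_coeff bs) = 0"
  let ?d = "sum_list bs" and ?P = "{\<pi>. \<pi> permutes {..<sum_list bs}}"
  \<comment> \<open>\<open>D v\<close> is the coefficient of the word \<open>v\<close> in the
    product of minors, symmetrized over the positions. It is kept real so that its squares are
    nonnegative.\<close>
  define D :: "(nat \<Rightarrow> nat \<times> nat) \<Rightarrow> real" where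
    "D v = (\<Sum>\<sigma>\<in>block_perms bs. \<Sum>\<pi>\<in>?P. if (\<lambda>c. minor_word bs \<sigma> (\<pi> c)) = v then signof \<sigma> else 0)" for v
  have finP: "finite ?P" by (simp add: finite_permutations)
  have in_words: "(\<lambda>c. minor_word bs \<sigma> (\<pi> c)) \<in> words n ?d"
    if "\<sigma> \<in> block_perms bs" "\<pi> \<in> ?P" for \<sigma> \<pi>
    using words_permute[OF minor_word_in_words[OF that(1) bs]] that(2) by simp
  have sum_D: "(\<Sum>v\<in>words n ?d. D v * h v) =
      (\<Sum>\<sigma>\<in>block_perms bs. \<Sum>\<pi>\<in>?P. signof \<sigma> * h (\<lambda>c. minor_word bs \<sigma> (\<pi> c)))" for h
  proof -
    have "(\<Sum>v\<in>words n ?d. D v * h v) = (\<Sum>v\<in>words n ?d. \<Sum>\<sigma>\<in>block_perms bs. \<Sum>\<pi>\<in>?P.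
        if (\<lambda>c. minor_word bs \<sigma> (\<pi> c)) = v then signof \<sigma> * h v else 0)"
      unfolding D_def sum_distrib_right by (intro sum.cong refl) auto
    also have "\<dots> = (\<Sum>\<sigma>\<in>block_perms bs. \<Sum>v\<in>words n ?d. \<Sum>\<pi>\<in>?P.
        if (\<lambda>c. minor_word bs \<sigma> (\<pi> c)) = v then signof \<sigma> * h v else 0)"
      by (rule sum.swap)
    also have "\<dots> = (\<Sum>\<sigma>\<in>block_perms bs. \<Sum>\<pi>\<in>?P. \<Sum>v\<in>words n ?d.
        if (\<lambda>c. minor_word bs \<sigma> (\<pi> c)) = v then signof \<sigma> * h v else 0)"
      by (intro sum.cong refl sum.swap)
    also have "\<dots> = (\<Sum>\<sigma>\<in>block_perms bs. \<Sum>\<pi>\<in>?P. signof \<sigma> * h (\<lambda>c. minor_word bs \<sigma> (\<pi> c)))"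
      using in_words by (intro sum.cong refl) (simp add: finite_words)
    finally show ?thesis .
  qed
  have D_perm: "D (\<lambda>c. v (\<rho> c)) = D v" if \<rho>: "\<rho> \<in> ?P" for v \<rho>
  proof -
    have "(\<Sum>\<pi>\<in>?P. if (\<lambda>c. minor_word bs \<sigma> (\<pi> c)) = (\<lambda>c. v (\<rho> c)) then signof \<sigma> else (0 :: real)) =
        (\<Sum>\<pi>\<in>?P. if (\<lambda>c. minor_word bs \<sigma> (\<pi> c)) = v then signof \<sigma> else 0)" for \<sigma>
    proof (rule sum.reindex_bij_witness[of _ "\<lambda>\<pi>. \<pi> \<circ> \<rho>" "\<lambda>\<pi>. \<pi> \<circ> Hilbert_Choice.inv \<rho>"])
      fix \<pi> assume \<pi>: "\<pi> \<in> ?P"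
      have bij: "bij \<rho>" using \<rho> permutes_bij by auto
      then have inv: "\<rho> (Hilbert_Choice.inv \<rho> c) = c" "Hilbert_Choice.inv \<rho> (\<rho> c) = c" for c
        by (simp_all add: bij_is_surj surj_f_inv_f bij_is_inj)
      show "(\<pi> \<circ> Hilbert_Choice.inv \<rho>) \<circ> \<rho> = \<pi>" "(\<pi> \<circ> \<rho>) \<circ> Hilbert_Choice.inv \<rho> = \<pi>"
        by (auto simp: inv)
      show "\<pi> \<circ> Hilbert_Choice.inv \<rho> \<in> ?P" "\<pi> \<circ> \<rho> \<in> ?P"
        using \<pi> \<rho> by (auto intro: permutes_compose permutes_inv)
      have "(\<lambda>c. minor_word bs \<sigma> ((\<pi> \<circ> Hilbert_Choice.inv \<rho>) c)) = v \<longleftrightarrow>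
          (\<lambda>c. minor_word bs \<sigma> (\<pi> c)) = (\<lambda>c. v (\<rho> c))"
        unfolding fun_eq_iff comp_def by (metis inv)
      then show "(if (\<lambda>c. minor_word bs \<sigma> ((\<pi> \<circ> Hilbert_Choice.inv \<rho>) c)) = v then signof \<sigma> else (0 :: real)) =
          (if (\<lambda>c. minor_word bs \<sigma> (\<pi> c)) = (\<lambda>c. v (\<rho> c)) then signof \<sigma> else 0)"
        by simp
    qed
    then show ?thesis by (simp add: D_def)
  qed
  define E :: real where "E = (\<Sum>\<sigma>\<in>block_perms bs. \<Sum>\<pi>\<in>?P. signof \<sigma> * (\<Sum>\<tau>\<in>block_perms bs.
    if (\<lambda>c. minor_word bs \<sigma> (\<pi> c)) = minor_word bs \<tau> then signof \<tau> else 0))"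
  have "minor_pairing bs (minor_coeff bs) = of_real E"
    by (simp add: E_def minor_pairing_def minor_coeff_def sum_distrib_left if_distrib[of of_real] cong: if_cong)
  then have "0 = E" using zero by simp
  also have "E = (\<Sum>\<sigma>\<in>block_perms bs. \<Sum>\<pi>\<in>?P. signof \<sigma> * (\<Sum>\<tau>\<in>block_perms bs.
    if (\<lambda>c. minor_word bs \<sigma> (\<pi> c)) = minor_word bs \<tau> then signof \<tau> else 0))"
    by (rule E_def)
  also have "\<dots> = (\<Sum>v\<in>words n ?d. D v * (\<Sum>\<tau>\<in>block_perms bs. if v = minor_word bs \<tau> then signof \<tau> else 0))"
    by (rule sum_D[symmetric])
  also have "\<dots> = (\<Sum>v\<in>words n ?d. \<Sum>\<tau>\<in>block_perms bs. if v = minor_word bs \<tau> then signof \<tau> * D v else 0)"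
    unfolding sum_distrib_left by (intro sum.cong refl) auto
  also have "\<dots> = (\<Sum>\<tau>\<in>block_perms bs. \<Sum>v\<in>words n ?d. if v = minor_word bs \<tau> then signof \<tau> * D v else 0)"
    by (rule sum.swap)
  also have "\<dots> = (\<Sum>\<tau>\<in>block_perms bs. signof \<tau> * D (minor_word bs \<tau>))"
    using minor_word_in_words[OF _ bs] by (intro sum.cong refl) (simp add: finite_words)
  finally have *: "(\<Sum>\<tau>\<in>block_perms bs. signof \<tau> * D (minor_word bs \<tau>)) = 0" by simp
  \<comment> \<open>Since \<open>D\<close> is invariant under permutations of the positions, its sum
    of squares is the number of permutations times the pairing.\<close>
  have "(\<Sum>v\<in>words n ?d. D v * D v) = (\<Sum>\<tau>\<in>block_perms bs. \<Sum>\<pi>\<in>?P. signof \<tau> * D (minor_word bs \<tau>))"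
    unfolding sum_D by (intro sum.cong refl) (simp add: D_perm)
  also have "\<dots> = of_nat (card ?P) * (\<Sum>\<tau>\<in>block_perms bs. signof \<tau> * D (minor_word bs \<tau>))"
    by (simp add: sum_distrib_left)
  finally have "(\<Sum>v\<in>words n ?d. D v * D v) = 0" using * by simp
  moreover have id: "id \<in> block_perms bs" by (simp add: block_perms_def permutes_id)
  ultimately have "D (minor_word bs id) = 0"
    using minor_word_in_words[OF id bs] by (subst (asm) sum_nonneg_eq_0_iff) (auto simp: finite_words)
  moreover have "D (minor_word bs id) = (\<Sum>\<pi>\<in>?P. if (\<lambda>c. minor_word bs id (\<pi> c)) = minor_word bs id then 1 else 0)"
  proof -
    \<comment> \<open>A letter of the word of \<open>id\<close> has equal row and column index, so
      \<open>\<sigma>\<close> preserves positions as well as blocks. Hence \<open>D\<close> counts,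
      at this word, the permutations fixing it, and \<open>id\<close> is one of them.\<close>
    have "\<sigma> = id" if \<sigma>: "\<sigma> \<in> block_perms bs" and \<pi>: "\<pi> \<in> ?P"
      and eq: "(\<lambda>c. minor_word bs \<sigma> (\<pi> c)) = minor_word bs id" for \<sigma> \<pi>
    proof
      fix x
      show "\<sigma> x = id x"
      proof (cases "x < ?d")
        case True
        then have "x \<in> \<pi> ` {..<?d}" using \<pi> permutes_image by auto
        then obtain c where c: "c < ?d" "x = \<pi> c" by auto
        have "minor_word bs \<sigma> x = (pos_of bs c, pos_of bs c)"
          using fun_cong[OF eq, of c] c by (simp add: minor_word_def)
        then have "pos_of bs (\<sigma> x) = pos_of bs x" using True by (simp add: minor_word_def)
        then show ?thesis
          using block_positions_inject[of "\<sigma> x" bs x] block_perms_block_of[OF \<sigma> True] True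
            permutes_in_image[OF block_perms_permutes[OF \<sigma>], of x] by simp
      next
        case False
        then show ?thesis using permutes_not_in[OF block_perms_permutes[OF \<sigma>]] by simp
      qed
    qed
    then have "D (minor_word bs id) = (\<Sum>\<sigma>\<in>block_perms bs. if \<sigma> = id then
        \<Sum>\<pi>\<in>?P. if (\<lambda>c. minor_word bs id (\<pi> c)) = minor_word bs id then 1 else 0 else 0)"
      unfolding D_def by (intro sum.cong refl) (auto intro!: sum.neutral sum.cong)
    then show ?thesis using id by (simp add: finite_block_perms)
  qed
  moreover have "(\<Sum>\<pi>\<in>?P. if (\<lambda>c. minor_word bs id (\<pi> c)) = minor_word bs id then 1 else (0 :: real)) \<ge>
      (\<Sum>\<pi>\<in>{id}. if (\<lambda>c. minor_word bs id (\<pi> c)) = minor_word bs id then 1 else 0)"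
    using finP by (intro sum_mono2) (auto simp: permutes_id)
  ultimately show False by simp
qed

section \<open>Polynomials invariant under the unipotent group\<close>

text \<open>Right multiplication by \<open>U\<close> is expressed through its generators, which add
  a multiple of a column to a later one. The condition is imposed on singular matrices too, as
  column elimination and limits pass through them.\<close>

definition unipotent_invariant :: "nat \<Rightarrow> nat \<Rightarrow> ((nat \<Rightarrow> nat \<times> nat) \<Rightarrow> complex) \<Rightarrow> bool" where
  "unipotent_invariant n d a \<longleftrightarrow> (\<forall>g\<in>carrier_mat n n. \<forall>x k l. l < k \<longrightarrow> k < n \<longrightarrow>
     word_sum n d a (addcol x k l g) = word_sum n d a g)"

definition isobaric :: "nat \<Rightarrow> (nat \<Rightarrow> nat) \<Rightarrow> (nat \<Rightarrow> nat \<times> nat) \<Rightarrow> bool" where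
  "isobaric d \<mu> w \<longleftrightarrow> word_content d (\<lambda>c. fst (w c)) = \<mu> \<and> word_content d (\<lambda>c. snd (w c)) = \<mu>"

definition weight_part :: "nat \<Rightarrow> (nat \<Rightarrow> nat) \<Rightarrow> ((nat \<Rightarrow> nat \<times> nat) \<Rightarrow> complex) \<Rightarrow> (nat \<Rightarrow> nat \<times> nat) \<Rightarrow> complex" where
  "weight_part d \<mu> a w = (if isobaric d \<mu> w then a w else 0)"

lemma word_sum_weight_part:
  "word_sum n d (weight_part d \<mu> a) g = (\<Sum>w\<in>{w \<in> words n d. isobaric d \<mu> w}. a w * (\<Prod>c<d. g $$ w c))"
  unfolding word_sum_def weight_part_def sum.inter_filter[OF finite_words]
  by (intro sum.cong) auto

text \<open>
  Scaling rows and columns by suitable powers of one variable \<open>z\<close> separates the weights, because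
  the exponent of \<open>z\<close> in a monomial has the row and column contents as its base \<open>Suc d\<close> digits.
\<close>

lemma unipotent_invariant_weight_part:
  assumes inv: "unipotent_invariant n d a"
    and \<mu>: "\<And>i. \<mu> i \<le> d" "\<And>i. n \<le> i \<Longrightarrow> \<mu> i = 0"
  shows "unipotent_invariant n d (weight_part d \<mu> a)"
  unfolding unipotent_invariant_def
proof (intro ballI allI impI)
  fix g :: "complex mat" and x k l assume g: "g \<in> carrier_mat n n" and kl: "l < k" "k < n"
  let ?M = "Suc d"
  define e where "e w = (\<Sum>c<d. ?M ^ fst (w c) + ?M ^ (n + snd (w c)))" for w :: "nat \<Rightarrow> nat \<times> nat"
  define scale where "scale z h = mat n n (\<lambda>(i, j). z ^ (?M ^ i) * h $$ (i, j) * z ^ (?M ^ (n + j)))"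
    for z :: complex and h
  have scale_sum: "word_sum n d a (scale z h) = (\<Sum>w\<in>words n d. a w * (\<Prod>c<d. h $$ w c) * z ^ e w)" for z h
    unfolding word_sum_def
  proof (intro sum.cong refl)
    fix w assume w: "w \<in> words n d"
    have "(\<Prod>c<d. scale z h $$ w c) = (\<Prod>c<d. h $$ w c * z ^ (?M ^ fst (w c) + ?M ^ (n + snd (w c))))"
    proof (intro prod.cong refl)
      fix c assume "c \<in> {..<d}"
      then show "scale z h $$ w c = h $$ w c * z ^ (?M ^ fst (w c) + ?M ^ (n + snd (w c)))"
        using words_less[OF w, of c] by (cases "w c") (simp add: scale_def power_add)
    qed
    also have "\<dots> = (\<Prod>c<d. h $$ w c) * z ^ e w"
      by (simp add: prod.distrib e_def power_sum)
    finally show "a w * (\<Prod>c<d. scale z h $$ w c) = a w * (\<Prod>c<d. h $$ w c) * z ^ e w" by simp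
  qed
  define \<delta> where "\<delta> w = a w * (\<Prod>c<d. addcol x k l g $$ w c) - a w * (\<Prod>c<d. g $$ w c)" for w
  have zero: "(\<Sum>w\<in>words n d. \<delta> w * z ^ e w) = 0" if z: "z \<noteq> 0" for z
  proof -
    \<comment> \<open>The multiplier for which the column operation commutes with the scaling, which
      multiplies the columns \<open>k\<close> and \<open>l\<close> by different powers of
      \<open>z\<close>.\<close>
    define y where "y = x * z ^ (?M ^ (n + k)) / z ^ (?M ^ (n + l))"
    have "addcol y k l (scale z g) = scale z (addcol x k l g)"
      using g kl z by (intro eq_matI) (auto simp: scale_def y_def field_simps)
    moreover have "word_sum n d a (addcol y k l (scale z g)) = word_sum n d a (scale z g)"
      using inv kl by (simp add: unipotent_invariant_def scale_def)
    ultimately show ?thesis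
      unfolding scale_sum \<delta>_def by (simp add: scale_sum left_diff_distrib sum_subtractf)
  qed
  define e0 where "e0 = (\<Sum>i<n. \<mu> i * ?M ^ i) + (\<Sum>i<n. \<mu> i * ?M ^ (n + i))"
  have e: "e w = e0 \<longleftrightarrow> isobaric d \<mu> w" if w: "w \<in> words n d" for w
  proof -
    let ?r = "word_content d (\<lambda>c. fst (w c))" and ?s = "word_content d (\<lambda>c. snd (w c))"
    \<comment> \<open>The row contents occupy the lower \<open>n\<close> digits and the column
      contents the upper \<open>n\<close>, so both together form one string of \<open>n + n\<close>
      digits.\<close>
    have split: "(\<Sum>i<n. r i * ?M ^ i) + (\<Sum>i<n. s i * ?M ^ (n + i)) =
        (\<Sum>i<n + n. (if i < n then r i else s (i - n)) * ?M ^ i)" for r s :: "nat \<Rightarrow> nat"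
    proof -
      have "(\<Sum>i<n + m. (if i < n then r i else s (i - n)) * ?M ^ i) =
          (\<Sum>i<n. r i * ?M ^ i) + (\<Sum>i<m. s i * ?M ^ (n + i))" for m
        by (induction m) auto
      then show ?thesis by simp
    qed
    have ew: "e w = (\<Sum>i<n. ?r i * ?M ^ i) + (\<Sum>i<n. ?s i * ?M ^ (n + i))"
      unfolding e_def sum.distrib
      using words_less[OF w] sum_content[of d "\<lambda>c. fst (w c)" n "\<lambda>i. ?M ^ i"]
        sum_content[of d "\<lambda>c. snd (w c)" n "\<lambda>i. ?M ^ (n + i)"] by simp
    show ?thesis
    proof
      assume "e w = e0"
      then have "\<forall>i<n + n. (if i < n then ?r i else ?s (i - n)) = (if i < n then \<mu> i else \<mu> (i - n))"
        unfolding ew e0_def split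
        by (intro digits_unique[where M = ?M]) (use \<mu>(1) content_le in \<open>auto simp: less_Suc_eq_le\<close>)
      then have eq: "?r i = \<mu> i" "?s i = \<mu> i" if "i < n" for i
        using that by (auto dest: spec[of _ i] spec[of _ "n + i"])
      have "?r i = 0" "?s i = 0" if "n \<le> i" for i
        by (rule content_zero[where n = n]; use words_less[OF w] that in simp)+
      then have "?r i = \<mu> i" "?s i = \<mu> i" for i using eq \<mu>(2) by (cases "i < n"; simp)+
      then show "isobaric d \<mu> w" by (simp add: isobaric_def fun_eq_iff)
    next
      assume "isobaric d \<mu> w"
      then show "e w = e0" unfolding ew e0_def by (simp add: isobaric_def)
    qed
  qed
  have "(\<Sum>w\<in>{w \<in> words n d. e w = e0}. \<delta> w) = 0"
    by (rule sum_powers_zero[OF finite_words zero])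
  moreover have "{w \<in> words n d. e w = e0} = {w \<in> words n d. isobaric d \<mu> w}"
    using e by auto
  ultimately show "word_sum n d (weight_part d \<mu> a) (addcol x k l g) = word_sum n d (weight_part d \<mu> a) g"
    unfolding word_sum_weight_part by (simp add: \<delta>_def sum_subtractf)
qed

text \<open>In an isobaric word the row indices and the column indices have equal sums. If no row
  index is smaller than its column index, as in every monomial that is nonzero on a lower triangular
  matrix, then all letters are diagonal.\<close>

lemma weight_part_lower_triangular:
  assumes L: "L \<in> carrier_mat n n" "\<And>i j. i < j \<Longrightarrow> j < n \<Longrightarrow> L $$ (i, j) = 0"
  shows "word_sum n d (weight_part d \<mu> a) L =
    (\<Prod>i<n. L $$ (i, i) ^ \<mu> i) * word_sum n d (weight_part d \<mu> a) (1\<^sub>m n)"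
  unfolding word_sum_weight_part sum_distrib_left
proof (intro sum.cong refl)
  fix w assume "w \<in> {w \<in> words n d. isobaric d \<mu> w}"
  then have w: "w \<in> words n d" and iso: "isobaric d \<mu> w" by auto
  show "a w * (\<Prod>c<d. L $$ w c) = (\<Prod>i<n. L $$ (i, i) ^ \<mu> i) * (a w * (\<Prod>c<d. 1\<^sub>m n $$ w c))"
  proof (cases "\<exists>c<d. fst (w c) < snd (w c)")
    case True
    then obtain c where c: "c < d" "fst (w c) < snd (w c)" by blast
    have "L $$ w c = 0" "1\<^sub>m n $$ w c = (0 :: complex)"
      using c words_less[OF w c(1)] L(2)[of "fst (w c)" "snd (w c)"] by (cases "w c"; auto)+
    then have prod0: "(\<Prod>c<d. L $$ w c) = 0" "(\<Prod>c<d. 1\<^sub>m n $$ w c) = (0 :: complex)"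
      using c(1) by (auto intro!: prod_zero)
    show ?thesis unfolding prod0 by simp
  next
    case False
    have sums: "(\<Sum>c<d. fst (w c)) = (\<Sum>c<d. snd (w c))"
      using sum_content[of d "\<lambda>c. fst (w c)" n "\<lambda>i. i"] sum_content[of d "\<lambda>c. snd (w c)" n "\<lambda>i. i"]
        words_less[OF w] iso by (auto simp: isobaric_def)
    have le: "snd (w c) \<le> fst (w c)" if "c < d" for c using False that not_less by blast
    have eq: "fst (w c) = snd (w c)" if "c < d" for c
    proof (rule ccontr)
      assume "fst (w c) \<noteq> snd (w c)"
      then have "(\<Sum>c<d. snd (w c)) < (\<Sum>c<d. fst (w c))"
        using le that by (intro sum_strict_mono_ex1) (auto intro!: bexI[of _ c] le_neq_implies_less)
      with sums show False by simp
    qed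
    have "(\<Prod>c<d. L $$ w c) = (\<Prod>c<d. L $$ (fst (w c), fst (w c)))"
      using eq by (intro prod.cong refl) (metis lessThan_iff prod.collapse)
    also have "\<dots> = (\<Prod>i<n. L $$ (i, i) ^ \<mu> i)"
      using prod_content[of d "\<lambda>c. fst (w c)" n "\<lambda>i. L $$ (i, i)"] words_less[OF w] iso
      by (simp add: isobaric_def)
    moreover have "(\<Prod>c<d. 1\<^sub>m n $$ w c) = (1 :: complex)"
    proof (intro prod.neutral ballI)
      fix c assume "c \<in> {..<d}"
      then show "1\<^sub>m n $$ w c = (1 :: complex)"
        using eq[of c] words_less[OF w, of c] by (cases "w c") auto
    qed
    ultimately show ?thesis by simp
  qed
qed

text \<open>In rows and columns \<open>k\<close> and \<open>Suc k\<close>, one column operation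
  turns the lower triangular block with rows \<open>(z, 0)\<close> and \<open>(1, - 1 / z)\<close>
  into the one with rows \<open>(z, 1)\<close> and \<open>(1, 0)\<close>. So the value at the latter
  is, up to sign, the value at the identity times \<open>z\<close> to the negative exponent
  \<open>\<mu> k - \<mu> (Suc k)\<close>. It stays bounded as \<open>z\<close> tends to
  \<open>0\<close>, which forces the value at the identity to be zero.\<close>

lemma weight_part_not_dominant:
  assumes inv: "unipotent_invariant n d (weight_part d \<mu> a)"
    and k: "Suc k < n" "\<mu> k < \<mu> (Suc k)"
  shows "word_sum n d (weight_part d \<mu> a) (1\<^sub>m n) = 0"
proof -
  let ?P = "word_sum n d (weight_part d \<mu> a)"
  define L where "L z = mat n n (\<lambda>(i, j). if i = j then (if i = k then z else if i = Suc k then - (1 / z) else 1)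
    else if i = Suc k \<and> j = k then 1 else 0)" for z :: complex
  define G where "G z = mat n n (\<lambda>(i, j). if i = j then (if i = k then z else if i = Suc k then 0 else 1)
    else if i = Suc k \<and> j = k \<or> i = k \<and> j = Suc k then 1 else 0)" for z :: complex
  define m where "m = \<mu> (Suc k) - \<mu> k"
  have *: "z ^ m * ?P (G z) = (- 1) ^ \<mu> (Suc k) * ?P (1\<^sub>m n)" if z: "z \<noteq> 0" for z
  proof -
    have "G z = addcol (1 / z) (Suc k) k (L z)"
      using k z by (intro eq_matI) (auto simp: G_def L_def)
    then have "?P (G z) = ?P (L z)"
      using inv k by (simp add: unipotent_invariant_def L_def)
    also have "\<dots> = (\<Prod>i<n. L z $$ (i, i) ^ \<mu> i) * ?P (1\<^sub>m n)"
      by (rule weight_part_lower_triangular) (auto simp: L_def)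
    also have "(\<Prod>i<n. L z $$ (i, i) ^ \<mu> i) = (\<Prod>i\<in>{k, Suc k}. L z $$ (i, i) ^ \<mu> i)"
      using k by (intro prod.mono_neutral_right) (auto simp: L_def)
    also have "\<dots> = z ^ \<mu> k * (- (1 / z)) ^ \<mu> (Suc k)"
      using k by (simp add: L_def)
    finally have "z ^ m * ?P (G z) = z ^ (m + \<mu> k) * (- (1 / z)) ^ \<mu> (Suc k) * ?P (1\<^sub>m n)"
      by (simp add: power_add)
    also have "m + \<mu> k = \<mu> (Suc k)" using k by (simp add: m_def)
    also have "z ^ \<mu> (Suc k) * (- (1 / z)) ^ \<mu> (Suc k) = (- 1) ^ \<mu> (Suc k)"
      using z by (simp flip: power_mult_distrib)
    finally show ?thesis .
  qed
  have "((\<lambda>z. z ^ m * ?P (G z)) \<longlongrightarrow> 0 ^ m * ?P (G 0)) (at 0)"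
    by (intro tendsto_mult tendsto_power tendsto_ident_at word_sum_tendsto)
      (auto simp: G_def intro: tendsto_ident_at)
  moreover have "eventually (\<lambda>z. z ^ m * ?P (G z) = (- 1) ^ \<mu> (Suc k) * ?P (1\<^sub>m n)) (at 0)"
    using * by (auto simp: eventually_at intro!: exI[of _ 1])
  ultimately have "((\<lambda>z :: complex. (- 1) ^ \<mu> (Suc k) * ?P (1\<^sub>m n)) \<longlongrightarrow> 0 ^ m * ?P (G 0)) (at 0)"
    by (rule Lim_transform_eventually)
  then have "(- 1) ^ \<mu> (Suc k) * ?P (1\<^sub>m n) = 0 ^ m * ?P (G 0)"
    by (simp add: tendsto_const_iff)
  then show ?thesis using k by (simp add: m_def power_0_left)
qed

text \<open>
  Column operations make the entries above the diagonal vanish one by one, in lexicographic order;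
  a vanishing pivot is handled by perturbation.
\<close>

lemma unipotent_invariant_eq_0:
  assumes inv: "unipotent_invariant n d a"
    and lower: "\<And>L. L \<in> carrier_mat n n \<Longrightarrow> (\<And>i j. i < j \<Longrightarrow> j < n \<Longrightarrow> L $$ (i, j) = 0) \<Longrightarrow> word_sum n d a L = 0"
    and g: "g \<in> carrier_mat n n"
  shows "word_sum n d a g = 0"
proof -
  \<comment> \<open>The entry \<open>(i, j)\<close> has number \<open>i * n + j\<close>, and all
    entries above the diagonal with number below \<open>t\<close> are already zero. The claim is
    proved downwards from \<open>t = n * n\<close>, where the matrix is lower triangular.\<close>
  have "\<forall>g\<in>carrier_mat n n. (\<forall>i j. i < j \<longrightarrow> j < n \<longrightarrow> i * n + j < t \<longrightarrow> g $$ (i, j) = 0) \<longrightarrow> word_sum n d a g = 0"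
    if "t \<le> n * n" for t
    using that
  proof (induction t rule: inc_induct)
    case base
    have "i * n + j < n * n" if "i < j" "j < n" for i j
    proof -
      have "i * n + j < Suc i * n" using that by simp
      also have "\<dots> \<le> n * n" using that by (intro mult_right_mono) auto
      finally show ?thesis .
    qed
    then show ?case by (auto intro: lower)
  next
    case (step t)
    define k j where "k = t div n" and "j = t mod n"
    have n: "n > 0" using step by (cases n) auto
    have t: "t = k * n + j" "j < n" using n by (simp_all add: k_def j_def)
    have uniq: "i = k \<and> s = j" if "i * n + s = t" "s < n" for i s
      using that n by (auto simp: k_def j_def)
    show ?case
    proof (intro ballI impI)
      fix g :: "complex mat" assume g: "g \<in> carrier_mat n n"
        and z: "\<forall>i j. i < j \<longrightarrow> j < n \<longrightarrow> i * n + j < t \<longrightarrow> g $$ (i, j) = 0"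
      show "word_sum n d a g = 0"
      proof (cases "k < j")
        case False
        have "\<forall>i s. i < s \<longrightarrow> s < n \<longrightarrow> i * n + s < Suc t \<longrightarrow> g $$ (i, s) = 0"
          using z uniq False by (metis less_antisym)
        then show ?thesis using step.IH g by blast
      next
        case True
        have pivot: "word_sum n d a h = 0"
          if h: "h \<in> carrier_mat n n" and hz: "\<forall>i j. i < j \<longrightarrow> j < n \<longrightarrow> i * n + j < t \<longrightarrow> h $$ (i, j) = 0"
            and hk: "h $$ (k, k) \<noteq> 0" for h
        proof -
          let ?h = "addcol (- (h $$ (k, j) / h $$ (k, k))) j k h"
          have "?h $$ (i, s) = 0" if lt: "i < s" "s < n" "i * n + s < Suc t" for i s
          proof (cases "i * n + s = t")
            case eq: True
            then have "i = k" "s = j" using uniq lt(2) by blast+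
            then show ?thesis using h hk True t(2) by simp
          next
            case neq: False
            then have his: "h $$ (i, s) = 0" using lt hz by simp
            \<comment> \<open>The pivot column \<open>k\<close> is already zero in the earlier rows,
              so adding it to column \<open>j\<close> preserves the zeros obtained there.\<close>
            have "h $$ (i, k) = 0" if s: "s = j"
            proof -
              have "i * n < k * n" using neq lt(3) s t(1) by linarith
              then have ik: "i < k" by simp
              have "i * n + k < Suc i * n" using True t(2) by simp
              also have "\<dots> \<le> k * n" using ik by (intro mult_right_mono) auto
              finally have "i * n + k < t" using t(1) by linarith
              then show ?thesis using hz ik True t(2) by simp
            qed
            then show ?thesis using lt(1,2) h his by simp
          qed
          moreover have "?h \<in> carrier_mat n n" using h by auto
          ultimately have "word_sum n d a ?h = 0" using step.IH by blast
          then show ?thesis using inv h True t(2) by (simp add: unipotent_invariant_def)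
        qed
        show ?thesis
        proof (cases "g $$ (k, k) = 0")
          case False
          then show ?thesis using pivot g z by blast
        next
          case gk: True
          \<comment> \<open>Only the diagonal entry \<open>(k, k)\<close> is perturbed, so the zeros
            above the diagonal remain.\<close>
          define h where "h x = mat n n (\<lambda>(i, s). g $$ (i, s) + (if i = k \<and> s = k then x else 0))" for x
          show ?thesis
          proof (rule word_sum_zero_extend[where G = h])
            fix i s assume lt: "i < n" "s < n"
            have "((\<lambda>x. g $$ (i, s) + (if i = k \<and> s = k then x else 0)) \<longlongrightarrow>
                g $$ (i, s) + (if i = k \<and> s = k then 0 else 0)) (at 0)"
              by (cases "i = k \<and> s = k") (auto intro!: tendsto_eq_intros)
            then show "((\<lambda>x. h x $$ (i, s)) \<longlongrightarrow> g $$ (i, s)) (at 0)"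
              using lt by (simp add: h_def)
          next
            have "word_sum n d a (h x) = 0" if "x \<noteq> 0" for x
              using True t(2) z gk that by (intro pivot) (auto simp: h_def)
            then show "eventually (\<lambda>x. word_sum n d a (h x) = 0) (at 0)"
              by (auto simp: eventually_at intro!: exI[of _ 1])
          qed
        qed
      qed
    qed
  qed
  from this[of 0] show ?thesis using g by simp
qed

lemma weight_part_dominant:
  assumes inv: "unipotent_invariant n d (weight_part d \<mu> a)"
    and bs: "set bs \<subseteq> {1..n}" "sum_list bs = d" "word_content d (pos_of bs) = \<mu>"
  shows "word_sum n d (weight_part d \<mu> a) (1\<^sub>m n) = minor_pairing bs a / minor_pairing bs (minor_coeff bs)"
proof -
  let ?\<kappa> = "word_sum n d (weight_part d \<mu> a) (1\<^sub>m n)"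
  \<comment> \<open>The difference of the weight part and \<open>?\<kappa>\<close> times the product
    of minors is invariant and vanishes on lower triangular matrices. Hence it is the zero
    polynomial, and its pairing is zero.\<close>
  define r where "r w = - ?\<kappa> * minor_coeff bs w + weight_part d \<mu> a w" for w
  have r: "word_sum n d r g = - ?\<kappa> * minor_product bs g + word_sum n d (weight_part d \<mu> a) g" for g
    unfolding r_def word_sum_add using word_sum_minor_coeff[OF bs(1), of g] bs(2) by simp
  have "word_sum n d r g = 0" if g: "g \<in> carrier_mat n n" for g
  proof (rule unipotent_invariant_eq_0[OF _ _ g])
    have "minor_product bs (addcol x k l g) = minor_product bs g"
      if g: "g \<in> carrier_mat n n" and kl: "l < k" "k < n" for g x k l
    proof -
      let ?u = "addrow_mat n x l k"
      have "minor_product bs (addcol x k l g) = minor_product bs (g * ?u)"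
        using addcol_mat[OF g, of l x k] kl by simp
      also have "\<dots> = minor_product bs g * (\<Prod>x<sum_list bs. ?u $$ (pos_of bs x, pos_of bs x))"
        using kl by (intro minor_product_mult_upper_triangular[OF g _ _ bs(1)]) (auto simp: upper_triangular_def)
      also have "(\<Prod>x<sum_list bs. ?u $$ (pos_of bs x, pos_of bs x)) = 1"
        using kl pos_of_less_bound[OF _ bs(1)] by (intro prod.neutral) auto
      finally show ?thesis by simp
    qed
    then show "unipotent_invariant n d r"
      using inv by (simp add: unipotent_invariant_def r)
    fix L :: "complex mat" assume L: "L \<in> carrier_mat n n" "\<And>i j. i < j \<Longrightarrow> j < n \<Longrightarrow> L $$ (i, j) = 0"
    have "minor_product bs L = (\<Prod>x<d. L $$ (pos_of bs x, pos_of bs x))"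
      using minor_product_lower_triangular[OF L(2) bs(1)] bs(2) by simp
    also have "\<dots> = (\<Prod>i<n. L $$ (i, i) ^ \<mu> i)"
      using prod_content[of d "pos_of bs" n "\<lambda>i. L $$ (i, i)"] pos_of_less_bound[OF _ bs(1)] bs by simp
    finally have "minor_product bs L = (\<Prod>i<n. L $$ (i, i) ^ \<mu> i)" .
    moreover have "word_sum n d (weight_part d \<mu> a) L = (\<Prod>i<n. L $$ (i, i) ^ \<mu> i) * ?\<kappa>"
      by (rule weight_part_lower_triangular[OF L])
    ultimately show "word_sum n d r L = 0" by (simp add: r)
  qed
  then have "minor_pairing bs r = 0"
    using minor_pairing_eq_0[OF bs(1), of r] bs(2) by simp
  then have "minor_pairing bs (weight_part d \<mu> a) = ?\<kappa> * minor_pairing bs (minor_coeff bs)"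
    unfolding r_def minor_pairing_add by simp
  \<comment> \<open>The other weights are invisible to the pairing, so the weight part can be
    replaced by \<open>a\<close> and the formula becomes linear in \<open>a\<close> itself.\<close>
  moreover have "minor_pairing bs (weight_part d \<mu> a) = minor_pairing bs a"
    unfolding minor_pairing_def
    using content_minor_word[of _ bs] bs by (intro sum.cong refl arg_cong2[where f = "(*)"]) (simp add: weight_part_def isobaric_def)
  ultimately show ?thesis
    using minor_pairing_self_nonzero[OF bs(1)] by (simp add: field_simps)
qed

section \<open>Dominant weights and the value at the identity\<close>

definition conjugate_partition :: "nat \<Rightarrow> (nat \<Rightarrow> nat) \<Rightarrow> nat list" where
  "conjugate_partition n \<mu> = map (\<lambda>j. card {i. i < n \<and> j < \<mu> i}) [0..<\<mu> 0]"

text \<open>As \<open>\<mu>\<close> decreases, the \<open>i\<close> with \<open>j < \<mu> i\<close>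
  form an initial segment. So position \<open>q\<close> occurs in block \<open>j\<close> exactly if
  \<open>j < \<mu> q\<close>, hence \<open>\<mu> q\<close> times altogether: these are the sizes of
  minors whose product has weight \<open>\<mu>\<close>.\<close>

lemma conjugate_partition:
  assumes n: "n \<ge> 1" and anti: "\<And>k. Suc k < n \<Longrightarrow> \<mu> (Suc k) \<le> \<mu> k" and zero: "\<And>i. n \<le> i \<Longrightarrow> \<mu> i = 0"
    and sum: "(\<Sum>i<n. \<mu> i) = d"
  shows "set (conjugate_partition n \<mu>) \<subseteq> {1..n}" "sum_list (conjugate_partition n \<mu>) = d"
    "word_content d (pos_of (conjugate_partition n \<mu>)) = \<mu>"
proof -
  let ?bs = "conjugate_partition n \<mu>"
  have "\<mu> (Suc k) \<le> \<mu> k" for k using anti zero by (cases "Suc k < n") auto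
  then have mono: "\<mu> j \<le> \<mu> i" if "i \<le> j" for i j
    using that by (rule lift_Suc_antimono_le)
  have card_le: "card {i. i < n \<and> j < \<mu> i} \<le> n" for j
    using card_mono[of "{..<n}" "{i. i < n \<and> j < \<mu> i}"] by auto
  have card_less: "q < card {i. i < n \<and> j < \<mu> i} \<longleftrightarrow> j < \<mu> q" for q j
  proof
    assume q: "j < \<mu> q"
    have "{..q} \<subseteq> {i. i < n \<and> j < \<mu> i}"
      using q mono zero by (auto intro: less_le_trans) (metis gr_implies_not0 le_less_trans not_le)
    then have "card {..q} \<le> card {i. i < n \<and> j < \<mu> i}" by (intro card_mono) auto
    then show "q < card {i. i < n \<and> j < \<mu> i}" by simp
  next
    assume q: "q < card {i. i < n \<and> j < \<mu> i}"
    show "j < \<mu> q"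
    proof (rule ccontr)
      assume "\<not> j < \<mu> q"
      then have "{i. i < n \<and> j < \<mu> i} \<subseteq> {..<q}"
        using mono by (auto simp: not_less) (metis leD le_trans not_le_imp_less)
      then have "card {i. i < n \<and> j < \<mu> i} \<le> card {..<q}" by (intro card_mono) auto
      then show False using q by simp
    qed
  qed
  show "set ?bs \<subseteq> {1..n}"
    using card_le card_less[of 0] by (fastforce simp: conjugate_partition_def Suc_le_eq)
  have content: "word_content (sum_list ?bs) (pos_of ?bs) q = \<mu> q" for q
  proof -
    have "word_content (sum_list ?bs) (pos_of ?bs) q = (\<Sum>x<sum_list ?bs. if pos_of ?bs x = q then 1 else 0)"
      by (simp add: word_content_def sum.If_cases Int_def)
    also have "\<dots> = (\<Sum>j<length ?bs. \<Sum>p<?bs ! j. if p = q then 1 else 0)"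
      using sum_block_positions[of "\<lambda>u. if snd u = q then 1 else 0" ?bs] by simp
    also have "\<dots> = (\<Sum>j<\<mu> 0. if j < \<mu> q then 1 else 0)"
      by (simp add: conjugate_partition_def card_less)
    also have "\<dots> = card {j. j < \<mu> 0 \<and> j < \<mu> q}" by (simp add: sum.If_cases Int_def)
    also have "{j. j < \<mu> 0 \<and> j < \<mu> q} = {..<\<mu> q}" using mono[of 0 q] by auto
    finally show ?thesis by simp
  qed
  have "sum_list ?bs = (\<Sum>x<sum_list ?bs. 1)" by simp
  also have "\<dots> = (\<Sum>i<n. word_content (sum_list ?bs) (pos_of ?bs) i * 1)"
    using pos_of_less_bound[OF _ \<open>set ?bs \<subseteq> {1..n}\<close>] by (rule sum_content)
  also have "\<dots> = d" using sum by (simp add: content)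
  finally show d: "sum_list ?bs = d" .
  show "word_content d (pos_of ?bs) = \<mu>" using content d by auto
qed

lemma word_sum_one_weight_parts:
  "word_sum n d a (1\<^sub>m n) =
    (\<Sum>\<mu>\<in>(\<lambda>w. word_content d (\<lambda>c. fst (w c))) ` words n d. word_sum n d (weight_part d \<mu> a) (1\<^sub>m n))"
proof -
  let ?f = "\<lambda>w. a w * (\<Prod>c<d. 1\<^sub>m n $$ w c)" and ?r = "\<lambda>w. word_content d (\<lambda>c. fst (w c))"
  have "word_sum n d a (1\<^sub>m n) = (\<Sum>\<mu>\<in>?r ` words n d. \<Sum>w\<in>{w \<in> words n d. ?r w = \<mu>}. ?f w)"
    unfolding word_sum_def by (rule sum.group[symmetric]) (auto simp: finite_words)
  also have "\<dots> = (\<Sum>\<mu>\<in>?r ` words n d. word_sum n d (weight_part d \<mu> a) (1\<^sub>m n))"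
    unfolding word_sum_weight_part
  proof (rule sum.cong[OF refl], rule sum.mono_neutral_right)
    fix \<mu>
    show "\<forall>w\<in>{w \<in> words n d. ?r w = \<mu>} - {w \<in> words n d. isobaric d \<mu> w}. ?f w = 0"
    proof
      fix w assume "w \<in> {w \<in> words n d. ?r w = \<mu>} - {w \<in> words n d. isobaric d \<mu> w}"
      then have w: "w \<in> words n d" and "word_content d (\<lambda>c. fst (w c)) \<noteq> word_content d (\<lambda>c. snd (w c))"
        by (auto simp: isobaric_def)
      then obtain c where c: "c < d" "fst (w c) \<noteq> snd (w c)"
        using content_cong[of d "\<lambda>c. fst (w c)" "\<lambda>c. snd (w c)"] by blast
      then have "1\<^sub>m n $$ w c = (0 :: complex)"
        using words_less[OF w c(1)] by (cases "w c") auto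
      then show "?f w = 0" using c(1) by (auto intro!: prod_zero)
    qed
  qed (auto simp: finite_words isobaric_def)
  finally show ?thesis .
qed

text \<open>\<open>\<Lambda>\<close> is obtained before \<open>a\<close>: one linear functional
  serves all invariant polynomials of degree \<open>d\<close>. Later \<open>a\<close> varies with
  \<open>N\<close>, while \<open>\<Lambda>\<close> and the denominators stay fixed.\<close>

lemma unipotent_invariant_value:
  assumes n: "n \<ge> 1"
  obtains \<Lambda> where "finite \<Lambda>"
    "\<And>\<mu>. \<mu> \<in> \<Lambda> \<Longrightarrow> set (conjugate_partition n \<mu>) \<subseteq> {1..n} \<and> sum_list (conjugate_partition n \<mu>) = d"
    "\<And>a. unipotent_invariant n d a \<Longrightarrow> word_sum n d a (1\<^sub>m n) =
      (\<Sum>\<mu>\<in>\<Lambda>. minor_pairing (conjugate_partition n \<mu>) a /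
        minor_pairing (conjugate_partition n \<mu>) (minor_coeff (conjugate_partition n \<mu>)))"
proof -
  let ?\<Lambda> = "(\<lambda>w. word_content d (\<lambda>c. fst (w c))) ` words n d"
  let ?D = "{\<mu> \<in> ?\<Lambda>. \<forall>k. Suc k < n \<longrightarrow> \<mu> (Suc k) \<le> \<mu> k}"
  have \<Lambda>: "\<mu> i \<le> d" "n \<le> i \<Longrightarrow> \<mu> i = 0" "(\<Sum>i<n. \<mu> i) = d" if "\<mu> \<in> ?\<Lambda>" for \<mu> i
  proof -
    from that obtain w where w: "w \<in> words n d" "\<mu> = word_content d (\<lambda>c. fst (w c))" by auto
    show "\<mu> i \<le> d" using w content_le by simp
    show "\<mu> i = 0" if "n \<le> i"
      unfolding w(2) by (rule content_zero[where n = n]) (use words_less[OF w(1)] that in simp_all)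
    show "(\<Sum>i<n. \<mu> i) = d"
      using sum_content[of d "\<lambda>c. fst (w c)" n "\<lambda>_. 1"] words_less[OF w(1)] w(2) by simp
  qed
  have conj: "set (conjugate_partition n \<mu>) \<subseteq> {1..n}" "sum_list (conjugate_partition n \<mu>) = d"
    "word_content d (pos_of (conjugate_partition n \<mu>)) = \<mu>" if "\<mu> \<in> ?D" for \<mu>
    using conjugate_partition[OF n, of \<mu> d] \<Lambda>[of \<mu>] that by auto
  show thesis
  proof (rule that[of ?D])
    show "finite ?D" by (simp add: finite_words)
    show "set (conjugate_partition n \<mu>) \<subseteq> {1..n} \<and> sum_list (conjugate_partition n \<mu>) = d"
      if "\<mu> \<in> ?D" for \<mu> using conj[OF that] by simp
    fix a assume inv: "unipotent_invariant n d a"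
    have inv': "unipotent_invariant n d (weight_part d \<mu> a)" if "\<mu> \<in> ?\<Lambda>" for \<mu>
      using unipotent_invariant_weight_part[OF inv] \<Lambda>[OF that] by blast
    have "word_sum n d a (1\<^sub>m n) = (\<Sum>\<mu>\<in>?\<Lambda>. word_sum n d (weight_part d \<mu> a) (1\<^sub>m n))"
      by (rule word_sum_one_weight_parts)
    also have "\<dots> = (\<Sum>\<mu>\<in>?D. word_sum n d (weight_part d \<mu> a) (1\<^sub>m n))"
    proof (rule sum.mono_neutral_right)
      show "\<forall>\<mu>\<in>?\<Lambda> - ?D. word_sum n d (weight_part d \<mu> a) (1\<^sub>m n) = 0"
      proof
        fix \<mu> assume "\<mu> \<in> ?\<Lambda> - ?D"
        then obtain k where "\<mu> \<in> ?\<Lambda>" "Suc k < n" "\<mu> k < \<mu> (Suc k)" by (auto simp: not_le)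
        then show "word_sum n d (weight_part d \<mu> a) (1\<^sub>m n) = 0"
          using weight_part_not_dominant[OF inv'] by blast
      qed
    qed (auto simp: finite_words)
    also have "\<dots> = (\<Sum>\<mu>\<in>?D. minor_pairing (conjugate_partition n \<mu>) a /
        minor_pairing (conjugate_partition n \<mu>) (minor_coeff (conjugate_partition n \<mu>)))"
      using inv' conj by (intro sum.cong refl weight_part_dominant) auto
    finally show "word_sum n d a (1\<^sub>m n) = \<dots>" .
  qed
qed

section \<open>Regular functions on the nilpotent cone\<close>

lemma gen_alg_extensional: "f \<in> gen_alg X G \<Longrightarrow> f \<in> extensional X"
  by (induction rule: gen_alg.induct) (auto simp: extensional_def)

lemma gen_alg_cong:
  "(\<lambda>x\<in>X. f x) \<in> gen_alg X G \<Longrightarrow> (\<And>x. x \<in> X \<Longrightarrow> f x = h x) \<Longrightarrow> (\<lambda>x\<in>X. h x) \<in> gen_alg X G"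
  by (metis restrict_ext)

lemma gen_alg_plus:
  assumes "(\<lambda>x\<in>X. f x) \<in> gen_alg X G" "(\<lambda>x\<in>X. h x) \<in> gen_alg X G"
  shows "(\<lambda>x\<in>X. f x + h x) \<in> gen_alg X G"
  by (rule gen_alg_cong[OF gen_alg.add[OF assms]]) simp

lemma gen_alg_times:
  assumes "(\<lambda>x\<in>X. f x) \<in> gen_alg X G" "(\<lambda>x\<in>X. h x) \<in> gen_alg X G"
  shows "(\<lambda>x\<in>X. f x * h x) \<in> gen_alg X G"
  by (rule gen_alg_cong[OF gen_alg.mult[OF assms]]) simp

lemma gen_alg_cmult: "(\<lambda>x\<in>X. f x) \<in> gen_alg X G \<Longrightarrow> (\<lambda>x\<in>X. c * f x) \<in> gen_alg X G"
  by (rule gen_alg_times[OF gen_alg.const])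

lemma gen_alg_sum:
  "(\<And>i. i \<in> I \<Longrightarrow> (\<lambda>x\<in>X. f i x) \<in> gen_alg X G) \<Longrightarrow> (\<lambda>x\<in>X. \<Sum>i\<in>I. f i x) \<in> gen_alg X G"
  by (induction I rule: infinite_finite_induct) (simp_all add: gen_alg.const gen_alg_plus)

lemma gen_alg_prod:
  "(\<And>i. i \<in> I \<Longrightarrow> (\<lambda>x\<in>X. f i x) \<in> gen_alg X G) \<Longrightarrow> (\<lambda>x\<in>X. \<Prod>i\<in>I. f i x) \<in> gen_alg X G"
  by (induction I rule: infinite_finite_induct) (simp_all add: gen_alg.const gen_alg_times)

section \<open>Brackets and Cramer's rule\<close>

text \<open>Regular functions will be evaluated at conjugates by arbitrary invertible matrices, not
  only by elements of the Borel subgroup.\<close>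

lemma conj_nilpotent_cone:
  assumes N: "N \<in> nilpotent_cone n"
    and gh: "g \<in> carrier_mat n n" "h \<in> carrier_mat n n" "g * h = 1\<^sub>m n" "h * g = 1\<^sub>m n"
  shows "g * N * h \<in> nilpotent_cone n"
proof -
  obtain k where k: "N \<in> carrier_mat n n" "N ^\<^sub>m k = 0\<^sub>m n n"
    using N by (auto simp: nilpotent_cone_def)
  have "similar_mat_wit (g * N * h) N g h"
    using gh k by (auto simp: similar_mat_wit_def Let_def)
  then have "(g * N * h) ^\<^sub>m k = g * N ^\<^sub>m k * h" by (rule similar_mat_wit_pow_id)
  also have "\<dots> = 0\<^sub>m n n" using k gh by simp
  finally show ?thesis using gh k by (auto simp: nilpotent_cone_def)
qed

text \<open>
  Up to sign, a product of \<open>k\<close> determinants of size \<open>n\<close>, collected in one matrix of size \<open>n k\<close>: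
  column \<open>c\<close> is \<open>N\<^sup>m g e\<^sub>j\<close> with \<open>m = m c\<close> and \<open>j = j c\<close>, and belongs to the factor \<open>l c\<close>.
\<close>

definition bracket :: "nat \<Rightarrow> nat \<Rightarrow> (nat \<Rightarrow> nat) \<Rightarrow> (nat \<Rightarrow> nat) \<Rightarrow> (nat \<Rightarrow> nat) \<Rightarrow> complex mat \<Rightarrow> complex mat \<Rightarrow> complex" where
  "bracket n k l m j N g = det (mat (n * k) (n * k) (\<lambda>(x, c).
     if x div n = l c then (N ^\<^sub>m m c * g) $$ (x mod n, j c) else 0))"

text \<open>The linear span of the brackets with \<open>k\<close> factors. Scalars and index
  functions depend neither on \<open>N\<close> nor on \<open>g\<close>, and the inductive form
  allows linear properties to be checked on one bracket at a time.\<close>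

inductive bracket_poly :: "nat \<Rightarrow> nat \<Rightarrow> (complex mat \<Rightarrow> complex mat \<Rightarrow> complex) \<Rightarrow> bool" for n k where
  zero: "bracket_poly n k (\<lambda>N g. 0)"
| step: "bracket_poly n k p \<Longrightarrow> (\<And>c. c < n * k \<Longrightarrow> l c < k \<and> j c < n) \<Longrightarrow>
    bracket_poly n k (\<lambda>N g. x * bracket n k l m j N g + p N g)"

lemma bracket_poly_bracket:
  assumes "\<And>c. c < n * k \<Longrightarrow> l c < k \<and> j c < n"
  shows "bracket_poly n k (\<lambda>N g. x * bracket n k l m j N g)"
  using bracket_poly.step[OF bracket_poly.zero assms] by simp

lemma bracket_poly_add:
  assumes "bracket_poly n k p" "bracket_poly n k q"
  shows "bracket_poly n k (\<lambda>N g. y * p N g + q N g)"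
  using assms(1)
proof induction
  case zero
  then show ?case using assms(2) by simp
next
  case (step p l j x m)
  show ?case
    using bracket_poly.step[where l = l and x = "y * x" and m = m and j = j, OF step.IH step.hyps(2)]
    by (simp add: algebra_simps)
qed

text \<open>Numbering the factors of the second bracket from \<open>k\<close> on makes the combined
  matrix block diagonal, so that no sign arises.\<close>

lemma bracket_mult:
  assumes n: "n \<ge> 1" and l: "\<And>c. c < n * k \<Longrightarrow> l c < k"
  shows "bracket n k l m j N g * bracket n k' l' m' j' N g =
    bracket n (k + k') (\<lambda>c. if c < n * k then l c else k + l' (c - n * k))
      (\<lambda>c. if c < n * k then m c else m' (c - n * k)) (\<lambda>c. if c < n * k then j c else j' (c - n * k)) N g"
proof -
  let ?f = "\<lambda>l m j (x, c). if x div n = l c then (N ^\<^sub>m m c * g) $$ (x mod n, j c) else 0"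
  let ?A = "mat (n * k) (n * k) (?f l m j)" and ?D = "mat (n * k') (n * k') (?f l' m' j')"
  let ?F = "mat (n * (k + k')) (n * (k + k')) (?f (\<lambda>c. if c < n * k then l c else k + l' (c - n * k))
      (\<lambda>c. if c < n * k then m c else m' (c - n * k)) (\<lambda>c. if c < n * k then j c else j' (c - n * k)))"
  have "?F = four_block_mat ?A (0\<^sub>m (n * k) (n * k')) (0\<^sub>m (n * k') (n * k)) ?D"
  proof (rule eq_matI)
    fix x c
    assume "x < dim_row (four_block_mat ?A (0\<^sub>m (n * k) (n * k')) (0\<^sub>m (n * k') (n * k)) ?D)"
      and "c < dim_col (four_block_mat ?A (0\<^sub>m (n * k) (n * k')) (0\<^sub>m (n * k') (n * k)) ?D)"
    then have xc: "x < n * k + n * k'" "c < n * k + n * k'" by simp_all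
    have xk: "x div n < k \<longleftrightarrow> x < n * k"
      using n by (simp add: div_less_iff_less_mult mult.commute)
    have shift: "(x - n * k) div n = x div n - k" "(x - n * k) mod n = x mod n" if "\<not> x < n * k"
    proof -
      define y where "y = x - n * k"
      have y: "x = n * k + y" using that by (simp add: y_def)
      then show "(x - n * k) div n = x div n - k" "(x - n * k) mod n = x mod n" using n by simp_all
    qed
    show "?F $$ (x, c) = four_block_mat ?A (0\<^sub>m (n * k) (n * k')) (0\<^sub>m (n * k') (n * k)) ?D $$ (x, c)"
    proof (cases "x < n * k")
      case x: True
      show ?thesis
      proof (cases "c < n * k")
        case True
        then show ?thesis using x xc by (simp add: distrib_left)
      next
        case False
        moreover have "x div n \<noteq> k + l' (c - n * k)" using x xk by simp
        ultimately show ?thesis using x xc by (simp add: distrib_left)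
      qed
    next
      case x: False
      then have k: "k \<le> x div n" using xk by simp
      show ?thesis
      proof (cases "c < n * k")
        case True
        moreover have "x div n \<noteq> l c" using k l[OF True] by simp
        ultimately show ?thesis using x xc by (simp add: distrib_left)
      next
        case False
        moreover have "x div n = k + l' (c - n * k) \<longleftrightarrow> (x - n * k) div n = l' (c - n * k)"
          using k shift(1)[OF x] by auto
        ultimately show ?thesis using x xc shift(2)[OF x] by (simp add: distrib_left)
      qed
    qed
  qed (simp_all add: distrib_left)
  then have "det ?F = det ?A * det ?D"
    using det_four_block_mat_lower_left_zero[of ?A "n * k" "0\<^sub>m (n * k) (n * k')" "n * k'" "0\<^sub>m (n * k') (n * k)" ?D]
    by simp
  then show ?thesis by (simp add: bracket_def)
qed

lemma bracket_poly_mult: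
  assumes n: "n \<ge> 1" and p: "bracket_poly n k p" and q: "bracket_poly n k' q"
  shows "bracket_poly n (k + k') (\<lambda>N g. p N g * q N g)"
  using p
proof induction
  case zero
  then show ?case using bracket_poly.zero by simp
next
  case (step p l j x m)
  note lj = step.hyps(2)
  have "bracket_poly n (k + k') (\<lambda>N g. bracket n k l m j N g * q N g)"
    using q
  proof induction
    case zero
    then show ?case using bracket_poly.zero by simp
  next
    case (step q l' j' y m')
    let ?l = "\<lambda>c. if c < n * k then l c else k + l' (c - n * k)"
    let ?j = "\<lambda>c. if c < n * k then j c else j' (c - n * k)"
    have eq: "bracket n k l m j N g * bracket n k' l' m' j' N g =
        bracket n (k + k') ?l (\<lambda>c. if c < n * k then m c else m' (c - n * k)) ?j N g" for N g
      using lj by (intro bracket_mult[OF n]) blast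
    have "?l c < k + k' \<and> ?j c < n" if "c < n * (k + k')" for c
      using lj[of c] step.hyps(2)[of "c - n * k"] that
      by (auto simp: distrib_left)
    from bracket_poly.step[where l = ?l and j = ?j and x = y
        and m = "\<lambda>c. if c < n * k then m c else m' (c - n * k)", OF step.IH this]
    show ?case
      unfolding eq[symmetric] by (simp add: algebra_simps)
  qed
  from bracket_poly_add[OF this step.IH, of x] show ?case by (simp add: algebra_simps)
qed

text \<open>Additional factors \<open>det g\<close> pad a bracket polynomial to a prescribed
  \<open>k\<close>, which brings terms of different degree to a common one.\<close>

lemma bracket_poly_det_power:
  assumes n: "n \<ge> 1"
  shows "\<exists>p. bracket_poly n k p \<and> (\<forall>N\<in>carrier_mat n n. \<forall>g\<in>carrier_mat n n. p N g = det g ^ k)"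
proof (induction k)
  case 0
  have "bracket_poly n 0 (\<lambda>N g. 1 * bracket n 0 (\<lambda>_. 0) (\<lambda>_. 0) (\<lambda>_. 0) N g)"
    by (rule bracket_poly_bracket) simp
  then show ?case by (intro exI conjI, assumption) (simp add: bracket_def)
next
  case (Suc k)
  then obtain p where p: "bracket_poly n k p" "\<forall>N\<in>carrier_mat n n. \<forall>g\<in>carrier_mat n n. p N g = det g ^ k"
    by blast
  have b: "bracket_poly n 1 (\<lambda>N g. 1 * bracket n 1 (\<lambda>_. 0) (\<lambda>_. 0) (\<lambda>c. c) N g)"
    by (rule bracket_poly_bracket) simp
  have "bracket n 1 (\<lambda>_. 0) (\<lambda>_. 0) (\<lambda>c. c) N g = det g"
    if "N \<in> carrier_mat n n" "g \<in> carrier_mat n n" for N g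
  proof -
    have "mat (n * 1) (n * 1) (\<lambda>(x, c). if x div n = 0 then (N ^\<^sub>m 0 * g) $$ (x mod n, c) else 0) = g"
      using that n by (intro eq_matI) auto
    then show ?thesis by (simp add: bracket_def)
  qed
  then show ?case
    using bracket_poly_mult[OF n p(1) b] p(2) by (intro exI conjI, simp) simp
qed

text \<open>Column \<open>j\<close> of \<open>h * N * g\<close> solves the linear system with matrix
  \<open>g\<close> and right-hand side column \<open>j\<close> of \<open>N * g\<close>. Its entry
  \<open>i\<close> therefore comes from \<open>g\<close> with column \<open>i\<close> replaced by
  that right-hand side.\<close>

lemma bracket_poly_entry:
  assumes n: "n \<ge> 1" and ij: "i < n" "j < n"
  shows "\<exists>p. bracket_poly n 1 p \<and> (\<forall>N\<in>carrier_mat n n. \<forall>g\<in>carrier_mat n n. \<forall>h\<in>carrier_mat n n.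
    g * h = 1\<^sub>m n \<longrightarrow> p N g = (h * N * g) $$ (i, j) * det g)"
proof -
  let ?m = "\<lambda>c. if c = i then 1 else 0" and ?j = "\<lambda>c. if c = i then j else c"
  have b: "bracket_poly n 1 (\<lambda>N g. 1 * bracket n 1 (\<lambda>_. 0) ?m ?j N g)"
    by (rule bracket_poly_bracket) (use ij in auto)
  have "bracket n 1 (\<lambda>_. 0) ?m ?j N g = (h * N * g) $$ (i, j) * det g"
    if N: "N \<in> carrier_mat n n" and g: "g \<in> carrier_mat n n" and h: "h \<in> carrier_mat n n" and gh: "g * h = 1\<^sub>m n"
    for N g h
  proof -
    have hNg: "h * N * g \<in> carrier_mat n n" using N g h by simp
    have "g * (h * N * g) = (g * h) * (N * g)"
      using N g h by (simp add: assoc_mult_mat[of _ n n _ n _ n])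
    then have ghNg: "g * (h * N * g) = N * g" using gh N g by simp
    have "g *\<^sub>v col (h * N * g) j = col (N * g) j"
      using col_mult2[OF g hNg ij(2)] ghNg by simp
    moreover have "det (replace_col g (g *\<^sub>v col (h * N * g) j) i) = col (h * N * g) j $ i * det g"
      by (rule cramer_lemma_mat[OF g _ ij(1)]) (use hNg ij in auto)
    moreover have "col (h * N * g) j $ i = (h * N * g) $$ (i, j)"
      using hNg ij by (intro index_col) auto
    ultimately have "det (replace_col g (col (N * g) j) i) = (h * N * g) $$ (i, j) * det g"
      by simp
    moreover have "replace_col g (col (N * g) j) i = mat (n * 1) (n * 1) (\<lambda>(x, c).
        if x div n = 0 then (N ^\<^sub>m ?m c * g) $$ (x mod n, ?j c) else 0)"
      using N g n ij by (intro eq_matI) (auto simp: replace_col_def)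
    ultimately show ?thesis by (simp add: bracket_def)
  qed
  note entry = this
  show ?thesis
    by (rule exI, rule conjI, rule b, intro ballI impI, unfold mult_1, rule entry)
qed

text \<open>
  By Cramer's rule the entries of \<open>det g\<close> times \<open>g\<^sup>-\<^sup>1 N g\<close> are brackets, so no first fundamental
  theorem is needed to write \<open>det g ^ k\<close> times \<open>f (g\<^sup>-\<^sup>1 N g)\<close> in terms of brackets.
\<close>

lemma nilcone_regular_bracket_poly:
  assumes n: "n \<ge> 1" and f: "f \<in> nilcone_regular n"
  shows "\<exists>k0. \<forall>k\<ge>k0. \<exists>p. bracket_poly n k p \<and> (\<forall>N\<in>nilpotent_cone n. \<forall>g\<in>carrier_mat n n. \<forall>h\<in>carrier_mat n n.
    g * h = 1\<^sub>m n \<longrightarrow> h * g = 1\<^sub>m n \<longrightarrow> p N g = f (h * N * g) * det g ^ k)"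
  using f unfolding nilcone_regular_def
proof induction
  case (gen f)
  then obtain i j where ij: "i < n" "j < n" and f: "f = (\<lambda>A. A $$ (i, j))"
    by (auto simp: entry_functions_def)
  show ?case
  proof (intro exI[of _ 1] allI impI)
    fix k :: nat assume k: "1 \<le> k"
    obtain p where p: "bracket_poly n 1 p" "\<forall>N\<in>carrier_mat n n. \<forall>g\<in>carrier_mat n n. \<forall>h\<in>carrier_mat n n.
        g * h = 1\<^sub>m n \<longrightarrow> p N g = (h * N * g) $$ (i, j) * det g"
      using bracket_poly_entry[OF n ij] by blast
    obtain q where q: "bracket_poly n (k - 1) q"
      "\<forall>N\<in>carrier_mat n n. \<forall>g\<in>carrier_mat n n. q N g = det g ^ (k - 1)"
      using bracket_poly_det_power[OF n] by blast
    have "bracket_poly n k (\<lambda>N g. p N g * q N g)"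
      using bracket_poly_mult[OF n p(1) q(1)] k by simp
    moreover have "p N g * q N g = restrict f (nilpotent_cone n) (h * N * g) * det g ^ k"
      if N: "N \<in> nilpotent_cone n" and g: "g \<in> carrier_mat n n" and h: "h \<in> carrier_mat n n"
        and gh: "g * h = 1\<^sub>m n" "h * g = 1\<^sub>m n" for N g h
    proof -
      have "N \<in> carrier_mat n n" using N by (simp add: nilpotent_cone_def)
      then have "p N g * q N g = (h * N * g) $$ (i, j) * (det g * det g ^ (k - 1))"
        using p(2) q(2) g h gh by simp
      also have "det g * det g ^ (k - 1) = det g ^ k" using k by (simp flip: power_Suc)
      finally show ?thesis using conj_nilpotent_cone[OF N h g gh(2,1)] f by simp
    qed
    ultimately show "\<exists>p. bracket_poly n k p \<and> (\<forall>N\<in>nilpotent_cone n. \<forall>g\<in>carrier_mat n n. \<forall>h\<in>carrier_mat n n.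
      g * h = 1\<^sub>m n \<longrightarrow> h * g = 1\<^sub>m n \<longrightarrow> p N g = restrict f (nilpotent_cone n) (h * N * g) * det g ^ k)"
      by blast
  qed
next
  case (const x)
  show ?case
  proof (intro exI[of _ 0] allI impI)
    fix k :: nat
    obtain q where q: "bracket_poly n k q"
      "\<forall>N\<in>carrier_mat n n. \<forall>g\<in>carrier_mat n n. q N g = det g ^ k"
      using bracket_poly_det_power[OF n] by blast
    have "bracket_poly n k (\<lambda>N g. x * q N g + 0)"
      by (rule bracket_poly_add[OF q(1) bracket_poly.zero])
    moreover have "x * q N g + 0 = (\<lambda>N\<in>nilpotent_cone n. x) (h * N * g) * det g ^ k"
      if N: "N \<in> nilpotent_cone n" and g: "g \<in> carrier_mat n n" and h: "h \<in> carrier_mat n n"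
        and gh: "g * h = 1\<^sub>m n" "h * g = 1\<^sub>m n" for N g h
      using conj_nilpotent_cone[OF N h g gh(2,1)] q(2) N g by (simp add: nilpotent_cone_def)
    ultimately show "\<exists>p. bracket_poly n k p \<and> (\<forall>N\<in>nilpotent_cone n. \<forall>g\<in>carrier_mat n n. \<forall>h\<in>carrier_mat n n.
      g * h = 1\<^sub>m n \<longrightarrow> h * g = 1\<^sub>m n \<longrightarrow> p N g = (\<lambda>N\<in>nilpotent_cone n. x) (h * N * g) * det g ^ k)"
      by blast
  qed
next
  case (add f1 f2)
  then obtain k1 k2 where k1: "\<forall>k\<ge>k1. \<exists>p. bracket_poly n k p \<and> (\<forall>N\<in>nilpotent_cone n. \<forall>g\<in>carrier_mat n n. \<forall>h\<in>carrier_mat n n.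
      g * h = 1\<^sub>m n \<longrightarrow> h * g = 1\<^sub>m n \<longrightarrow> p N g = f1 (h * N * g) * det g ^ k)"
    and k2: "\<forall>k\<ge>k2. \<exists>p. bracket_poly n k p \<and> (\<forall>N\<in>nilpotent_cone n. \<forall>g\<in>carrier_mat n n. \<forall>h\<in>carrier_mat n n.
      g * h = 1\<^sub>m n \<longrightarrow> h * g = 1\<^sub>m n \<longrightarrow> p N g = f2 (h * N * g) * det g ^ k)" by blast
  show ?case
  \<comment> \<open>A sum needs the same \<open>k\<close> in both summands; this is why the claim is
    made for all large \<open>k\<close>.\<close>
  proof (intro exI[of _ "max k1 k2"] allI impI)
    fix k assume k: "max k1 k2 \<le> k"
    from k k1 obtain p where p: "bracket_poly n k p" "\<forall>N\<in>nilpotent_cone n. \<forall>g\<in>carrier_mat n n. \<forall>h\<in>carrier_mat n n.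
        g * h = 1\<^sub>m n \<longrightarrow> h * g = 1\<^sub>m n \<longrightarrow> p N g = f1 (h * N * g) * det g ^ k"
      by auto
    from k k2 obtain q where q: "bracket_poly n k q" "\<forall>N\<in>nilpotent_cone n. \<forall>g\<in>carrier_mat n n. \<forall>h\<in>carrier_mat n n.
        g * h = 1\<^sub>m n \<longrightarrow> h * g = 1\<^sub>m n \<longrightarrow> q N g = f2 (h * N * g) * det g ^ k"
      by auto
    have "bracket_poly n k (\<lambda>N g. 1 * p N g + q N g)"
      by (rule bracket_poly_add[OF p(1) q(1)])
    moreover have "1 * p N g + q N g = (\<lambda>N\<in>nilpotent_cone n. f1 N + f2 N) (h * N * g) * det g ^ k"
      if N: "N \<in> nilpotent_cone n" and g: "g \<in> carrier_mat n n" and h: "h \<in> carrier_mat n n"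
        and gh: "g * h = 1\<^sub>m n" "h * g = 1\<^sub>m n" for N g h
      using conj_nilpotent_cone[OF N h g gh(2,1)] p(2) q(2) N g h gh by (simp add: distrib_right)
    ultimately show "\<exists>p. bracket_poly n k p \<and> (\<forall>N\<in>nilpotent_cone n. \<forall>g\<in>carrier_mat n n. \<forall>h\<in>carrier_mat n n.
      g * h = 1\<^sub>m n \<longrightarrow> h * g = 1\<^sub>m n \<longrightarrow> p N g = (\<lambda>N\<in>nilpotent_cone n. f1 N + f2 N) (h * N * g) * det g ^ k)"
      by blast
  qed
next
  case (mult f1 f2)
  then obtain k1 k2 where k1: "\<forall>k\<ge>k1. \<exists>p. bracket_poly n k p \<and> (\<forall>N\<in>nilpotent_cone n. \<forall>g\<in>carrier_mat n n. \<forall>h\<in>carrier_mat n n.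
      g * h = 1\<^sub>m n \<longrightarrow> h * g = 1\<^sub>m n \<longrightarrow> p N g = f1 (h * N * g) * det g ^ k)"
    and k2: "\<forall>k\<ge>k2. \<exists>p. bracket_poly n k p \<and> (\<forall>N\<in>nilpotent_cone n. \<forall>g\<in>carrier_mat n n. \<forall>h\<in>carrier_mat n n.
      g * h = 1\<^sub>m n \<longrightarrow> h * g = 1\<^sub>m n \<longrightarrow> p N g = f2 (h * N * g) * det g ^ k)" by blast
  show ?case
  \<comment> \<open>The first factor takes exactly \<open>k1\<close> determinants and the second
    takes the remaining ones, at least \<open>k2\<close> in number.\<close>
  proof (intro exI[of _ "k1 + k2"] allI impI)
    fix k assume k: "k1 + k2 \<le> k"
    obtain p where p: "bracket_poly n k1 p" "\<forall>N\<in>nilpotent_cone n. \<forall>g\<in>carrier_mat n n. \<forall>h\<in>carrier_mat n n.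
        g * h = 1\<^sub>m n \<longrightarrow> h * g = 1\<^sub>m n \<longrightarrow> p N g = f1 (h * N * g) * det g ^ k1"
      using k1 by blast
    have "k2 \<le> k - k1" using k by simp
    then obtain q where q: "bracket_poly n (k - k1) q" "\<forall>N\<in>nilpotent_cone n. \<forall>g\<in>carrier_mat n n. \<forall>h\<in>carrier_mat n n.
        g * h = 1\<^sub>m n \<longrightarrow> h * g = 1\<^sub>m n \<longrightarrow> q N g = f2 (h * N * g) * det g ^ (k - k1)"
      using k2 by blast
    have "bracket_poly n k (\<lambda>N g. p N g * q N g)"
      using bracket_poly_mult[OF n p(1) q(1)] k by simp
    moreover have "p N g * q N g = (\<lambda>N\<in>nilpotent_cone n. f1 N * f2 N) (h * N * g) * det g ^ k"
      if N: "N \<in> nilpotent_cone n" and g: "g \<in> carrier_mat n n" and h: "h \<in> carrier_mat n n"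
        and gh: "g * h = 1\<^sub>m n" "h * g = 1\<^sub>m n" for N g h
    proof -
      have "p N g * q N g = f1 (h * N * g) * f2 (h * N * g) * (det g ^ k1 * det g ^ (k - k1))"
        using p(2) q(2) N g h gh by simp
      also have "det g ^ k1 * det g ^ (k - k1) = det g ^ k" using k by (simp flip: power_add)
      finally show ?thesis using conj_nilpotent_cone[OF N h g gh(2,1)] by simp
    qed
    ultimately show "\<exists>p. bracket_poly n k p \<and> (\<forall>N\<in>nilpotent_cone n. \<forall>g\<in>carrier_mat n n. \<forall>h\<in>carrier_mat n n.
      g * h = 1\<^sub>m n \<longrightarrow> h * g = 1\<^sub>m n \<longrightarrow> p N g = (\<lambda>N\<in>nilpotent_cone n. f1 N * f2 N) (h * N * g) * det g ^ k)"
      by blast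
  qed
qed

section \<open>Pairings as determinantal functions\<close>

lemma det_mat_col_expansion:
  fixes K :: "nat \<Rightarrow> nat \<Rightarrow> 'a :: comm_ring_1"
  shows "det (mat d d (\<lambda>(x, y). K x y)) = (\<Sum>p | p permutes {..<d}. signof p * (\<Prod>y<d. K (p y) y))"
proof -
  have "det (mat d d (\<lambda>(x, y). K x y)) =
      (\<Sum>p | p permutes {..<d}. signof p * (\<Prod>y<d. mat d d (\<lambda>(x, y). K x y) $$ (p y, y)))"
    by (subst det_col[of _ d]) (simp_all add: atLeast0LessThan)
  also have "\<dots> = (\<Sum>p | p permutes {..<d}. signof p * (\<Prod>y<d. K (p y) y))"
  proof (intro sum.cong refl arg_cong2[where f = "(*)"] prod.cong)
    fix p y assume "p \<in> {p. p permutes {..<d}}" "y \<in> {..<d}"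
    then show "mat d d (\<lambda>(x, y). K x y) $$ (p y, y) = K (p y) y"
      using permutes_in_image[of p "{..<d}" y] by simp
  qed
  finally show ?thesis .
qed

lemma det_sum_cols:
  fixes K :: "nat \<Rightarrow> nat \<Rightarrow> 'u \<Rightarrow> 'a :: comm_ring_1"
  assumes "\<And>y. y < d \<Longrightarrow> finite (S y)"
  shows "det (mat d d (\<lambda>(x, y). \<Sum>u\<in>S y. K x y u)) =
    (\<Sum>\<phi>\<in>PiE {..<d} S. det (mat d d (\<lambda>(x, y). K x y (\<phi> y))))"
proof -
  have "det (mat d d (\<lambda>(x, y). \<Sum>u\<in>S y. K x y u)) =
      (\<Sum>p | p permutes {..<d}. \<Sum>\<phi>\<in>PiE {..<d} S. signof p * (\<Prod>y<d. K (p y) y (\<phi> y)))"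
    unfolding det_mat_col_expansion using assms
    by (intro sum.cong refl) (subst prod_sum_PiE, simp_all add: sum_distrib_left)
  also have "\<dots> = (\<Sum>\<phi>\<in>PiE {..<d} S. det (mat d d (\<lambda>(x, y). K x y (\<phi> y))))"
    unfolding det_mat_col_expansion by (rule sum.swap)
  finally show ?thesis .
qed

lemma det_scale_cols:
  fixes K :: "nat \<Rightarrow> nat \<Rightarrow> 'a :: comm_ring_1"
  shows "det (mat d d (\<lambda>(x, y). K x y * s y)) = det (mat d d (\<lambda>(x, y). K x y)) * (\<Prod>y<d. s y)"
  unfolding det_mat_col_expansion by (simp add: prod.distrib sum_distrib_right mult.assoc)

lemma det_permute_cols:
  fixes K :: "nat \<Rightarrow> nat \<Rightarrow> 'a :: comm_ring_1"
  assumes "\<theta> permutes {..<d}"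
  shows "det (mat d d (\<lambda>(x, y). K x (\<theta> y))) = signof \<theta> * det (mat d d (\<lambda>(x, y). K x y))"
proof -
  let ?B = "mat d d (\<lambda>(y, x). K x y)"
  have "det (mat d d (\<lambda>(x, y). K x (\<theta> y))) = det (mat d d (\<lambda>(y, x). K x (\<theta> y)))"
    by (subst det_transpose[symmetric, of _ d], simp) (auto intro!: arg_cong[where f = det] eq_matI)
  also have "mat d d (\<lambda>(y, x). K x (\<theta> y)) = mat d d (\<lambda>(i, j). ?B $$ (\<theta> i, j))"
    using permutes_in_image[OF assms] by (intro eq_matI) auto
  also have "det \<dots> = signof \<theta> * det ?B"
    by (rule det_permute_rows) (use assms in \<open>simp_all add: atLeast0LessThan\<close>)
  also have "det ?B = det (mat d d (\<lambda>(x, y). K x y))"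
    by (subst det_transpose[symmetric, of _ d], simp) (auto intro!: arg_cong[where f = det] eq_matI)
  finally show ?thesis .
qed

text \<open>Column \<open>c\<close> of the bracket matrix with the vector \<open>g e_j\<close>
  replaced by the basis vector \<open>e_q\<close>.\<close>

definition bracket_column :: "nat \<Rightarrow> (nat \<Rightarrow> nat) \<Rightarrow> (nat \<Rightarrow> nat) \<Rightarrow> complex mat \<Rightarrow> nat \<Rightarrow> nat \<Rightarrow> nat \<Rightarrow> complex" where
  "bracket_column n l m N c x q = (if x div n = l c then (N ^\<^sub>m m c) $$ (x mod n, q) else 0)"

definition bracket_coeff :: "nat \<Rightarrow> nat \<Rightarrow> (nat \<Rightarrow> nat) \<Rightarrow> (nat \<Rightarrow> nat) \<Rightarrow> (nat \<Rightarrow> nat) \<Rightarrow> complex mat \<Rightarrow>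
    (nat \<Rightarrow> nat \<times> nat) \<Rightarrow> complex" where
  "bracket_coeff n k l m j N w = (if \<forall>c<n * k. snd (w c) = j c
     then det (mat (n * k) (n * k) (\<lambda>(x, c). bracket_column n l m N c x (fst (w c)))) else 0)"

text \<open>Column \<open>c\<close> is the combination of the \<open>bracket_column\<close> vectors
  with coefficients \<open>g $$ (q, j c)\<close>. Multilinear expansion gives one word for each
  choice of row indices \<open>q\<close>, the column indices being prescribed by
  \<open>j\<close>.\<close>

lemma word_sum_bracket_coeff:
  assumes n: "n \<ge> 1" and N: "N \<in> carrier_mat n n" and g: "g \<in> carrier_mat n n"
    and j: "\<And>c. c < n * k \<Longrightarrow> j c < n"
  shows "word_sum n (n * k) (bracket_coeff n k l m j N) g = bracket n k l m j N g"
proof -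
  let ?d = "n * k" and ?C = "bracket_column n l m N"
  have "bracket n k l m j N g = det (mat ?d ?d (\<lambda>(x, c). \<Sum>i<n. ?C c x i * g $$ (i, j c)))"
    unfolding bracket_def
  proof (intro arg_cong[where f = det] eq_matI)
    fix x c assume "x < dim_row (mat ?d ?d (\<lambda>(x, c). \<Sum>i<n. ?C c x i * g $$ (i, j c)))"
      "c < dim_col (mat ?d ?d (\<lambda>(x, c). \<Sum>i<n. ?C c x i * g $$ (i, j c)))"
    then have xc: "x < ?d" "c < ?d" by simp_all
    have pow: "N ^\<^sub>m m c \<in> carrier_mat n n" using N by (rule pow_carrier_mat)
    have "(N ^\<^sub>m m c * g) $$ (x mod n, j c) = (\<Sum>i<n. (N ^\<^sub>m m c) $$ (x mod n, i) * g $$ (i, j c))"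
      using N pow g j[OF xc(2)] mod_less_divisor[of n x] n
      by (simp add: scalar_prod_def atLeast0LessThan)
    then show "mat ?d ?d (\<lambda>(x, c). if x div n = l c then (N ^\<^sub>m m c * g) $$ (x mod n, j c) else 0) $$ (x, c) =
        mat ?d ?d (\<lambda>(x, c). \<Sum>i<n. ?C c x i * g $$ (i, j c)) $$ (x, c)"
      using xc by (simp add: bracket_column_def)
  qed simp_all
  also have "\<dots> = (\<Sum>\<phi>\<in>{..<?d} \<rightarrow>\<^sub>E {..<n}.
      det (mat ?d ?d (\<lambda>(x, c). ?C c x (\<phi> c))) * (\<Prod>c<?d. g $$ (\<phi> c, j c)))"
    by (subst det_sum_cols) (simp_all add: det_scale_cols)
  also have "\<dots> = (\<Sum>w\<in>{w \<in> words n ?d. \<forall>c<?d. snd (w c) = j c}.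
      det (mat ?d ?d (\<lambda>(x, c). ?C c x (fst (w c)))) * (\<Prod>c<?d. g $$ w c))"
  proof (rule sum.reindex_bij_witness[of _ "\<lambda>w. \<lambda>c\<in>{..<?d}. fst (w c)" "\<lambda>\<phi>. \<lambda>c\<in>{..<?d}. (\<phi> c, j c)"])
    fix \<phi> assume \<phi>: "\<phi> \<in> {..<?d} \<rightarrow>\<^sub>E {..<n}"
    then show "(\<lambda>c\<in>{..<?d}. fst ((\<lambda>c\<in>{..<?d}. (\<phi> c, j c)) c)) = \<phi>"
      by (auto simp: fun_eq_iff PiE_def extensional_def)
    show "(\<lambda>c\<in>{..<?d}. (\<phi> c, j c)) \<in> {w \<in> words n ?d. \<forall>c<?d. snd (w c) = j c}"
      using \<phi> j by (auto simp: words_def)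
    have "mat ?d ?d (\<lambda>(x, c). ?C c x (fst ((\<lambda>c\<in>{..<?d}. (\<phi> c, j c)) c))) = mat ?d ?d (\<lambda>(x, c). ?C c x (\<phi> c))"
      by (intro eq_matI) auto
    then show "det (mat ?d ?d (\<lambda>(x, c). ?C c x (fst ((\<lambda>c\<in>{..<?d}. (\<phi> c, j c)) c)))) *
        (\<Prod>c<?d. g $$ (\<lambda>c\<in>{..<?d}. (\<phi> c, j c)) c) =
        det (mat ?d ?d (\<lambda>(x, c). ?C c x (\<phi> c))) * (\<Prod>c<?d. g $$ (\<phi> c, j c))"
      by simp
  next
    fix w assume w: "w \<in> {w \<in> words n ?d. \<forall>c<?d. snd (w c) = j c}"
    then have ext: "w c = undefined" if "\<not> c < ?d" for c
      using that by (auto simp: words_def PiE_def extensional_def)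
    have pair: "w c = (fst (w c), j c)" if "c < ?d" for c
      using w that by (metis (mono_tags, lifting) mem_Collect_eq prod.collapse)
    show "(\<lambda>c\<in>{..<?d}. ((\<lambda>c\<in>{..<?d}. fst (w c)) c, j c)) = w"
      using ext pair by (auto simp: fun_eq_iff)
    show "(\<lambda>c\<in>{..<?d}. fst (w c)) \<in> {..<?d} \<rightarrow>\<^sub>E {..<n}"
      using w words_less(1)[of w n ?d] by auto
  qed
  also have "\<dots> = word_sum n ?d (bracket_coeff n k l m j N) g"
    unfolding word_sum_def sum.inter_filter[OF finite_words]
    by (intro sum.cong refl) (auto simp: bracket_coeff_def)
  finally show ?thesis ..
qed

text \<open>With an entry of \<open>N ^\<^sub>m k\<close> for \<open>F k\<close>, this evaluates a
  sum of monomials at \<open>N\<close>. It is how a sum of bracket columns becomes a polynomial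
  block of a datum.\<close>

lemma poly_linear_functional:
  fixes F :: "nat \<Rightarrow> complex" and e :: "'a \<Rightarrow> nat"
  assumes "finite A"
  defines "P \<equiv> (\<Sum>a\<in>A. monom 1 (e a))"
  shows "(\<Sum>k\<le>degree P. coeff P k * F k) = (\<Sum>a\<in>A. F (e a))"
proof -
  let ?D = "degree P + (\<Sum>a\<in>A. e a)"
  have "(\<Sum>k\<le>degree P. coeff P k * F k) = (\<Sum>k\<le>?D. coeff P k * F k)"
    by (intro sum.mono_neutral_left) (auto simp: coeff_eq_0)
  also have "\<dots> = (\<Sum>k\<le>?D. \<Sum>a\<in>A. if k = e a then F k else 0)"
    by (intro sum.cong refl) (auto simp: P_def coeff_sum sum_distrib_right intro!: sum.cong)
  also have "\<dots> = (\<Sum>a\<in>A. \<Sum>k\<le>?D. if k = e a then F k else 0)" by (rule sum.swap)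
  also have "\<dots> = (\<Sum>a\<in>A. F (e a))"
  proof (intro sum.cong refl)
    fix a assume "a \<in> A"
    then have "e a \<le> (\<Sum>a\<in>A. e a)" using assms by (intro member_le_sum) auto
    then show "(\<Sum>k\<le>?D. if k = e a then F k else 0) = F (e a)" by simp
  qed
  finally show ?thesis .
qed

lemma block_positions_replicate:
  assumes "x < n * k"
  shows "block_positions (replicate k n) ! x = (x div n, x mod n)"
  using assms
proof (induction k)
  case 0
  then show ?case by simp
next
  case (Suc k)
  have n: "n > 0" using Suc.prems by (cases n) auto
  have eq: "block_positions (replicate (Suc k) n) =
      block_positions (replicate k n) @ map (\<lambda>p. (k, p)) [0..<n]"
    using block_positions_snoc[of "replicate k n" n] by (simp add: replicate_append_same)
  have len: "length (block_positions (replicate k n)) = n * k"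
    by (simp add: length_block_positions sum_list_replicate mult.commute)
  show ?case
  proof (cases "x < n * k")
    case True
    then show ?thesis using Suc.IH unfolding eq by (simp add: nth_append len)
  next
    case False
    define y where "y = x - n * k"
    have y: "x = n * k + y" "y < n" using False Suc.prems by (simp_all add: y_def)
    then show ?thesis using n unfolding eq by (simp add: nth_append len)
  qed
qed

abbreviation (input) datum_functions :: "nat \<Rightarrow> (complex mat \<Rightarrow> complex) set" where
  "datum_functions n \<equiv> {datum_function n as bs P | as bs P. is_datum n as bs}"

text \<open>After summation the entries in block \<open>(i, j)\<close> are those of one polynomial
  in \<open>N\<close>: it has a monomial of degree \<open>m (\<theta> u)\<close> for every
  \<open>u\<close> that \<open>b\<close> assigns to column block \<open>j\<close> and whose bracket
  column belongs to factor \<open>i\<close>. A factor occupies all \<open>n\<close> rows, hence the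
  row block sizes \<open>n\<close>.\<close>

lemma datum_det_in_gen_alg:
  assumes n: "n \<ge> 1" and k: "k \<ge> 1" and bs: "set bs \<subseteq> {1..n}" "sum_list bs = n * k"
    and S: "finite S"
  shows "(\<lambda>N\<in>nilpotent_cone n. det (mat (n * k) (n * k)
      (\<lambda>(x, y). \<Sum>u\<in>{u \<in> S. b u = block_of bs y}. bracket_column n l m N (\<theta> u) x (pos_of bs y))))
    \<in> gen_alg (nilpotent_cone n) (datum_functions n)"
proof -
  let ?as = "replicate k n" and ?d = "n * k"
  define P :: "nat \<Rightarrow> nat \<Rightarrow> complex poly" where
    "P i j = (\<Sum>u\<in>{u \<in> S. b u = j \<and> l (\<theta> u) = i}. monom 1 (m (\<theta> u)))" for i j
  have "bs \<noteq> []" using bs n k by auto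
  then have "is_datum n ?as bs"
    using n k bs by (auto simp: is_datum_def sum_list_replicate)
  then have "restrict (datum_function n ?as bs P) (nilpotent_cone n)
      \<in> gen_alg (nilpotent_cone n) (datum_functions n)"
    by (intro gen_alg.gen) blast
  moreover have "datum_function n ?as bs P N = det (mat ?d ?d
      (\<lambda>(x, y). \<Sum>u\<in>{u \<in> S. b u = block_of bs y}. bracket_column n l m N (\<theta> u) x (pos_of bs y)))"
    if N: "N \<in> nilpotent_cone n" for N
  proof -
    have Nc: "N \<in> carrier_mat n n" using N by (simp add: nilpotent_cone_def)
    have sum_as: "sum_list ?as = ?d" by (simp add: sum_list_replicate mult.commute)
    have "datum_matrix ?as bs P N = mat ?d ?d
      (\<lambda>(x, y). \<Sum>u\<in>{u \<in> S. b u = block_of bs y}. bracket_column n l m N (\<theta> u) x (pos_of bs y))"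
    proof (rule eq_matI)
      fix x y assume "x < dim_row (mat ?d ?d
          (\<lambda>(x, y). \<Sum>u\<in>{u \<in> S. b u = block_of bs y}. bracket_column n l m N (\<theta> u) x (pos_of bs y)))"
        "y < dim_col (mat ?d ?d
          (\<lambda>(x, y). \<Sum>u\<in>{u \<in> S. b u = block_of bs y}. bracket_column n l m N (\<theta> u) x (pos_of bs y)))"
      then have xy: "x < ?d" "y < ?d" by simp_all
      have i: "x div n < k" "x mod n < n"
        using xy n by (simp_all add: less_mult_imp_div_less mult.commute)
      have y: "y < sum_list bs" using xy bs by simp
      have q: "pos_of bs y < bs ! block_of bs y" "pos_of bs y < n"
        using pos_of_less[OF y] pos_of_less_bound[OF y bs(1)] by simp_all
      have "datum_matrix ?as bs P N $$ (x, y) =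
          (\<Sum>e\<le>degree (P (x div n) (block_of bs y)). coeff (P (x div n) (block_of bs y)) e *
            (N ^\<^sub>m e) $$ (x mod n, pos_of bs y))"
        using xy y i q Nc
        by (simp add: datum_matrix_def block_matrix_eq_blockwise_mat sum_as bs(2) block_positions_replicate
            corner_submatrix_def poly_at_mat_def)
      also have "\<dots> = (\<Sum>u\<in>{u \<in> S. b u = block_of bs y \<and> l (\<theta> u) = x div n}.
          (N ^\<^sub>m m (\<theta> u)) $$ (x mod n, pos_of bs y))"
        unfolding P_def using S by (intro poly_linear_functional) simp
      also have "\<dots> = (\<Sum>u\<in>{u \<in> S. b u = block_of bs y}. bracket_column n l m N (\<theta> u) x (pos_of bs y))"
        using S by (intro sum.mono_neutral_cong_left) (auto simp: bracket_column_def)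
      finally show "datum_matrix ?as bs P N $$ (x, y) = mat ?d ?d
          (\<lambda>(x, y). \<Sum>u\<in>{u \<in> S. b u = block_of bs y}. bracket_column n l m N (\<theta> u) x (pos_of bs y)) $$ (x, y)"
        using xy by simp
    qed (simp_all add: datum_matrix_def block_matrix_eq_blockwise_mat sum_as bs(2))
    then show ?thesis using N by (simp add: datum_function_def)
  qed
  ultimately show ?thesis by (rule gen_alg_cong)
qed

lemma block_perms_inv: "\<sigma> \<in> block_perms bs \<Longrightarrow> Hilbert_Choice.inv \<sigma> \<in> block_perms bs"
proof -
  assume \<sigma>: "\<sigma> \<in> block_perms bs"
  then have p: "\<sigma> permutes {..<sum_list bs}" by (rule block_perms_permutes)
  have "block_of bs (Hilbert_Choice.inv \<sigma> x) = block_of bs x" if "x < sum_list bs" for x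
    using block_perms_block_of[OF \<sigma>, of "Hilbert_Choice.inv \<sigma> x"] permutes_in_image[OF permutes_inv[OF p], of x]
      permutes_inverses(1)[OF p, of x] that by simp
  then show ?thesis using permutes_inv[OF p] by (simp add: block_perms_def)
qed

text \<open>
  Summing over the permutations within the blocks is undone by polarization, which turns the
  alternating sum into a signed sum of determinants of the required block shape.
\<close>

lemma block_perms_sum_in_gen_alg:
  assumes n: "n \<ge> 1" and k: "k \<ge> 1" and bs: "set bs \<subseteq> {1..n}" "sum_list bs = n * k"
    and \<pi>: "\<pi> permutes {..<n * k}"
  shows "(\<lambda>N\<in>nilpotent_cone n. \<Sum>\<sigma>\<in>block_perms bs. signof \<sigma> *
      det (mat (n * k) (n * k) (\<lambda>(x, c). bracket_column n l m N c x (pos_of bs (\<sigma> (\<pi> c))))))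
    \<in> gen_alg (nilpotent_cone n) (datum_functions n)"
proof -
  let ?d = "n * k" and ?X = "{..<n * k}"
  let ?inv = "Hilbert_Choice.inv"
  let ?C = "bracket_column n l m"
  define D where "D N \<phi> = det (mat ?d ?d (\<lambda>(x, y). ?C N (?inv \<pi> (\<phi> y)) x (pos_of bs y)))"
    for N and \<phi> :: "nat \<Rightarrow> nat"
  \<comment> \<open>Extension by zero from the maps preserving blocks to all maps, the form to which
    inclusion-exclusion applies.\<close>
  define G where "G N \<phi> = (if \<forall>y<?d. block_of bs (\<phi> y) = block_of bs y then D N \<phi> else 0)"
    for N and \<phi> :: "nat \<Rightarrow> nat"
  \<comment> \<open>Reordering the columns by \<open>\<sigma> \<circ> \<pi>\<close> moves the
    permutations from the position index \<open>q\<close> to the choice of column. The sign of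
    \<open>\<sigma>\<close> then occurs twice and cancels.\<close>
  have step1: "signof \<sigma> * det (mat ?d ?d (\<lambda>(x, c). ?C N c x (pos_of bs (\<sigma> (\<pi> c))))) = signof \<pi> * D N (?inv \<sigma>)"
    if \<sigma>: "\<sigma> \<in> block_perms bs" for N \<sigma>
  proof -
    have s: "\<sigma> permutes ?X" using block_perms_permutes[OF \<sigma>] bs(2) by simp
    have "det (mat ?d ?d (\<lambda>(x, c). ?C N c x (pos_of bs (\<sigma> (\<pi> c))))) =
        det (mat ?d ?d (\<lambda>(x, c). (\<lambda>x y. ?C N (?inv \<pi> (?inv \<sigma> y)) x (pos_of bs y)) x ((\<sigma> \<circ> \<pi>) c)))"
      by (simp add: permutes_inverses[OF s] permutes_inverses[OF \<pi>])
    also have "\<dots> = signof (\<sigma> \<circ> \<pi>) * D N (?inv \<sigma>)"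
      unfolding D_def by (rule det_permute_cols) (rule permutes_compose[OF \<pi> s])
    also have "signof (\<sigma> \<circ> \<pi>) = (signof \<sigma> * signof \<pi> :: complex)"
      using s \<pi> by (intro signof_compose[of _ ?d]) (simp_all add: atLeast0LessThan)
    finally have "signof \<sigma> * det (mat ?d ?d (\<lambda>(x, c). ?C N c x (pos_of bs (\<sigma> (\<pi> c))))) =
        (signof \<sigma> * signof \<sigma>) * signof \<pi> * D N (?inv \<sigma>)" by (simp add: mult_ac)
    also have "signof \<sigma> * signof \<sigma> = (1 :: complex)" by (simp add: sign_def)
    finally show ?thesis by simp
  qed
  have "(\<Sum>\<sigma>\<in>block_perms bs. signof \<sigma> * det (mat ?d ?d (\<lambda>(x, c). ?C N c x (pos_of bs (\<sigma> (\<pi> c)))))) =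
      (\<Sum>S\<in>Pow ?X. signof \<pi> * (- 1) ^ card (?X - S) *
        det (mat ?d ?d (\<lambda>(x, y). \<Sum>u\<in>{u \<in> S. block_of bs u = block_of bs y}. ?C N (?inv \<pi> u) x (pos_of bs y))))" for N
  proof -
    have "(\<Sum>\<sigma>\<in>block_perms bs. signof \<sigma> * det (mat ?d ?d (\<lambda>(x, c). ?C N c x (pos_of bs (\<sigma> (\<pi> c)))))) =
        (\<Sum>\<sigma>\<in>block_perms bs. signof \<pi> * D N (?inv \<sigma>))"
      by (intro sum.cong refl step1)
    also have "\<dots> = (\<Sum>\<sigma>\<in>block_perms bs. signof \<pi> * D N \<sigma>)"
      by (rule sum.reindex_bij_witness[of _ ?inv ?inv])
        (auto simp: block_perms_inv permutes_inv_inv[OF block_perms_permutes])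
    also have "\<dots> = signof \<pi> * (\<Sum>\<sigma>\<in>block_perms bs. D N \<sigma>)" by (simp add: sum_distrib_left)
    also have "(\<Sum>\<sigma>\<in>block_perms bs. D N \<sigma>) = (\<Sum>\<sigma> | \<sigma> permutes ?X. G N (restrict \<sigma> ?X))"
    proof (rule sum.mono_neutral_cong_left)
      show "\<forall>\<sigma>\<in>{\<sigma>. \<sigma> permutes ?X} - block_perms bs. G N (restrict \<sigma> ?X) = 0"
        using bs(2) by (auto simp: G_def block_perms_def)
      fix \<sigma> assume "\<sigma> \<in> block_perms bs"
      then have "\<forall>y<?d. block_of bs (restrict \<sigma> ?X y) = block_of bs y"
        using bs(2) by (simp add: block_perms_def)
      moreover have "mat ?d ?d (\<lambda>(x, y). ?C N (?inv \<pi> (\<sigma> y)) x (pos_of bs y)) =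
          mat ?d ?d (\<lambda>(x, y). ?C N (?inv \<pi> (restrict \<sigma> ?X y)) x (pos_of bs y))"
        by (intro eq_matI) auto
      ultimately show "D N \<sigma> = G N (restrict \<sigma> ?X)" by (simp add: G_def D_def)
    qed (use bs(2) in \<open>auto simp: finite_permutations block_perms_def\<close>)
    also have "\<dots> = (\<Sum>S\<in>Pow ?X. (- 1) ^ card (?X - S) * (\<Sum>\<phi>\<in>?X \<rightarrow>\<^sub>E S. G N \<phi>))"
      by (rule polarization[symmetric]) simp
    also have "\<dots> = (\<Sum>S\<in>Pow ?X. (- 1) ^ card (?X - S) *
        det (mat ?d ?d (\<lambda>(x, y). \<Sum>u\<in>{u \<in> S. block_of bs u = block_of bs y}. ?C N (?inv \<pi> u) x (pos_of bs y))))"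
    proof (intro sum.cong refl arg_cong2[where f = "(*)"])
      fix S assume "S \<in> Pow ?X"
      then have S: "finite S" using finite_subset by auto
      \<comment> \<open>By multilinearity a determinant with summed columns is the sum over all
        choices of \<open>u\<close>, which are the maps into \<open>S\<close> that preserve
        blocks.\<close>
      have "det (mat ?d ?d (\<lambda>(x, y). \<Sum>u\<in>{u \<in> S. block_of bs u = block_of bs y}. ?C N (?inv \<pi> u) x (pos_of bs y))) =
          (\<Sum>\<phi>\<in>PiE ?X (\<lambda>y. {u \<in> S. block_of bs u = block_of bs y}). D N \<phi>)"
        unfolding D_def using S by (subst det_sum_cols) simp_all
      also have "\<dots> = (\<Sum>\<phi>\<in>?X \<rightarrow>\<^sub>E S. G N \<phi>)"
      proof (rule sum.mono_neutral_cong_left)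
        show "finite (?X \<rightarrow>\<^sub>E S)" using S by (simp add: finite_PiE)
        show "PiE ?X (\<lambda>y. {u \<in> S. block_of bs u = block_of bs y}) \<subseteq> ?X \<rightarrow>\<^sub>E S"
          by (rule PiE_mono) auto
        show "\<forall>\<phi>\<in>(?X \<rightarrow>\<^sub>E S) - PiE ?X (\<lambda>y. {u \<in> S. block_of bs u = block_of bs y}). G N \<phi> = 0"
          by (auto simp: G_def PiE_def Pi_def)
        fix \<phi> assume "\<phi> \<in> PiE ?X (\<lambda>y. {u \<in> S. block_of bs u = block_of bs y})"
        then show "D N \<phi> = G N \<phi>" by (auto simp: G_def PiE_def Pi_def)
      qed
      finally show "(\<Sum>\<phi>\<in>?X \<rightarrow>\<^sub>E S. G N \<phi>) = det (mat ?d ?d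
          (\<lambda>(x, y). \<Sum>u\<in>{u \<in> S. block_of bs u = block_of bs y}. ?C N (?inv \<pi> u) x (pos_of bs y)))" ..
    qed
    finally show ?thesis by (simp add: sum_distrib_left mult.assoc)
  qed
  note eq = this
  have "(\<lambda>N\<in>nilpotent_cone n. \<Sum>S\<in>Pow ?X. signof \<pi> * (- 1) ^ card (?X - S) *
        det (mat ?d ?d (\<lambda>(x, y). \<Sum>u\<in>{u \<in> S. block_of bs u = block_of bs y}. ?C N (?inv \<pi> u) x (pos_of bs y))))
      \<in> gen_alg (nilpotent_cone n) (datum_functions n)"
  proof (intro gen_alg_sum gen_alg_cmult datum_det_in_gen_alg[OF n k bs])
    fix S assume "S \<in> Pow ?X"
    then show "finite S" using finite_subset by auto
  qed
  then show ?thesis unfolding eq .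
qed

text \<open>The condition that column indices agree with \<open>j\<close> involves
  \<open>\<pi>\<close> only. It factors out of the sum over the Young subgroup and leaves, for every
  \<open>\<pi>\<close>, the alternating sum already treated.\<close>

lemma minor_pairing_bracket_coeff_in_gen_alg:
  assumes n: "n \<ge> 1" and k: "k \<ge> 1" and bs: "set bs \<subseteq> {1..n}" "sum_list bs = n * k"
  shows "(\<lambda>N\<in>nilpotent_cone n. minor_pairing bs (bracket_coeff n k l m j N))
    \<in> gen_alg (nilpotent_cone n) (datum_functions n)"
proof -
  let ?d = "n * k" and ?P = "{\<pi>. \<pi> permutes {..<n * k}}"
  have "minor_pairing bs (bracket_coeff n k l m j N) =
      (\<Sum>\<pi>\<in>?P. (if \<forall>c<?d. pos_of bs (\<pi> c) = j c then 1 else 0) * (\<Sum>\<sigma>\<in>block_perms bs. signof \<sigma> *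
        det (mat ?d ?d (\<lambda>(x, c). bracket_column n l m N c x (pos_of bs (\<sigma> (\<pi> c)))))))" for N
  proof -
    have coeff: "bracket_coeff n k l m j N (\<lambda>c. minor_word bs \<sigma> (\<pi> c)) =
        (if \<forall>c<?d. pos_of bs (\<pi> c) = j c then 1 else 0) *
        det (mat ?d ?d (\<lambda>(x, c). bracket_column n l m N c x (pos_of bs (\<sigma> (\<pi> c)))))"
      if "\<pi> \<in> ?P" for \<pi> \<sigma>
    proof -
      have w: "minor_word bs \<sigma> (\<pi> c) = (pos_of bs (\<sigma> (\<pi> c)), pos_of bs (\<pi> c))" if "c < ?d" for c
        using permutes_in_image[of \<pi> "{..<?d}" c] \<open>\<pi> \<in> ?P\<close> that bs(2) by (simp add: minor_word_def)
      have "mat ?d ?d (\<lambda>(x, c). bracket_column n l m N c x (fst (minor_word bs \<sigma> (\<pi> c)))) =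
          mat ?d ?d (\<lambda>(x, c). bracket_column n l m N c x (pos_of bs (\<sigma> (\<pi> c))))"
        using w by (intro eq_matI) auto
      then show ?thesis using w by (auto simp: bracket_coeff_def)
    qed
    have "minor_pairing bs (bracket_coeff n k l m j N) = (\<Sum>\<sigma>\<in>block_perms bs. \<Sum>\<pi>\<in>?P.
        signof \<sigma> * bracket_coeff n k l m j N (\<lambda>c. minor_word bs \<sigma> (\<pi> c)))"
      by (simp add: minor_pairing_def bs(2) sum_distrib_left)
    also have "\<dots> = (\<Sum>\<pi>\<in>?P. \<Sum>\<sigma>\<in>block_perms bs.
        signof \<sigma> * bracket_coeff n k l m j N (\<lambda>c. minor_word bs \<sigma> (\<pi> c)))"
      by (rule sum.swap)
    also have "\<dots> = (\<Sum>\<pi>\<in>?P. (if \<forall>c<?d. pos_of bs (\<pi> c) = j c then 1 else 0) *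
        (\<Sum>\<sigma>\<in>block_perms bs. signof \<sigma> *
          det (mat ?d ?d (\<lambda>(x, c). bracket_column n l m N c x (pos_of bs (\<sigma> (\<pi> c)))))))"
      by (intro sum.cong refl) (simp only: coeff sum_distrib_left mult.left_commute)
    finally show ?thesis .
  qed
  note eq = this
  show ?thesis
    unfolding eq by (intro gen_alg_sum gen_alg_cmult block_perms_sum_in_gen_alg[OF n k bs]) simp
qed

text \<open>Both properties are linear, so they pass from single brackets to their span. The family
  \<open>a\<close> is chosen once for all \<open>N\<close>, which makes its pairings functions on
  the nilpotent cone.\<close>

lemma bracket_poly_coefficients:
  assumes n: "n \<ge> 1" and k: "k \<ge> 1" and p: "bracket_poly n k p"
  shows "\<exists>a. (\<forall>N\<in>carrier_mat n n. \<forall>g\<in>carrier_mat n n. word_sum n (n * k) (a N) g = p N g) \<and>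
    (\<forall>bs. set bs \<subseteq> {1..n} \<longrightarrow> sum_list bs = n * k \<longrightarrow>
      (\<lambda>N\<in>nilpotent_cone n. minor_pairing bs (a N)) \<in> gen_alg (nilpotent_cone n) (datum_functions n))"
  using p
proof induction
  case zero
  show ?case
  proof (rule exI[of _ "\<lambda>N w. 0"], intro conjI ballI allI impI)
    fix bs
    have "minor_pairing bs (\<lambda>w. 0) = 0" by (simp add: minor_pairing_def)
    then show "(\<lambda>N\<in>nilpotent_cone n. minor_pairing bs (\<lambda>w. 0)) \<in> gen_alg (nilpotent_cone n) (datum_functions n)"
      by (simp only: gen_alg.const)
  qed (simp add: word_sum_def)
next
  case (step p l j x m)
  then obtain a where a: "\<forall>N\<in>carrier_mat n n. \<forall>g\<in>carrier_mat n n. word_sum n (n * k) (a N) g = p N g"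
    "\<forall>bs. set bs \<subseteq> {1..n} \<longrightarrow> sum_list bs = n * k \<longrightarrow>
      (\<lambda>N\<in>nilpotent_cone n. minor_pairing bs (a N)) \<in> gen_alg (nilpotent_cone n) (datum_functions n)"
    by blast
  show ?case
  proof (rule exI[of _ "\<lambda>N w. x * bracket_coeff n k l m j N w + a N w"], intro conjI ballI allI impI)
    fix N g :: "complex mat" assume "N \<in> carrier_mat n n" "g \<in> carrier_mat n n"
    then show "word_sum n (n * k) (\<lambda>w. x * bracket_coeff n k l m j N w + a N w) g =
        x * bracket n k l m j N g + p N g"
      unfolding word_sum_add using a(1) word_sum_bracket_coeff[OF n] step.hyps(2) by simp
  next
    fix bs assume bs: "set bs \<subseteq> {1..n}" "sum_list bs = n * k"
    show "(\<lambda>N\<in>nilpotent_cone n. minor_pairing bs (\<lambda>w. x * bracket_coeff n k l m j N w + a N w))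
        \<in> gen_alg (nilpotent_cone n) (datum_functions n)"
      unfolding minor_pairing_add
      using a(2) bs by (intro gen_alg_plus gen_alg_cmult minor_pairing_bracket_coeff_in_gen_alg[OF n k]) auto
  qed
qed

section \<open>Semi-invariants of the Borel subgroup\<close>

lemma borel_subgroupI:
  assumes "g \<in> carrier_mat n n" "h \<in> carrier_mat n n" "g * h = 1\<^sub>m n" "upper_triangular g"
  shows "g \<in> borel_subgroup n"
  using assms mat_mult_left_right_inverse[OF assms(1-3)]
  by (auto simp: borel_subgroup_def invertible_mat_def inverts_mat_def intro!: exI[of _ h])

lemma conj_act_eq:
  assumes g: "g \<in> carrier_mat n n" and h: "h \<in> carrier_mat n n" and gh: "g * h = 1\<^sub>m n"
  shows "conj_act g N = g * N * h"
proof -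
  have hg: "h * g = 1\<^sub>m n" by (rule mat_mult_left_right_inverse[OF g h gh])
  have "g \<in> Units (ring_mat TYPE(complex) n ())"
    using g h gh hg by (auto simp: Units_def ring_mat_simps)
  then obtain h' where h': "mat_inverse g = Some h'"
    using mat_inverse(1)[OF g, of "()"] by (cases "mat_inverse g") auto
  then have "g * h' = 1\<^sub>m n" "h' \<in> carrier_mat n n"
    using mat_inverse(2)[OF g] by auto
  then have "h' = h"
    using assoc_mult_mat[OF h g, of h' n] hg h gh by simp
  then show ?thesis by (simp add: conj_act_def h')
qed

text \<open>
  A character takes the same value on the conjugate elements \<open>x\<close> and \<open>x\<^sup>2\<close>, where \<open>x\<close> is an
  elementary unipotent.
\<close>

lemma borel_character_addrow:
  assumes \<chi>: "\<chi> \<in> borel_characters n" and kl: "l < k" "k < n"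
  shows "addrow_mat n x l k \<in> borel_subgroup n" "\<chi> (addrow_mat n x l k) = 1"
proof -
  \<comment> \<open>\<open>?t\<close> is diagonal with entry \<open>2\<close> at \<open>l\<close>
    and \<open>1\<close> elsewhere; conjugating by it doubles the off-diagonal entry
    \<open>x\<close>, as squaring \<open>?u x\<close> does.\<close>
  let ?u = "\<lambda>x. addrow_mat n x l k :: complex mat" and ?t = "multrow_mat n l 2 :: complex mat"
  have u: "?u y \<in> borel_subgroup n" for y
    using kl addrow_mat_inv[of l n k y]
    by (intro borel_subgroupI[where h = "?u (- y)"]) (auto simp: upper_triangular_def)
  then show "?u x \<in> borel_subgroup n" .
  have t: "?t \<in> borel_subgroup n"
    using kl multrow_mat_inv[of l n "2 :: complex"]
    by (intro borel_subgroupI[where h = "multrow_mat n l (inverse 2)"]) (auto simp: upper_triangular_def)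
  have \<chi>_mult: "\<chi> (g * h) = \<chi> g * \<chi> h" if "g \<in> borel_subgroup n" "h \<in> borel_subgroup n" for g h
    using \<chi> that by (auto simp: borel_characters_def)
  have nonzero: "\<chi> g \<noteq> 0" if "g \<in> borel_subgroup n" for g
    using \<chi> that by (auto simp: borel_characters_def)
  have "?t * ?u x = multrow l 2 (?u x)"
    by (rule multrow_mat[symmetric, of _ n n]) simp
  also have "\<dots> = addrow (2 * x) l k ?t"
    using kl by (intro eq_matI) auto
  also have "\<dots> = ?u (2 * x) * ?t"
    using kl by (intro addrow_mat[of _ n n]) auto
  finally have "\<chi> ?t * \<chi> (?u x) = \<chi> (?u (2 * x)) * \<chi> ?t"
    using \<chi>_mult[OF t u] \<chi>_mult[OF u t] by metis
  then have conj: "\<chi> (?u x) = \<chi> (?u (2 * x))" using nonzero[OF t] by simp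
  have "?u x * ?u x = addrow x l k (?u x)"
    using kl by (intro addrow_mat[symmetric, of _ n n]) auto
  also have "\<dots> = ?u (2 * x)"
    using kl by (intro eq_matI) auto
  finally have "\<chi> (?u (2 * x)) = \<chi> (?u x) * \<chi> (?u x)"
    using \<chi>_mult[OF u u] by metis
  then show "\<chi> (?u x) = 1" using conj nonzero[OF u, of x] by simp
qed

text \<open>The determinant vanishes only at the finitely many eigenvalues, so \<open>g\<close> is a
  limit of invertible matrices obtained by subtracting small scalars.\<close>

lemma eventually_det_char_matrix_nonzero:
  fixes g :: "complex mat"
  assumes "g \<in> carrier_mat n n"
  shows "eventually (\<lambda>z. det (char_matrix g z) \<noteq> 0) (at 0)"
proof -
  have "char_poly g \<noteq> 0" using degree_monic_char_poly[OF assms] by auto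
  then have "finite {z. poly (char_poly g) z = 0}" by (rule poly_roots_finite)
  then have "eventually (\<lambda>z. \<forall>y\<in>{z. poly (char_poly g) z = 0}. z \<noteq> y) (at 0)"
    by (rule eventually_ball_finite) (simp add: eventually_neq_at_within)
  then have "eventually (\<lambda>z. poly (char_poly g) z \<noteq> 0) (at 0)"
    by (rule eventually_mono) blast
  then show ?thesis
    by (simp flip: eigenvalue_root_char_poly[OF assms] add: eigenvalue_det[OF assms])
qed

text \<open>Invariance can be derived from \<open>f\<close> only where \<open>g\<close> has an
  inverse. Both sides are continuous, and invertible matrices are dense.\<close>

lemma unipotent_invariantI:
  assumes inv: "\<And>g x k l. g \<in> carrier_mat n n \<Longrightarrow> det g \<noteq> 0 \<Longrightarrow> l < k \<Longrightarrow> k < n \<Longrightarrow>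
    word_sum n d a (addcol x k l g) = word_sum n d a g"
  shows "unipotent_invariant n d a"
  unfolding unipotent_invariant_def
proof (intro ballI allI impI)
  fix g :: "complex mat" and x k l assume g: "g \<in> carrier_mat n n" and kl: "l < k" "k < n"
  let ?G = "char_matrix g"
  have lim: "((\<lambda>z. ?G z $$ (i, j)) \<longlongrightarrow> g $$ (i, j)) (at 0)" if "i < n" "j < n" for i j
  proof -
    have "((\<lambda>z. g $$ (i, j) + - z * 1\<^sub>m n $$ (i, j)) \<longlongrightarrow> g $$ (i, j) + - 0 * 1\<^sub>m n $$ (i, j)) (at 0)"
      by (intro tendsto_intros)
    then show ?thesis using g that by (simp add: char_matrix_def)
  qed
  have lim': "((\<lambda>z. addcol x k l (?G z) $$ (i, j)) \<longlongrightarrow> addcol x k l g $$ (i, j)) (at 0)"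
    if ij: "i < n" "j < n" for i j
  proof (cases "j = k")
    case True
    have "((\<lambda>z. x * ?G z $$ (i, l) + ?G z $$ (i, j)) \<longlongrightarrow> x * g $$ (i, l) + g $$ (i, j)) (at 0)"
      using ij kl by (intro tendsto_add tendsto_mult tendsto_const lim) auto
    then show ?thesis using True ij kl g by (simp add: char_matrix_def)
  next
    case False
    then show ?thesis using lim[OF ij] ij g by (simp add: char_matrix_def)
  qed
  have "eventually (\<lambda>z. word_sum n d a (?G z) = word_sum n d a (addcol x k l (?G z))) (at 0)"
    using eventually_det_char_matrix_nonzero[OF g]
  proof (rule eventually_mono)
    fix z assume "det (?G z) \<noteq> 0"
    moreover have "?G z \<in> carrier_mat n n" using g by simp
    ultimately show "word_sum n d a (?G z) = word_sum n d a (addcol x k l (?G z))"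
      using inv kl by simp
  qed
  with word_sum_tendsto[OF lim]
  have "((\<lambda>z. word_sum n d a (addcol x k l (?G z))) \<longlongrightarrow> word_sum n d a g) (at 0)"
    by (rule Lim_transform_eventually)
  with word_sum_tendsto[OF lim'] show "word_sum n d a (addcol x k l g) = word_sum n d a g"
    by (rule tendsto_unique[OF at_neq_bot])
qed

section \<open>Semi-invariants lie in the generated algebra\<close>

lemma semi_invariant_in_gen_alg:
  assumes n: "n \<ge> 1" and \<chi>: "\<chi> \<in> borel_characters n" and f: "f \<in> semi_invariants n \<chi>"
  shows "f \<in> gen_alg (nilpotent_cone n) (datum_functions n)"
proof -
  have reg: "f \<in> nilcone_regular n"
    and semi: "\<And>g N. g \<in> borel_subgroup n \<Longrightarrow> N \<in> nilpotent_cone n \<Longrightarrow> f (conj_act g N) = \<chi> g * f N"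
    using f by (auto simp: semi_invariants_def)
  obtain k0 where k0: "\<forall>k\<ge>k0. \<exists>p. bracket_poly n k p \<and> (\<forall>N\<in>nilpotent_cone n. \<forall>g\<in>carrier_mat n n. \<forall>h\<in>carrier_mat n n.
      g * h = 1\<^sub>m n \<longrightarrow> h * g = 1\<^sub>m n \<longrightarrow> p N g = f (h * N * g) * det g ^ k)"
    using nilcone_regular_bracket_poly[OF n reg] by blast
  \<comment> \<open>With \<open>k = 0\<close> the list of block sizes would be empty, which is not a
    datum.\<close>
  define k where "k = max k0 1"
  have k: "k \<ge> 1" "k \<ge> k0" by (simp_all add: k_def)
  obtain p where p: "bracket_poly n k p"
    and pf: "\<And>N g h. N \<in> nilpotent_cone n \<Longrightarrow> g \<in> carrier_mat n n \<Longrightarrow> h \<in> carrier_mat n n \<Longrightarrow>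
      g * h = 1\<^sub>m n \<Longrightarrow> h * g = 1\<^sub>m n \<Longrightarrow> p N g = f (h * N * g) * det g ^ k"
    using k0 k(2) by blast
  obtain a where a: "\<And>N g. N \<in> carrier_mat n n \<Longrightarrow> g \<in> carrier_mat n n \<Longrightarrow> word_sum n (n * k) (a N) g = p N g"
    and alg: "\<And>bs. set bs \<subseteq> {1..n} \<Longrightarrow> sum_list bs = n * k \<Longrightarrow>
      (\<lambda>N\<in>nilpotent_cone n. minor_pairing bs (a N)) \<in> gen_alg (nilpotent_cone n) (datum_functions n)"
    using bracket_poly_coefficients[OF n k(1) p] by blast
  \<comment> \<open>Replacing \<open>g\<close> by \<open>g * ?u\<close> conjugates
    \<open>h * N * g\<close> by the unipotent \<open>?v\<close>, on which the character is
    \<open>1\<close>, and leaves the determinant unchanged.\<close>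
  have invariant: "unipotent_invariant n (n * k) (a N)" if N: "N \<in> nilpotent_cone n" for N
  proof (rule unipotent_invariantI)
    fix g :: "complex mat" and x :: complex and r l
    assume g: "g \<in> carrier_mat n n" "det g \<noteq> 0" and rl: "l < r" "r < n"
    have Nc: "N \<in> carrier_mat n n" using N by (simp add: nilpotent_cone_def)
    obtain h where h: "h \<in> carrier_mat n n" "h * g = 1\<^sub>m n" "g * h = 1\<^sub>m n"
      using det_non_zero_imp_unit[OF g, of "()"] by (auto simp: Units_def ring_mat_simps)
    let ?u = "addrow_mat n x l r" and ?v = "addrow_mat n (- x) l r"
    have uv: "?u * ?v = 1\<^sub>m n" using rl addrow_mat_inv[of l n r x] by simp
    have vu: "?v * ?u = 1\<^sub>m n" using rl addrow_mat_inv[of l n r "- x"] by simp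
    have c: "?u \<in> carrier_mat n n" "?v \<in> carrier_mat n n" by simp_all
    have hNg: "h * N * g \<in> nilpotent_cone n" by (rule conj_nilpotent_cone[OF N h(1) g(1) h(2,3)])
    have "addcol x r l g = g * ?u" using addcol_mat[OF g(1), of l x r] rl by simp
    moreover have "p N (g * ?u) = f ((?v * h) * N * (g * ?u)) * det (g * ?u) ^ k"
    proof (rule pf[OF N])
      have "g * ?u * (?v * h) = g * ((?u * ?v) * h)"
        using g(1) h(1) c by (simp add: assoc_mult_mat[of _ n n _ n _ n] del: addrow_mat_carrier)
      then show "g * ?u * (?v * h) = 1\<^sub>m n" using uv h by simp
      have "?v * h * (g * ?u) = ?v * ((h * g) * ?u)"
        using g(1) h(1) c by (simp add: assoc_mult_mat[of _ n n _ n _ n] del: addrow_mat_carrier)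
      then show "?v * h * (g * ?u) = 1\<^sub>m n" using vu h c by simp
    qed (auto intro!: mult_carrier_mat[of _ n n] g(1) h(1))
    moreover have "(?v * h) * N * (g * ?u) = ?v * (h * N * g) * ?u"
      using g(1) h(1) c Nc by (simp add: assoc_mult_mat[of _ n n _ n _ n] del: addrow_mat_carrier)
    moreover have "?v * (h * N * g) * ?u = conj_act ?v (h * N * g)"
      by (rule conj_act_eq[OF c(2,1) vu, symmetric])
    moreover have "f (conj_act ?v (h * N * g)) = f (h * N * g)"
      using semi[OF borel_character_addrow(1)[OF \<chi> rl] hNg] borel_character_addrow(2)[OF \<chi> rl] by simp
    moreover have "det (g * ?u) = det g"
      using det_mult[OF g(1) c(1)] det_addrow_mat[of l r n x] rl by simp
    ultimately have "p N (addcol x r l g) = p N g"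
      using pf[OF N g(1) h(1) h(3,2)] by simp
    moreover have "addcol x r l g \<in> carrier_mat n n" using g(1) by auto
    ultimately show "word_sum n (n * k) (a N) (addcol x r l g) = word_sum n (n * k) (a N) g"
      using a[OF Nc, of "addcol x r l g"] a[OF Nc g(1)] by simp
  qed
  obtain \<Lambda> where \<Lambda>: "finite \<Lambda>"
    "\<And>\<mu>. \<mu> \<in> \<Lambda> \<Longrightarrow> set (conjugate_partition n \<mu>) \<subseteq> {1..n} \<and> sum_list (conjugate_partition n \<mu>) = n * k"
    "\<And>a. unipotent_invariant n (n * k) a \<Longrightarrow> word_sum n (n * k) a (1\<^sub>m n) =
      (\<Sum>\<mu>\<in>\<Lambda>. minor_pairing (conjugate_partition n \<mu>) a /
        minor_pairing (conjugate_partition n \<mu>) (minor_coeff (conjugate_partition n \<mu>)))"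
    using unipotent_invariant_value[OF n, of "n * k"] by blast
  let ?c = "\<lambda>\<mu>. inverse (minor_pairing (conjugate_partition n \<mu>) (minor_coeff (conjugate_partition n \<mu>)))"
  have "(\<lambda>N\<in>nilpotent_cone n. \<Sum>\<mu>\<in>\<Lambda>. ?c \<mu> * minor_pairing (conjugate_partition n \<mu>) (a N))
      \<in> gen_alg (nilpotent_cone n) (datum_functions n)"
    using \<Lambda>(2) by (intro gen_alg_sum gen_alg_cmult alg) auto
  moreover have "(\<Sum>\<mu>\<in>\<Lambda>. ?c \<mu> * minor_pairing (conjugate_partition n \<mu>) (a N)) = f N"
    if N: "N \<in> nilpotent_cone n" for N
  proof -
    have Nc: "N \<in> carrier_mat n n" using N by (simp add: nilpotent_cone_def)
    have "f N = p N (1\<^sub>m n)"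
      using pf[OF N, of "1\<^sub>m n" "1\<^sub>m n"] Nc by simp
    also have "\<dots> = word_sum n (n * k) (a N) (1\<^sub>m n)" using a[OF Nc] by simp
    also have "\<dots> = (\<Sum>\<mu>\<in>\<Lambda>. minor_pairing (conjugate_partition n \<mu>) (a N) /
        minor_pairing (conjugate_partition n \<mu>) (minor_coeff (conjugate_partition n \<mu>)))"
      by (rule \<Lambda>(3)[OF invariant[OF N]])
    finally show ?thesis by (simp add: divide_inverse mult.commute)
  qed
  ultimately have "(\<lambda>N\<in>nilpotent_cone n. f N) \<in> gen_alg (nilpotent_cone n) (datum_functions n)"
    by (rule gen_alg_cong)
  moreover have "f \<in> extensional (nilpotent_cone n)"
    using reg gen_alg_extensional by (auto simp: nilcone_regular_def)
  ultimately show ?thesis by (simp add: extensional_restrict)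
qed

section \<open>The sum of the spaces of semi-invariants is a ring\<close>

lemma semi_invariants_extensional: "f \<in> semi_invariants n \<chi> \<Longrightarrow> f \<in> extensional (nilpotent_cone n)"
  using gen_alg_extensional by (auto simp: semi_invariants_def nilcone_regular_def)

lemma semi_invariant_ring_single:
  assumes "\<chi> \<in> borel_characters n" "f \<in> semi_invariants n \<chi>"
  shows "f \<in> semi_invariant_ring n"
proof -
  have "f = (\<lambda>N\<in>nilpotent_cone n. \<Sum>\<chi>\<in>{\<chi>}. f N)"
    using extensional_restrict[OF semi_invariants_extensional[OF assms(2)]] by simp
  then show ?thesis
    using assms unfolding semi_invariant_ring_def
    by (intro CollectI exI[of _ "{\<chi>}"] exI[of _ "\<lambda>_. f"]) auto
qed

lemma semi_invariants_plus:
  assumes "f \<in> semi_invariants n \<chi>" "h \<in> semi_invariants n \<chi>"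
  shows "(\<lambda>N\<in>nilpotent_cone n. f N + h N) \<in> semi_invariants n \<chi>"
  using assms gen_alg.add[of f "nilpotent_cone n" "entry_functions n" h] conj_act_nilpotent_cone[of _ n]
  by (auto simp: semi_invariants_def nilcone_regular_def distrib_left)

lemma semi_invariants_zero: "(\<lambda>N\<in>nilpotent_cone n. 0) \<in> semi_invariants n \<chi>"
  using gen_alg.const[of 0 "nilpotent_cone n" "entry_functions n"] conj_act_nilpotent_cone[of _ n]
  by (auto simp: semi_invariants_def nilcone_regular_def)

lemma semi_invariant_ring_plus:
  assumes "f \<in> semi_invariant_ring n" "h \<in> semi_invariant_ring n"
  shows "(\<lambda>N\<in>nilpotent_cone n. f N + h N) \<in> semi_invariant_ring n"
proof -
  let ?Z = "\<lambda>N\<in>nilpotent_cone n. 0 :: complex"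
  obtain X F where X: "finite X" "X \<subseteq> borel_characters n" "\<forall>\<chi>\<in>X. F \<chi> \<in> semi_invariants n \<chi>"
    and f: "f = (\<lambda>N\<in>nilpotent_cone n. \<Sum>\<chi>\<in>X. F \<chi> N)"
    using assms(1) by (auto simp: semi_invariant_ring_def)
  obtain Y H where Y: "finite Y" "Y \<subseteq> borel_characters n" "\<forall>\<chi>\<in>Y. H \<chi> \<in> semi_invariants n \<chi>"
    and h: "h = (\<lambda>N\<in>nilpotent_cone n. \<Sum>\<chi>\<in>Y. H \<chi> N)"
    using assms(2) by (auto simp: semi_invariant_ring_def)
  define K where "K \<chi> = (\<lambda>N\<in>nilpotent_cone n. (if \<chi> \<in> X then F \<chi> else ?Z) N + (if \<chi> \<in> Y then H \<chi> else ?Z) N)" for \<chi>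
  have K: "K \<chi> \<in> semi_invariants n \<chi>" for \<chi>
    unfolding K_def using X(3) Y(3) semi_invariants_zero by (intro semi_invariants_plus) auto
  have "(\<Sum>\<chi>\<in>X \<union> Y. K \<chi> N) = f N + h N" if N: "N \<in> nilpotent_cone n" for N
  proof -
    have "(\<Sum>\<chi>\<in>X \<union> Y. K \<chi> N) = (\<Sum>\<chi>\<in>X \<union> Y. if \<chi> \<in> X then F \<chi> N else 0) + (\<Sum>\<chi>\<in>X \<union> Y. if \<chi> \<in> Y then H \<chi> N else 0)"
      using N unfolding sum.distrib[symmetric] by (intro sum.cong refl) (simp add: K_def)
    also have "(\<Sum>\<chi>\<in>X \<union> Y. if \<chi> \<in> X then F \<chi> N else 0) = (\<Sum>\<chi>\<in>X. F \<chi> N)"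
      using X(1) Y(1) by (intro sum.mono_neutral_cong_right) auto
    also have "(\<Sum>\<chi>\<in>X \<union> Y. if \<chi> \<in> Y then H \<chi> N else 0) = (\<Sum>\<chi>\<in>Y. H \<chi> N)"
      using X(1) Y(1) by (intro sum.mono_neutral_cong_right) auto
    finally show ?thesis using N by (simp add: f h)
  qed
  then have "(\<lambda>N\<in>nilpotent_cone n. f N + h N) = (\<lambda>N\<in>nilpotent_cone n. \<Sum>\<chi>\<in>X \<union> Y. K \<chi> N)"
    by (intro restrict_ext) simp
  then show ?thesis
    using X Y K unfolding semi_invariant_ring_def
    by (intro CollectI exI[of _ "X \<union> Y"] exI[of _ K]) auto
qed

lemma borel_characters_one: "(\<lambda>g\<in>borel_subgroup n. 1) \<in> borel_characters n"
  using gen_alg.const[of 1 "borel_subgroup n"] borel_subgroup_mult[of _ n]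
  by (auto simp: borel_characters_def borel_regular_def)

lemma semi_invariant_ring_const: "(\<lambda>N\<in>nilpotent_cone n. c) \<in> semi_invariant_ring n"
  by (rule semi_invariant_ring_single[OF borel_characters_one])
    (use gen_alg.const[of c "nilpotent_cone n" "entry_functions n"] conj_act_nilpotent_cone[of _ n]
      in \<open>auto simp: semi_invariants_def nilcone_regular_def\<close>)

lemma semi_invariant_ring_sum:
  "(\<And>i. i \<in> I \<Longrightarrow> (\<lambda>N\<in>nilpotent_cone n. f i N) \<in> semi_invariant_ring n) \<Longrightarrow>
    (\<lambda>N\<in>nilpotent_cone n. \<Sum>i\<in>I. f i N) \<in> semi_invariant_ring n"
proof (induction I rule: infinite_finite_induct)
  case (insert i I)
  then have "(\<lambda>N\<in>nilpotent_cone n. (\<lambda>N\<in>nilpotent_cone n. f i N) N + (\<lambda>N\<in>nilpotent_cone n. \<Sum>i\<in>I. f i N) N)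
      \<in> semi_invariant_ring n"
    by (intro semi_invariant_ring_plus) auto
  moreover have "(\<lambda>N\<in>nilpotent_cone n. (\<lambda>N\<in>nilpotent_cone n. f i N) N + (\<lambda>N\<in>nilpotent_cone n. \<Sum>i\<in>I. f i N) N) =
      (\<lambda>N\<in>nilpotent_cone n. \<Sum>i\<in>insert i I. f i N)"
    using insert.hyps by (intro restrict_ext) simp
  ultimately show ?case by (simp only:)
next
  case (infinite I)
  show ?case unfolding sum.infinite[OF infinite(1)] by (rule semi_invariant_ring_const)
next
  case empty
  show ?case unfolding sum.empty by (rule semi_invariant_ring_const)
qed

lemma borel_characters_times:
  assumes "\<chi> \<in> borel_characters n" "\<psi> \<in> borel_characters n"
  shows "(\<lambda>g\<in>borel_subgroup n. \<chi> g * \<psi> g) \<in> borel_characters n"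
proof -
  have "(\<lambda>g\<in>borel_subgroup n. \<chi> g * \<psi> g) \<in> borel_regular n"
    using assms gen_alg.mult[of \<chi> "borel_subgroup n" _ \<psi>] by (simp add: borel_characters_def borel_regular_def)
  then show ?thesis
    using assms borel_subgroup_mult[of _ n] by (auto simp: borel_characters_def)
qed

lemma semi_invariant_ring_times:
  assumes "f \<in> semi_invariant_ring n" "h \<in> semi_invariant_ring n"
  shows "(\<lambda>N\<in>nilpotent_cone n. f N * h N) \<in> semi_invariant_ring n"
proof -
  obtain X F where X: "finite X" "X \<subseteq> borel_characters n" "\<forall>\<chi>\<in>X. F \<chi> \<in> semi_invariants n \<chi>"
    and f: "f = (\<lambda>N\<in>nilpotent_cone n. \<Sum>\<chi>\<in>X. F \<chi> N)"
    using assms(1) by (auto simp: semi_invariant_ring_def)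
  obtain Y H where Y: "finite Y" "Y \<subseteq> borel_characters n" "\<forall>\<chi>\<in>Y. H \<chi> \<in> semi_invariants n \<chi>"
    and h: "h = (\<lambda>N\<in>nilpotent_cone n. \<Sum>\<chi>\<in>Y. H \<chi> N)"
    using assms(2) by (auto simp: semi_invariant_ring_def)
  \<comment> \<open>Different pairs \<open>(\<chi>, \<psi>)\<close> may have the same product
    character, so each product is placed in the ring by itself and closure under sums collects
    them.\<close>
  have "(\<lambda>N\<in>nilpotent_cone n. F \<chi> N * H \<psi> N) \<in> semi_invariant_ring n" if "\<chi> \<in> X" "\<psi> \<in> Y" for \<chi> \<psi>
  proof (rule semi_invariant_ring_single)
    show "(\<lambda>g\<in>borel_subgroup n. \<chi> g * \<psi> g) \<in> borel_characters n"
      using X Y that by (intro borel_characters_times) auto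
    have "F \<chi> \<in> semi_invariants n \<chi>" "H \<psi> \<in> semi_invariants n \<psi>" using X Y that by auto
    then show "(\<lambda>N\<in>nilpotent_cone n. F \<chi> N * H \<psi> N) \<in> semi_invariants n (\<lambda>g\<in>borel_subgroup n. \<chi> g * \<psi> g)"
      using gen_alg.mult[of "F \<chi>" "nilpotent_cone n" "entry_functions n" "H \<psi>"] conj_act_nilpotent_cone[of _ n]
      by (auto simp: semi_invariants_def nilcone_regular_def)
  qed
  then have "(\<lambda>N\<in>nilpotent_cone n. \<Sum>u\<in>X \<times> Y. F (fst u) N * H (snd u) N) \<in> semi_invariant_ring n"
    by (intro semi_invariant_ring_sum) auto
  moreover have "(\<lambda>N\<in>nilpotent_cone n. \<Sum>u\<in>X \<times> Y. F (fst u) N * H (snd u) N) = (\<lambda>N\<in>nilpotent_cone n. f N * h N)"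
    by (intro restrict_ext) (simp add: f h sum_product sum.cartesian_product split_beta)
  ultimately show ?thesis by simp
qed

section \<open>Datum functions are regular semi-invariants\<close>

lemma nilcone_regular_entry:
  assumes "i < n" "j < n"
  shows "(\<lambda>N\<in>nilpotent_cone n. N $$ (i, j)) \<in> nilcone_regular n"
  unfolding nilcone_regular_def by (rule gen_alg.gen) (use assms in \<open>auto simp: entry_functions_def\<close>)

lemma nilcone_regular_pow_entry:
  assumes "i < n" "j < n"
  shows "(\<lambda>N\<in>nilpotent_cone n. (N ^\<^sub>m k) $$ (i, j)) \<in> nilcone_regular n"
  using assms
proof (induction k arbitrary: i j)
  case 0
  have "(\<lambda>N\<in>nilpotent_cone n. (if i = j then 1 else 0)) \<in> nilcone_regular n"
    unfolding nilcone_regular_def by (rule gen_alg.const)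
  moreover have "(if i = j then 1 else 0) = (N ^\<^sub>m 0) $$ (i, j)" if "N \<in> nilpotent_cone n" for N
    using that 0 by (auto simp: nilpotent_cone_def)
  ultimately show ?case unfolding nilcone_regular_def by (rule gen_alg_cong)
next
  case (Suc k)
  have "(\<lambda>N\<in>nilpotent_cone n. \<Sum>r<n. (N ^\<^sub>m k) $$ (i, r) * N $$ (r, j)) \<in> nilcone_regular n"
    unfolding nilcone_regular_def
  proof (intro gen_alg_sum gen_alg_times)
    fix r assume "r \<in> {..<n}"
    then show "(\<lambda>N\<in>nilpotent_cone n. (N ^\<^sub>m k) $$ (i, r)) \<in> gen_alg (nilpotent_cone n) (entry_functions n)"
      "(\<lambda>N\<in>nilpotent_cone n. N $$ (r, j)) \<in> gen_alg (nilpotent_cone n) (entry_functions n)"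
      using Suc.IH[of i r] nilcone_regular_entry[of r n j] Suc.prems
      unfolding nilcone_regular_def lessThan_iff by blast+
  qed
  moreover have "(\<Sum>r<n. (N ^\<^sub>m k) $$ (i, r) * N $$ (r, j)) = (N ^\<^sub>m Suc k) $$ (i, j)"
    if "N \<in> nilpotent_cone n" for N
    using that Suc.prems pow_carrier_mat[of N n k]
    by (auto simp: nilpotent_cone_def scalar_prod_def atLeast0LessThan)
  ultimately show ?case unfolding nilcone_regular_def by (rule gen_alg_cong)
qed

lemma datum_matrix_eq_blockwise_mat:
  assumes N: "N \<in> carrier_mat n n" and as: "set as \<subseteq> {1..n}" and bs: "set bs \<subseteq> {1..n}"
  shows "datum_matrix as bs P N = blockwise_mat as bs (\<lambda>i j p q. poly_at_mat (P i j) N $$ (n - as ! i + p, q))"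
  unfolding datum_matrix_def block_matrix_eq_blockwise_mat
proof (rule blockwise_mat_cong)
  fix i j p q assume "i < length as" "j < length bs" "p < as ! i" "q < bs ! j"
  then show "corner_submatrix (as ! i) (bs ! j) (poly_at_mat (P i j) N) $$ (p, q) =
      poly_at_mat (P i j) N $$ (n - as ! i + p, q)"
    using N by (simp add: corner_submatrix_def poly_at_mat_def)
qed

lemma datum_function_regular:
  assumes "is_datum n as bs"
  shows "datum_function n as bs P \<in> nilcone_regular n"
proof -
  have as: "set as \<subseteq> {1..n}" and bs: "set bs \<subseteq> {1..n}" and eq: "sum_list bs = sum_list as"
    using assms by (auto simp: is_datum_def)
  let ?d = "sum_list as"
  let ?e = "\<lambda>N x y. \<Sum>k\<le>degree (P (block_of as x) (block_of bs y)). coeff (P (block_of as x) (block_of bs y)) k *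
    (N ^\<^sub>m k) $$ (n - as ! block_of as x + pos_of as x, pos_of bs y)"
  have idx: "n - as ! block_of as x + pos_of as x < n" "pos_of bs y < n" if "x < ?d" "y < ?d" for x y
  proof -
    have "as ! block_of as x \<in> set as" using block_of_less[OF that(1)] by simp
    then have "as ! block_of as x \<le> n" using as by auto
    then show "n - as ! block_of as x + pos_of as x < n" using pos_of_less[OF that(1)] by simp
    show "pos_of bs y < n" using that eq by (intro pos_of_less_bound[OF _ bs]) simp
  qed
  have "(\<lambda>N\<in>nilpotent_cone n. \<Sum>p | p permutes {..<?d}. signof p * (\<Prod>y<?d. ?e N (p y) y)) \<in> nilcone_regular n"
    unfolding nilcone_regular_def
  proof (intro gen_alg_sum gen_alg_cmult gen_alg_prod)
    fix p y k assume "p \<in> {p. p permutes {..<?d}}" and y: "y \<in> {..<?d}"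
    then have "p y < ?d" using permutes_in_image[of p "{..<?d}" y] by simp
    then show "(\<lambda>N\<in>nilpotent_cone n. (N ^\<^sub>m k) $$ (n - as ! block_of as (p y) + pos_of as (p y), pos_of bs y))
        \<in> gen_alg (nilpotent_cone n) (entry_functions n)"
      using nilcone_regular_pow_entry[OF idx] y unfolding nilcone_regular_def by blast
  qed
  moreover have "(\<Sum>p | p permutes {..<?d}. signof p * (\<Prod>y<?d. ?e N (p y) y)) = det (datum_matrix as bs P N)"
    if N: "N \<in> nilpotent_cone n" for N
  proof -
    have Nc: "N \<in> carrier_mat n n" using N by (simp add: nilpotent_cone_def)
    have "datum_matrix as bs P N = mat ?d ?d (\<lambda>(x, y). ?e N x y)"
      unfolding datum_matrix_eq_blockwise_mat[OF Nc as bs] blockwise_mat_def eq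
      using idx Nc by (intro eq_matI) (auto simp: poly_at_mat_def)
    then show ?thesis by (simp only: det_mat_col_expansion)
  qed
  ultimately show ?thesis unfolding nilcone_regular_def datum_function_def by (rule gen_alg_cong)
qed

lemma borel_diag_nonzero:
  assumes g: "g \<in> borel_subgroup n"
  shows "det g = (\<Prod>i<n. g $$ (i, i))" "i < n \<Longrightarrow> g $$ (i, i) \<noteq> 0"
proof -
  have gc: "g \<in> carrier_mat n n" "upper_triangular g" using g by (auto simp: borel_subgroup_def)
  show det: "det g = (\<Prod>i<n. g $$ (i, i))"
    using det_upper_triangular[OF gc(2,1)] gc(1) by (simp add: prod_list_diag_prod atLeast0LessThan)
  obtain h where h: "h \<in> carrier_mat n n" "g * h = 1\<^sub>m n" using borel_subgroup_inverse[OF g] .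
  then have "det g * det h = 1" using det_mult[OF gc(1) h(1)] by simp
  then have "det g \<noteq> 0" by auto
  then show "g $$ (i, i) \<noteq> 0" if "i < n" using det that by auto
qed

lemma borel_mult_diag:
  assumes g: "g \<in> borel_subgroup n" and h: "h \<in> borel_subgroup n" and i: "i < n"
  shows "(g * h) $$ (i, i) = g $$ (i, i) * h $$ (i, i)"
proof -
  have c: "g \<in> carrier_mat n n" "upper_triangular g" "h \<in> carrier_mat n n" "upper_triangular h"
    using g h by (auto simp: borel_subgroup_def)
  have "(g * h) $$ (i, i) = (\<Sum>k<n. g $$ (i, k) * h $$ (k, i))"
    using c i by (simp add: scalar_prod_def atLeast0LessThan)
  also have "\<dots> = (\<Sum>k\<in>{i}. g $$ (i, k) * h $$ (k, i))"
  proof (rule sum.mono_neutral_right)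
    show "\<forall>k\<in>{..<n} - {i}. g $$ (i, k) * h $$ (k, i) = 0"
    proof
      fix k assume "k \<in> {..<n} - {i}"
      then consider "k < i" | "i < k" "k < n" by force
      then show "g $$ (i, k) * h $$ (k, i) = 0"
        using upper_triangularD[OF c(2), of k i] upper_triangularD[OF c(4), of i k] c i by cases auto
    qed
  qed (use i in auto)
  finally show ?thesis by simp
qed

text \<open>The inverse of a diagonal entry is regular because it equals the inverse of
  \<open>det g\<close> times the product of the other diagonal entries.\<close>

lemma borel_character_diag:
  assumes i: "i < n"
  shows "(\<lambda>g\<in>borel_subgroup n. g $$ (i, i)) \<in> borel_characters n"
    and "(\<lambda>g\<in>borel_subgroup n. inverse (g $$ (i, i))) \<in> borel_characters n"
proof -
  let ?G = "insert (\<lambda>g. inverse (det g)) (entry_functions n)"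
  have entry: "(\<lambda>g\<in>borel_subgroup n. g $$ (j, j)) \<in> gen_alg (borel_subgroup n) ?G" if "j < n" for j
    by (rule gen_alg.gen) (use that in \<open>auto simp: entry_functions_def\<close>)
  then show "(\<lambda>g\<in>borel_subgroup n. g $$ (i, i)) \<in> borel_characters n"
    using i borel_diag_nonzero(2)[of _ n i] borel_mult_diag[of _ n _ i] borel_subgroup_mult[of _ n]
    by (auto simp: borel_characters_def borel_regular_def)
  have "(\<lambda>g\<in>borel_subgroup n. inverse (det g)) \<in> gen_alg (borel_subgroup n) ?G"
    by (rule gen_alg.gen) simp
  then have "(\<lambda>g\<in>borel_subgroup n. inverse (det g) * (\<Prod>j\<in>{..<n} - {i}. g $$ (j, j))) \<in> gen_alg (borel_subgroup n) ?G"
    using entry by (intro gen_alg_times gen_alg_prod) auto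
  moreover have "inverse (det g) * (\<Prod>j\<in>{..<n} - {i}. g $$ (j, j)) = inverse (g $$ (i, i))"
    if g: "g \<in> borel_subgroup n" for g
  proof -
    have "det g = g $$ (i, i) * (\<Prod>j\<in>{..<n} - {i}. g $$ (j, j))"
      unfolding borel_diag_nonzero(1)[OF g] using i by (intro prod.remove) auto
    moreover have "(\<Prod>j\<in>{..<n} - {i}. g $$ (j, j)) \<noteq> 0"
      using borel_diag_nonzero(2)[OF g] by simp
    ultimately show ?thesis by simp
  qed
  ultimately have "(\<lambda>g\<in>borel_subgroup n. inverse (g $$ (i, i))) \<in> borel_regular n"
    unfolding borel_regular_def by (rule gen_alg_cong)
  then show "(\<lambda>g\<in>borel_subgroup n. inverse (g $$ (i, i))) \<in> borel_characters n"
    using i borel_diag_nonzero(2)[of _ n i] borel_mult_diag[of _ n _ i] borel_subgroup_mult[of _ n]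
    by (auto simp: borel_characters_def)
qed

lemma borel_characters_prod:
  assumes "\<And>x. x \<in> X \<Longrightarrow> (\<lambda>g\<in>borel_subgroup n. \<chi> x g) \<in> borel_characters n"
  shows "(\<lambda>g\<in>borel_subgroup n. \<Prod>x\<in>X. \<chi> x g) \<in> borel_characters n"
  using assms
proof (induction X rule: infinite_finite_induct)
  case (insert x X)
  have "(\<lambda>g\<in>borel_subgroup n. \<Prod>x\<in>insert x X. \<chi> x g) =
      (\<lambda>g\<in>borel_subgroup n. (\<lambda>g\<in>borel_subgroup n. \<chi> x g) g * (\<lambda>g\<in>borel_subgroup n. \<Prod>x\<in>X. \<chi> x g) g)"
    using insert.hyps by (intro restrict_ext) simp
  then show ?case using insert by (simp only: borel_characters_times insertI1 insertI2)
next
  case (infinite X)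
  show ?case unfolding prod.infinite[OF infinite(1)] by (rule borel_characters_one)
next
  case empty
  show ?case unfolding prod.empty by (rule borel_characters_one)
qed

text \<open>In this intertwining form only \<open>g\<close> occurs outside the polynomial, once on
  each side, which suits the restriction to last rows and first columns.\<close>

lemma poly_at_mat_conj:
  assumes N: "N \<in> carrier_mat n n" and g: "g \<in> carrier_mat n n" and h: "h \<in> carrier_mat n n"
    and gh: "g * h = 1\<^sub>m n" "h * g = 1\<^sub>m n"
  shows "poly_at_mat P (g * N * h) * g = g * poly_at_mat P N"
proof (rule eq_matI)
  fix i j assume "i < dim_row (g * poly_at_mat P N)" "j < dim_col (g * poly_at_mat P N)"
  then have ij: "i < n" "j < n" using g N by (simp_all add: poly_at_mat_def)
  have wit: "similar_mat_wit (g * N * h) N g h"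
    using N g h gh by (auto simp: similar_mat_wit_def Let_def)
  have pow: "(g * N * h) ^\<^sub>m k * g = g * N ^\<^sub>m k" for k
  proof -
    have Nk: "N ^\<^sub>m k \<in> carrier_mat n n" using N by (rule pow_carrier_mat)
    have "(g * N * h) ^\<^sub>m k * g = g * N ^\<^sub>m k * h * g"
      using similar_mat_wit_pow_id[OF wit] by simp
    also have "\<dots> = g * N ^\<^sub>m k * (h * g)"
      using Nk g h by (intro assoc_mult_mat[of _ n n _ n _ n]) auto
    also have "\<dots> = g * N ^\<^sub>m k"
      unfolding gh(2) using Nk g by (intro right_mult_one_mat[of _ n n]) simp
    finally show ?thesis .
  qed
  have entry: "(\<Sum>r<n. A $$ (i, r) * B $$ (r, j)) = (A * B) $$ (i, j)"
    if "A \<in> carrier_mat n n" "B \<in> carrier_mat n n" for A B :: "complex mat"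
    using that ij by (simp add: scalar_prod_def atLeast0LessThan)
  have gNh: "g * N * h \<in> carrier_mat n n" using N g h by simp
  have "(poly_at_mat P (g * N * h) * g) $$ (i, j) =
      (\<Sum>r<n. (\<Sum>k\<le>degree P. coeff P k * ((g * N * h) ^\<^sub>m k) $$ (i, r)) * g $$ (r, j))"
    using gNh g ij by (simp add: poly_at_mat_def scalar_prod_def atLeast0LessThan)
  also have "\<dots> = (\<Sum>r<n. \<Sum>k\<le>degree P. coeff P k * (((g * N * h) ^\<^sub>m k) $$ (i, r) * g $$ (r, j)))"
    by (simp only: sum_distrib_right mult.assoc)
  also have "\<dots> = (\<Sum>k\<le>degree P. \<Sum>r<n. coeff P k * (((g * N * h) ^\<^sub>m k) $$ (i, r) * g $$ (r, j)))"
    by (rule sum.swap)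
  also have "\<dots> = (\<Sum>k\<le>degree P. \<Sum>r<n. coeff P k * (g $$ (i, r) * (N ^\<^sub>m k) $$ (r, j)))"
    using entry[OF pow_carrier_mat[OF gNh] g] entry[OF g pow_carrier_mat[OF N]]
    by (simp only: pow flip: sum_distrib_left)
  also have "\<dots> = (\<Sum>r<n. \<Sum>k\<le>degree P. coeff P k * (g $$ (i, r) * (N ^\<^sub>m k) $$ (r, j)))"
    by (rule sum.swap)
  also have "\<dots> = (\<Sum>r<n. g $$ (i, r) * (\<Sum>k\<le>degree P. coeff P k * (N ^\<^sub>m k) $$ (r, j)))"
    by (simp only: sum_distrib_left mult.left_commute)
  also have "\<dots> = (g * poly_at_mat P N) $$ (i, j)"
    using N g ij by (simp add: poly_at_mat_def scalar_prod_def atLeast0LessThan)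
  finally show "(poly_at_mat P (g * N * h) * g) $$ (i, j) = (g * poly_at_mat P N) $$ (i, j)" .
qed (use N g h in \<open>simp_all add: poly_at_mat_def\<close>)

text \<open>
  Since \<open>g\<close> is upper triangular, the last rows of \<open>g M\<close> only involve the last rows of \<open>M\<close>, and the
  first columns of \<open>M g\<close> only the first columns of \<open>M\<close>.
\<close>

lemma det_datum_matrix_conj:
  assumes datum: "is_datum n as bs" and N: "N \<in> carrier_mat n n"
    and g: "g \<in> borel_subgroup n" and h: "h \<in> carrier_mat n n" "g * h = 1\<^sub>m n" "h * g = 1\<^sub>m n"
  shows "det (datum_matrix as bs P (g * N * h)) * (\<Prod>y<sum_list bs. g $$ (pos_of bs y, pos_of bs y)) =
    (\<Prod>x<sum_list as. g $$ (n - as ! block_of as x + pos_of as x, n - as ! block_of as x + pos_of as x)) *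
    det (datum_matrix as bs P N)"
proof -
  have as: "set as \<subseteq> {1..n}" and bs: "set bs \<subseteq> {1..n}" and eq: "sum_list bs = sum_list as"
    using datum by (auto simp: is_datum_def)
  have le_as: "as ! i \<le> n" if "i < length as" for i using as nth_mem[OF that] by auto
  have le_bs: "bs ! i \<le> n" if "i < length bs" for i using bs nth_mem[OF that] by auto
  have gc: "g \<in> carrier_mat n n" and gu: "upper_triangular g" using g by (auto simp: borel_subgroup_def)
  have g0: "g $$ (i, j) = 0" if "j < i" "i < n" for i j
    using upper_triangularD[OF gu that(1)] that(2) gc by simp
  have gNh: "g * N * h \<in> carrier_mat n n" using gc N h by simp
  define Q where "Q i j = poly_at_mat (P i j) N" for i j
  define Q' where "Q' i j = poly_at_mat (P i j) (g * N * h)" for i j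
  have Qc: "Q i j \<in> carrier_mat n n" "Q' i j \<in> carrier_mat n n" for i j
    using N gc by (simp_all add: Q_def Q'_def poly_at_mat_def)
  have QQ: "Q' i j * g = g * Q i j" for i j
    unfolding Q_def Q'_def by (rule poly_at_mat_conj[OF N gc h])
  \<comment> \<open>\<open>?R\<close> collects the leading and \<open>?L\<close> the trailing
    principal submatrices of \<open>g\<close>; their determinants are the two parts of the
    weight.\<close>
  let ?R = "blockwise_mat bs bs (\<lambda>i j p q. if i = j then g $$ (p, q) else 0)"
  let ?L = "blockwise_mat as as (\<lambda>i j p q. if i = j then g $$ (n - as ! i + p, n - as ! i + q) else 0)"
  let ?D = "blockwise_mat as bs (\<lambda>i j p q. Q i j $$ (n - as ! i + p, q))"
  let ?D' = "blockwise_mat as bs (\<lambda>i j p q. Q' i j $$ (n - as ! i + p, q))"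
  have "?D' * ?R = ?L * ?D"
    unfolding blockwise_mat_mult
  proof (rule blockwise_mat_cong)
    fix i j p q assume ij: "i < length as" "j < length bs" "p < as ! i" "q < bs ! j"
    have idx: "n - as ! i + p < n" "q < n" using ij le_as[OF ij(1)] le_bs[OF ij(2)] by simp_all
    have "(\<Sum>l<length bs. \<Sum>r<bs ! l. Q' i l $$ (n - as ! i + p, r) * (if l = j then g $$ (r, q) else 0)) =
        (\<Sum>l<length bs. if l = j then \<Sum>r<bs ! j. Q' i j $$ (n - as ! i + p, r) * g $$ (r, q) else 0)"
      by (intro sum.cong refl) auto
    also have "\<dots> = (\<Sum>r<bs ! j. Q' i j $$ (n - as ! i + p, r) * g $$ (r, q))"
      using ij by simp
    also have "\<dots> = (\<Sum>r<n. Q' i j $$ (n - as ! i + p, r) * g $$ (r, q))"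
      using ij le_bs[OF ij(2)] by (intro sum.mono_neutral_left) (auto intro!: g0)
    also have "\<dots> = (Q' i j * g) $$ (n - as ! i + p, q)"
      using Qc(2)[of i j] gc idx by (simp add: scalar_prod_def atLeast0LessThan)
    also have "\<dots> = (g * Q i j) $$ (n - as ! i + p, q)" by (simp only: QQ)
    also have "\<dots> = (\<Sum>r<n. g $$ (n - as ! i + p, r) * Q i j $$ (r, q))"
      using Qc(1)[of i j] gc idx by (simp add: scalar_prod_def atLeast0LessThan)
    also have "\<dots> = (\<Sum>r\<in>{n - as ! i..<n}. g $$ (n - as ! i + p, r) * Q i j $$ (r, q))"
      using idx by (intro sum.mono_neutral_right) (auto intro!: g0)
    also have "\<dots> = (\<Sum>r<as ! i. g $$ (n - as ! i + p, n - as ! i + r) * Q i j $$ (n - as ! i + r, q))"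
      using le_as[OF ij(1)]
      by (intro sum.reindex_bij_witness[of _ "\<lambda>r. n - as ! i + r" "\<lambda>r. r - (n - as ! i)"]) auto
    also have "\<dots> = (\<Sum>l<length as. if l = i then
        \<Sum>r<as ! i. g $$ (n - as ! i + p, n - as ! i + r) * Q i j $$ (n - as ! i + r, q) else 0)"
      using ij by simp
    also have "\<dots> = (\<Sum>l<length as. \<Sum>r<as ! l.
        (if i = l then g $$ (n - as ! i + p, n - as ! i + r) else 0) * Q l j $$ (n - as ! l + r, q))"
      by (intro sum.cong refl) auto
    finally show "(\<Sum>l<length bs. \<Sum>r<bs ! l. Q' i l $$ (n - as ! i + p, r) * (if l = j then g $$ (r, q) else 0)) =
        (\<Sum>l<length as. \<Sum>r<as ! l.
        (if i = l then g $$ (n - as ! i + p, n - as ! i + r) else 0) * Q l j $$ (n - as ! l + r, q))" .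
  qed
  then have "det (?D' * ?R) = det (?L * ?D)" by simp
  moreover have carr: "?D' \<in> carrier_mat (sum_list as) (sum_list as)" "?D \<in> carrier_mat (sum_list as) (sum_list as)"
    "?R \<in> carrier_mat (sum_list as) (sum_list as)" "?L \<in> carrier_mat (sum_list as) (sum_list as)"
    by (intro carrier_matI; simp add: eq)+
  ultimately have "det ?D' * det ?R = det ?L * det ?D"
    by (simp only: det_mult[OF carr(1) carr(3)] det_mult[OF carr(4) carr(2)])
  moreover have "det ?R = (\<Prod>y<sum_list bs. g $$ (pos_of bs y, pos_of bs y))"
    by (subst det_blockwise_mat_upper_triangular) (auto intro!: g0 dest: le_bs)
  moreover have "det ?L = (\<Prod>x<sum_list as. g $$ (n - as ! block_of as x + pos_of as x, n - as ! block_of as x + pos_of as x))"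
    by (subst det_blockwise_mat_upper_triangular) (auto intro!: g0 dest: le_as)
  ultimately show ?thesis
    by (simp only: datum_matrix_eq_blockwise_mat[OF N as bs] datum_matrix_eq_blockwise_mat[OF gNh as bs] Q_def Q'_def)
qed

lemma datum_function_in_semi_invariant_ring:
  assumes datum: "is_datum n as bs"
  shows "datum_function n as bs P \<in> semi_invariant_ring n"
proof -
  have as: "set as \<subseteq> {1..n}" and bs: "set bs \<subseteq> {1..n}"
    using datum by (auto simp: is_datum_def)
  let ?p = "\<lambda>x. n - as ! block_of as x + pos_of as x"
  \<comment> \<open>The weight in multiplicative form: the last \<open>as ! i\<close> diagonal
    entries for each row block, divided by the first \<open>bs ! j\<close> ones for each column
    block. The nested restrictions fit the closure lemmas for characters.\<close>
  define \<chi> where "\<chi> = (\<lambda>g\<in>borel_subgroup n. (\<lambda>g\<in>borel_subgroup n. \<Prod>x<sum_list as. g $$ (?p x, ?p x)) g *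
    (\<lambda>g\<in>borel_subgroup n. \<Prod>y<sum_list bs. inverse (g $$ (pos_of bs y, pos_of bs y)) :: complex) g)"
  have p: "?p x < n" if "x < sum_list as" for x
  proof -
    have "as ! block_of as x \<in> set as" using block_of_less[OF that] by simp
    then have "as ! block_of as x \<le> n" using as by auto
    then show ?thesis using pos_of_less[OF that] by simp
  qed
  have "\<chi> \<in> borel_characters n"
    unfolding \<chi>_def using p pos_of_less_bound[OF _ bs]
    by (intro borel_characters_times borel_characters_prod borel_character_diag) auto
  moreover have "datum_function n as bs P \<in> semi_invariants n \<chi>"
  proof -
    have "datum_function n as bs P (conj_act g N) = \<chi> g * datum_function n as bs P N"
      if g: "g \<in> borel_subgroup n" and N: "N \<in> nilpotent_cone n" for g N
    proof -
      obtain h where h: "h \<in> carrier_mat n n" "g * h = 1\<^sub>m n" "h * g = 1\<^sub>m n"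
        using borel_subgroup_inverse[OF g] .
      have gc: "g \<in> carrier_mat n n" using g by (auto simp: borel_subgroup_def)
      have Nc: "N \<in> carrier_mat n n" using N by (simp add: nilpotent_cone_def)
      have conj: "conj_act g N = g * N * h" by (rule conj_act_eq[OF gc h(1,2)])
      let ?r = "\<Prod>y<sum_list bs. g $$ (pos_of bs y, pos_of bs y)"
      have "?r \<noteq> 0" using borel_diag_nonzero(2)[OF g] pos_of_less_bound[OF _ bs] by simp
      then have det: "det (datum_matrix as bs P (conj_act g N)) =
          (\<Prod>x<sum_list as. g $$ (?p x, ?p x)) * inverse ?r * det (datum_matrix as bs P N)"
        using det_datum_matrix_conj[OF datum Nc g h, of P] conj by (simp add: field_simps)
      have "\<chi> g = (\<Prod>x<sum_list as. g $$ (?p x, ?p x)) * inverse ?r"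
        using g prod_inversef[of "\<lambda>y. g $$ (pos_of bs y, pos_of bs y)" "{..<sum_list bs}"]
        by (simp only: \<chi>_def restrict_apply' comp_def)
      then show ?thesis
        using N conj_act_nilpotent_cone[OF g N] by (simp only: datum_function_def restrict_apply' det)
    qed
    then show ?thesis using datum_function_regular[OF datum] by (simp add: semi_invariants_def)
  qed
  ultimately show ?thesis by (rule semi_invariant_ring_single)
qed

theorem theorem7p2:
  fixes n :: nat
  assumes "n \<ge> 1"
  shows "semi_invariant_ring n =
    gen_alg (nilpotent_cone n) {datum_function n as bs P | as bs P. is_datum n as bs}"
proof (intro equalityI subsetI)
  fix f assume "f \<in> semi_invariant_ring n"
  then obtain X F where X: "X \<subseteq> borel_characters n" "\<forall>\<chi>\<in>X. F \<chi> \<in> semi_invariants n \<chi>"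
    and f: "f = (\<lambda>N\<in>nilpotent_cone n. \<Sum>\<chi>\<in>X. F \<chi> N)"
    by (auto simp: semi_invariant_ring_def)
  show "f \<in> gen_alg (nilpotent_cone n) (datum_functions n)"
    unfolding f
  proof (rule gen_alg_sum)
    fix \<chi> assume "\<chi> \<in> X"
    then have F: "F \<chi> \<in> semi_invariants n \<chi>" "\<chi> \<in> borel_characters n" using X by auto
    then show "(\<lambda>N\<in>nilpotent_cone n. F \<chi> N) \<in> gen_alg (nilpotent_cone n) (datum_functions n)"
      using semi_invariant_in_gen_alg[OF assms F(2,1)] extensional_restrict[OF semi_invariants_extensional[OF F(1)]]
      by simp
  qed
next
  fix f assume "f \<in> gen_alg (nilpotent_cone n) (datum_functions n)"
  then show "f \<in> semi_invariant_ring n"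
  proof induction
    case (gen f)
    then obtain as bs P where f: "f = datum_function n as bs P" and datum: "is_datum n as bs" by blast
    have "restrict f (nilpotent_cone n) = f" by (auto simp: f datum_function_def fun_eq_iff)
    then show ?case using datum_function_in_semi_invariant_ring[OF datum, of P] by (simp only: f)
  qed (simp_all only: semi_invariant_ring_const semi_invariant_ring_plus semi_invariant_ring_times)
qed

end
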